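(* Let $\Delta$ be a triangulation of a compact connected surface without boundary, and let $S\subseteq\Delta$ be a vertex spanning subsurface. Then: (1) $S$ is extendible in $\Delta$ if and only if $S$ contains at least one edge of every triangle of $\Delta$. (2) Let $\Delta\to\Delta'$ be a vertex split. If $S$ is extendible in $\Delta$, then there is a subsurface $S'\subseteq\Delta'$ which is an extension of $S$ (in the sense of (a) or (b) below) and which is extendible in $\Delta'$.
   Context: A vertex spanning subsurface of $\Delta$ is a subcomplex $S\subseteq\Delta$ containing every vertex of $\Delta$ whose realization is a surface with boundary. Vertex split: let $v$ be a vertex of $\Delta$ with link the cycle $(x_1,x_2,\dots,x_m,x_1)$. Choose $k\neq 1$, splitting the link into the closed intervals $[x_1,x_k]$ and $[x_k,x_1]$ (in cyclic order). Replace the closed star of $v$ by the union of the cone with apex $v$ over the cycle $(x_1,\dots,x_k,v',x_1)$ and the cone with apex $v'$ over the cycle $(x_k,x_{k+1},\dots,x_m,x_1,v,x_k)$, where $v'$ is a new vertex. The result $\Delta'$ triangulates the same surface; contracting the edge $vv'$ in $\Delta'$ recovers $\Delta$. A vertex spanning subsurface $S\subseteq\Delta$ is extendible if for every vertex split $\Delta\to\Delta'$ (at a vertex $v$, with new vertex $v'$) there is a subsurface $S'\subseteq\Delta'$ such that either (a) $S'$ is obtained from $S$ by a vertex split at $v$, i.e. contracting the edge $vv'$ in $S'$ yields $S$; or (b) $S'$ is obtained from $S$ by adding a cone, with apex the new vertex $v'$, over an interval (path) in the boundary of $S$.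
   Formalization: In (b) the roles of v and v' may be swapped: S may first be relabelled by v to v', with the cone then having apex v. With apex v' only, (1) fails, e.g. for the octahedron with S the closed star of one pole plus one triangle at the other. *)

theory Defs
  imports "HOL-Analysis.Analysis" "HOL-Library.Infinite_Typeclass"
begin

section \<open>Surfaces with boundary\<close>

definition second_countable_space :: "'a topology \<Rightarrow> bool" where
  "second_countable_space X \<longleftrightarrow>
     (\<exists>B. countable B \<and> (\<forall>U\<in>B. openin X U) \<and>
          (\<forall>U x. openin X U \<and> x \<in> U \<longrightarrow> (\<exists>W\<in>B. x \<in> W \<and> W \<subseteq> U)))"

definition half_plane :: "(real \<times> real) set" where
  "half_plane = {p. 0 \<le> snd p}"

text \<open>The boundary of a surface may be empty, and a surface need not be connected.\<close>

definition surface_with_boundary :: "'a topology \<Rightarrow> bool" where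
  "surface_with_boundary X \<longleftrightarrow>
     Hausdorff_space X \<and> second_countable_space X \<and>
     (\<forall>p\<in>topspace X. \<exists>U V. openin X U \<and> p \<in> U \<and> openin (top_of_set half_plane) V \<and>
        subtopology X U homeomorphic_space top_of_set V)"

definition surface_interior :: "'a topology \<Rightarrow> 'a set" where
  "surface_interior X =
     {p \<in> topspace X. \<exists>U (V :: (real \<times> real) set). openin X U \<and> p \<in> U \<and> open V \<and>
        subtopology X U homeomorphic_space top_of_set V}"

definition surface_boundary :: "'a topology \<Rightarrow> 'a set" where
  "surface_boundary X = topspace X - surface_interior X"

definition compact_connected_surface_without_boundary :: "'a topology \<Rightarrow> bool" where
  "compact_connected_surface_without_boundary X \<longleftrightarrow>
     surface_with_boundary X \<and> surface_boundary X = {} \<and> compact_space X \<and> connected_space X"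


section \<open>Finite abstract simplicial complexes\<close>

text \<open>Only nonempty simplices are listed, so the vertex set of \<open>K\<close> is \<open>\<Union>K\<close>.\<close>

definition finite_simplicial_complex :: "'a set set \<Rightarrow> bool" where
  "finite_simplicial_complex K \<longleftrightarrow>
     finite K \<and> (\<forall>\<sigma>\<in>K. finite \<sigma> \<and> \<sigma> \<noteq> {} \<and> (\<forall>\<tau>. \<tau> \<subseteq> \<sigma> \<and> \<tau> \<noteq> {} \<longrightarrow> \<tau> \<in> K))"

text \<open>Points are given by their barycentric coordinates. The topology is the one inherited
  from the product topology on \<^typ>\<open>'a \<Rightarrow> real\<close>; for a finite complex this is the usual
  topology on the realization.\<close>

definition realization :: "'a set set \<Rightarrow> ('a \<Rightarrow> real) set" where
  "realization K =
     {f. (\<forall>x. 0 \<le> f x) \<and> {x. f x \<noteq> 0} \<in> K \<and> (\<Sum>x | f x \<noteq> 0. f x) = 1}"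

abbreviation realization_space :: "'a set set \<Rightarrow> ('a \<Rightarrow> real) topology" where
  "realization_space K \<equiv> top_of_set (realization K)"

definition triangulation_of_closed_connected_surface :: "'a set set \<Rightarrow> bool" where
  "triangulation_of_closed_connected_surface \<Delta> \<longleftrightarrow>
     finite_simplicial_complex \<Delta> \<and>
     compact_connected_surface_without_boundary (realization_space \<Delta>)"

definition subsurface :: "'a set set \<Rightarrow> 'a set set \<Rightarrow> bool" where
  "subsurface \<Delta> S \<longleftrightarrow>
     S \<subseteq> \<Delta> \<and> finite_simplicial_complex S \<and> surface_with_boundary (realization_space S)"

definition vertex_spanning_subsurface :: "'a set set \<Rightarrow> 'a set set \<Rightarrow> bool" where
  "vertex_spanning_subsurface \<Delta> S \<longleftrightarrow> subsurface \<Delta> S \<and> \<Union>\<Delta> \<subseteq> \<Union>S"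


section \<open>Vertex splits\<close>

definition link :: "'a set set \<Rightarrow> 'a \<Rightarrow> 'a set set" where
  "link K v = {\<sigma>. \<sigma> \<noteq> {} \<and> v \<notin> \<sigma> \<and> insert v \<sigma> \<in> K}"

definition closed_star :: "'a set set \<Rightarrow> 'a \<Rightarrow> 'a set set" where
  "closed_star K v = {\<tau>. \<tau> \<noteq> {} \<and> (\<exists>\<sigma>\<in>K. v \<in> \<sigma> \<and> \<tau> \<subseteq> \<sigma>)}"

definition cone_over :: "'a \<Rightarrow> 'a set set \<Rightarrow> 'a set set" where
  "cone_over v L = L \<union> insert v ` L \<union> {{v}}"

definition path_complex :: "'a list \<Rightarrow> 'a set set" where
  "path_complex xs = {{x} | x. x \<in> set xs} \<union> {{xs ! i, xs ! Suc i} | i. Suc i < length xs}"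

definition cycle_complex :: "'a list \<Rightarrow> 'a set set" where
  "cycle_complex xs = path_complex xs \<union> {{last xs, hd xs}}"

text \<open>The list \<open>xs\<close> is \<open>[x\<^sub>1, \<dots>, x\<^sub>m]\<close> (so \<open>x\<^sub>i\<close> is \<open>xs ! (i - 1)\<close>), and the two cones below are
  over the cycles \<open>(x\<^sub>1, \<dots>, x\<^sub>k, v', x\<^sub>1)\<close> and \<open>(x\<^sub>k, \<dots>, x\<^sub>m, x\<^sub>1, v, x\<^sub>k)\<close>.\<close>

definition vertex_split :: "'a set set \<Rightarrow> 'a \<Rightarrow> 'a \<Rightarrow> 'a set set \<Rightarrow> bool" where
  "vertex_split \<Delta> v v' \<Delta>' \<longleftrightarrow>
     v \<in> \<Union>\<Delta> \<and> v' \<notin> \<Union>\<Delta> \<and>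
     (\<exists>xs k. distinct xs \<and> 3 \<le> length xs \<and> link \<Delta> v = cycle_complex xs \<and>
        1 \<le> k \<and> k \<le> length xs \<and> k \<noteq> 1 \<and>
        \<Delta>' = (\<Delta> - closed_star \<Delta> v)
              \<union> cone_over v (cycle_complex (take k xs @ [v']))
              \<union> cone_over v' (cycle_complex (drop (k - 1) xs @ [hd xs, v])))"


section \<open>Extensions and extendibility\<close>

text \<open>\<open>rename_vertex a b K\<close> is the image of \<open>K\<close> under the simplicial map that sends \<open>a\<close> to \<open>b\<close>
  and fixes all other vertices. If \<open>{a, b}\<close> is an edge of \<open>K\<close>, this contracts it to the
  vertex \<open>b\<close>; if \<open>b\<close> is not a vertex of \<open>K\<close>, it is a relabelling.\<close>

definition rename_vertex :: "'a \<Rightarrow> 'a \<Rightarrow> 'a set set \<Rightarrow> 'a set set" where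
  "rename_vertex a b K = (\<lambda>\<sigma>. (\<lambda>x. if x = a then b else x) ` \<sigma>) ` K"

definition extension_by_split ::
    "'a \<Rightarrow> 'a \<Rightarrow> 'a set set \<Rightarrow> 'a set set \<Rightarrow> bool" where
  "extension_by_split v v' S S' \<longleftrightarrow> {v, v'} \<in> S' \<and> rename_vertex v' v S' = S"

text \<open>\<open>S'\<close> arises from \<open>S\<close> by adding a cone with apex the new vertex over a path in the
  boundary. In a vertex split the two endpoints of the edge \<open>vv'\<close> play symmetric roles, and
  either of them may be regarded as the old vertex \<open>v\<close> of \<open>\<Delta>\<close>: \<open>w\<close> is the one
  that is identified with it, and \<open>w'\<close> is the new one. For \<open>w = v\<close> the relabelling does nothing.
  The choice \<open>w = v'\<close> is needed when all triangles of \<open>S\<close> at \<open>v\<close> become triangles at \<open>v'\<close>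
  in \<open>\<Delta>'\<close>: then \<open>S\<close> itself is not a subcomplex of \<open>\<Delta>'\<close>, but its relabelled copy is.\<close>

definition extension_by_cone ::
    "'a \<Rightarrow> 'a \<Rightarrow> 'a set set \<Rightarrow> 'a set set \<Rightarrow> bool" where
  "extension_by_cone v v' S S' \<longleftrightarrow>
     (\<exists>w w' xs. (w, w') \<in> {(v, v'), (v', v)} \<and> distinct xs \<and> 2 \<le> length xs \<and>
        realization (path_complex xs)
          \<subseteq> surface_boundary (realization_space (rename_vertex v w S)) \<and>
        S' = rename_vertex v w S \<union> cone_over w' (path_complex xs))"

text \<open>Here \<open>\<Delta>'\<close> is the result of the vertex split of the ambient complex at \<open>v\<close>, with new
  vertex \<open>v'\<close>.\<close>

definition extension ::
    "'a set set \<Rightarrow> 'a \<Rightarrow> 'a \<Rightarrow> 'a set set \<Rightarrow> 'a set set \<Rightarrow> bool" where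
  "extension \<Delta>' v v' S S' \<longleftrightarrow>
     subsurface \<Delta>' S' \<and> (extension_by_split v v' S S' \<or> extension_by_cone v v' S S')"

definition extendible :: "'a set set \<Rightarrow> 'a set set \<Rightarrow> bool" where
  "extendible \<Delta> S \<longleftrightarrow>
     vertex_spanning_subsurface \<Delta> S \<and>
     (\<forall>v v' \<Delta>'. vertex_split \<Delta> v v' \<Delta>' \<longrightarrow> (\<exists>S'. extension \<Delta>' v v' S S'))"

end

theory Submission
  imports Defs
begin

text \<open>By invariance of domain, every disc embedded in the realization of a triangulated surface is
  open. Hence an edge lies in at most two triangles, everything is covered by triangles, and (a
  punctured half disc being connected) every vertex link is connected, so it is a path or a cycle.
  Conversely, explicit piecewise linear charts on open stars show that these combinatorial
  conditions suffice; so all constructions can be carried out with abstract complexes.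

  Let a split of \<open>v\<close> cut the link of \<open>v\<close> at \<open>p\<close> and \<open>q\<close> into two arcs, and let \<open>S\<close> meet every triangle
  in an edge. If \<open>vp\<close> or \<open>vq\<close> belongs to \<open>S\<close>, the preimage of \<open>S\<close> under the contraction of the new
  edge is a surface. Otherwise the link of \<open>v\<close> in \<open>S\<close> lies in the interior of one arc; then all edges
  of the other arc are boundary edges of \<open>S\<close>, and a cone over that arc can be added. Either way the
  new surface again meets every triangle. If conversely a triangle \<open>abc\<close> has no edge in \<open>S\<close>, then
  the split of \<open>a\<close> for which one of the arcs is the edge \<open>bc\<close> admits no extension of \<open>S\<close>.\<close>

section \<open>Surface charts and invariance of domain\<close>

text \<open>Connectedness of a link is phrased as a cut condition: every set of vertices that
  separates two link vertices is crossed by a link edge. In this form it passes to cones,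
  relabellings and contraction preimages by chasing one crossing edge, and the links of a new
  complex need not be computed. The degree bound on edges behaves differently: it is inherited by
  subcomplexes. It is therefore proved once for the split complex, and a candidate extension has
  only purity and link connectedness left to check. The same bound yields the boundary condition of
  a cone extension, since the cone already occupies one of the two places at every edge of its base.
  The distinction whether \<open>{v,p}\<close> or \<open>{v,q}\<close> lies in \<open>S\<close>
  comes from the new edge. In the contraction preimage the triangle on \<open>v\<close>,
  \<open>v'\<close> and \<open>p\<close> is present exactly when \<open>{v,p}\<close> is in
  \<open>S\<close>, and likewise for \<open>q\<close>; if both are missing, the new edge lies in no
  triangle and the preimage cannot be a surface.\<close>

lemma homeomorphic_space_top_of_set:
  "top_of_set U homeomorphic_space top_of_set V \<longleftrightarrow> (\<exists>h k. homeomorphism U V h k)"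
proof -
  have "homeomorphic_maps (top_of_set U) (top_of_set V) h k \<longleftrightarrow> homeomorphism U V h k" for h k
  proof
    assume "homeomorphic_maps (top_of_set U) (top_of_set V) h k"
    then have "continuous_on U h" "h \<in> U \<rightarrow> V" "continuous_on V k" "k \<in> V \<rightarrow> U"
      "\<forall>x\<in>U. k (h x) = x" "\<forall>y\<in>V. h (k y) = y"
      by (simp_all add: homeomorphic_maps_def continuous_map_in_subtopology)
    then show "homeomorphism U V h k"
      by (intro homeomorphismI) (auto simp: Pi_iff)
  next
    assume "homeomorphism U V h k"
    then show "homeomorphic_maps (top_of_set U) (top_of_set V) h k"
      by (auto simp: homeomorphic_maps_def continuous_map_in_subtopology homeomorphism_def)
  qed
  then show ?thesis by (simp add: homeomorphic_space_def)
qed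

lemma subtopology_homeomorphic_iff:
  assumes "openin (top_of_set R) U"
  shows "subtopology (top_of_set R) U homeomorphic_space top_of_set V \<longleftrightarrow>
    (\<exists>h k. homeomorphism U V h k)"
proof -
  have "subtopology (top_of_set R) U = top_of_set U"
    using assms by (simp add: subtopology_subtopology Int_absorb1 openin_imp_subset)
  then show ?thesis by (simp add: homeomorphic_space_top_of_set)
qed

lemma surface_with_boundary_top_of_set:
  "surface_with_boundary (top_of_set R) \<longleftrightarrow>
     Hausdorff_space (top_of_set R) \<and> second_countable_space (top_of_set R) \<and>
     (\<forall>p\<in>R. \<exists>U V h k. openin (top_of_set R) U \<and> p \<in> U \<and> openin (top_of_set half_plane) V \<and>
        homeomorphism U V h k)"
proof -
  have "(openin (top_of_set R) U \<and> p \<in> U \<and> openin (top_of_set half_plane) V \<and>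
        subtopology (top_of_set R) U homeomorphic_space top_of_set V) \<longleftrightarrow>
     (\<exists>h k. openin (top_of_set R) U \<and> p \<in> U \<and> openin (top_of_set half_plane) V \<and>
        homeomorphism U V h k)" for p U V
    using subtopology_homeomorphic_iff[of R U V] by blast
  then show ?thesis by (simp only: surface_with_boundary_def topspace_euclidean_subtopology)
qed

lemma surface_chart:
  assumes "surface_with_boundary (top_of_set R)" "p \<in> R"
  obtains U V h k where "openin (top_of_set R) U" "p \<in> U" "openin (top_of_set half_plane) V"
    "homeomorphism U V h k"
proof -
  note assms(1)[unfolded surface_with_boundary_top_of_set]
  then show ?thesis using assms(2) that by meson
qed

lemma chart_image_openin:
  assumes hk: "homeomorphism U V h k" and U: "openin (top_of_set R) U" and V: "openin (top_of_set H) V"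
    and W: "openin (top_of_set R) W"
  shows "openin (top_of_set H) (h ` (U \<inter> W))"
proof -
  have "openin (top_of_set R) (U \<inter> W)" using U W by blast
  then have "openin (top_of_set U) (U \<inter> W)"
    using U by (meson Int_lower1 openin_imp_subset openin_subset_trans)
  then have "openin (top_of_set V) (h ` (U \<inter> W))"
    using hk homeomorphism_imp_open_map by blast
  then show ?thesis using V openin_trans by metis
qed

lemma surface_interior_top_of_set:
  "surface_interior (top_of_set R) =
     {p \<in> R. \<exists>U (V :: (real \<times> real) set) h k. openin (top_of_set R) U \<and> p \<in> U \<and> open V \<and>
        homeomorphism U V h k}"
proof -
  have "(openin (top_of_set R) U \<and> p \<in> U \<and> open V \<and>
        subtopology (top_of_set R) U homeomorphic_space top_of_set V) \<longleftrightarrow>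
     (\<exists>h k. openin (top_of_set R) U \<and> p \<in> U \<and> open V \<and> homeomorphism U V h k)"
    for p U and V :: "(real \<times> real) set"
    using subtopology_homeomorphic_iff[of R U V] by blast
  then show ?thesis by (simp only: surface_interior_def topspace_euclidean_subtopology)
qed

text \<open>In a chart, \<open>h \<circ> g\<close> is a continuous injection of a planar open set
  into the plane, so its image is open in the whole plane although the chart is only modelled on the
  half plane. Pulling it back shows that a disc inside a surface with boundary is open, without
  knowing in advance that it avoids the boundary.\<close>

lemma planar_disc_open:
  fixes g :: "real \<times> real \<Rightarrow> 'b::topological_space"
  assumes R: "surface_with_boundary (top_of_set R)"
    and W: "open W" and g: "continuous_on W g" "inj_on g W" "g ` W \<subseteq> R"
  shows "openin (top_of_set R) (g ` W)"
proof (subst openin_subopen, intro ballI)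
  fix p assume p: "p \<in> g ` W"
  then have "p \<in> R" using g by auto
  then obtain U V h k where U: "openin (top_of_set R) U" "p \<in> U"
    and V: "openin (top_of_set half_plane) V" and hk: "homeomorphism U V h k"
    using surface_chart[OF R] by metis
  define W' where "W' = W \<inter> g -` U"
  obtain O' where O': "open O'" "U = R \<inter> O'" using U by (auto simp: openin_open)
  have "W' = W \<inter> g -` O'" using g O' by (auto simp: W'_def)
  then have W'o: "open W'"
    using continuous_openin_preimage_gen W g(1) O'(1) continuous_open_preimage by metis
  have "open ((h \<circ> g) ` W')"
  proof (rule invariance_of_domain)
    have h: "continuous_on U h" using hk homeomorphism_cont1 by blast
    have c: "continuous_on W' g" using g(1) by (rule continuous_on_subset) (auto simp: W'_def)
    show "continuous_on W' (h \<circ> g)"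
      by (rule continuous_on_compose[OF c]) (rule continuous_on_subset[OF h], auto simp: W'_def)
    have "inj_on h (g ` W')"
      using hk by (auto simp: homeomorphism_def W'_def inj_on_def) metis+
    moreover have "inj_on g W'" using g(2) by (auto simp: W'_def inj_on_def)
    ultimately show "inj_on (h \<circ> g) W'" by (rule comp_inj_on[rotated])
  qed (rule W'o)
  moreover have "(h \<circ> g) ` W' \<subseteq> V" using hk by (auto simp: homeomorphism_def W'_def)
  ultimately have "openin (top_of_set V) ((h \<circ> g) ` W')"
    by (metis open_subset)
  then have "openin (top_of_set U) (k ` ((h \<circ> g) ` W'))"
    using hk homeomorphism_imp_open_map homeomorphism_symD by blast
  moreover have "k ` ((h \<circ> g) ` W') = g ` W'"
    using hk unfolding image_comp by (intro image_cong refl) (auto simp: homeomorphism_def W'_def)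
  ultimately have "openin (top_of_set R) (g ` W')" using U(1) openin_trans by metis
  moreover have "p \<in> g ` W'" "g ` W' \<subseteq> g ` W" using p U by (auto simp: W'_def)
  ultimately show "\<exists>T. openin (top_of_set R) T \<and> p \<in> T \<and> T \<subseteq> g ` W" by blast
qed

lemma half_plane_open_contains_disc:
  assumes "openin (top_of_set half_plane) V" "V \<noteq> {}"
  obtains W where "open W" "W \<noteq> {}" "W \<subseteq> V"
proof -
  obtain O' where O': "open O'" "V = half_plane \<inter> O'" using assms by (auto simp: openin_open)
  obtain a b where ab: "(a, b) \<in> O'" "b \<ge> 0" using assms O' by (auto simp: half_plane_def)
  obtain e where e: "e > 0" "ball (a,b) e \<subseteq> O'" using O'(1) ab open_contains_ball by blast
  \<comment> \<open>The given point may lie on the boundary line, around which \<open>V\<close>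
    contains no planar disc; a shift upwards by \<open>e/2\<close> stays in the ball and reaches the
    open upper half plane.\<close>
  have "(a, b + e/2) \<in> ball (a,b) e" using e by (simp add: dist_Pair_Pair dist_real_def)
  then have ne: "(a, b + e/2) \<in> O' \<inter> {p. 0 < snd p}" using e ab by auto
  have "{p::real\<times>real. 0 < snd p} = snd -` {0<..}" by auto
  then have "open {p::real\<times>real. 0 < snd p}" by (metis open_greaterThan open_vimage_snd vimage_snd)
  then have "open (O' \<inter> {p. 0 < snd p})" using O' by blast
  moreover have "O' \<inter> {p. 0 < snd p} \<subseteq> V" using O' by (auto simp: half_plane_def)
  ultimately show ?thesis using that ne by blast
qed

text \<open>A chart carries part of \<open>O'\<close> to a nonempty set open in the half plane,
  which contains a planar disc; \<open>q\<close> would embed this disc in the line, against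
  invariance of dimension.\<close>

lemma surface_not_one_dimensional:
  fixes q :: "'b::topological_space \<Rightarrow> real"
  assumes R: "surface_with_boundary (top_of_set R)"
    and O': "openin (top_of_set R) O'" "O' \<noteq> {}" and q: "continuous_on O' q" "inj_on q O'"
  shows False
proof -
  obtain p where p: "p \<in> O'" "p \<in> R" using O' openin_imp_subset by blast
  then obtain U V h k where U: "openin (top_of_set R) U" "p \<in> U"
    and V: "openin (top_of_set half_plane) V" and hk: "homeomorphism U V h k"
    using surface_chart[OF R] by metis
  have "openin (top_of_set half_plane) (h ` (U \<inter> O'))"
    by (rule chart_image_openin[OF hk U(1) V O'(1)])
  then obtain W where W: "open W" "W \<noteq> {}" "W \<subseteq> h ` (U \<inter> O')"
    using half_plane_open_contains_disc p U by (metis Int_iff empty_iff image_is_empty)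
  have kW: "k w \<in> O' \<and> k w \<in> U \<and> h (k w) = w" if "w \<in> W" for w
    using that W hk by (auto simp: homeomorphism_def)
  have "W \<subseteq> V" using W hk by (auto simp: homeomorphism_def)
  then have "continuous_on W k" using hk by (meson continuous_on_subset homeomorphism_def)
  then have "continuous_on W (q \<circ> k)"
    by (rule continuous_on_compose) (rule continuous_on_subset[OF q(1)], use kW in auto)
  moreover have "inj_on (q \<circ> k) W"
    unfolding inj_on_def comp_def using kW q(2) by (metis inj_onD)
  ultimately have "DIM(real \<times> real) \<le> DIM(real)"
    using invariance_of_dimension W by blast
  then show False by simp
qed

section \<open>The combinatorial type of a triangulated surface\<close>

lemma realizationI:
  assumes K: "finite_simplicial_complex K" and "X \<in> K" and nn: "\<And>x. 0 \<le> f x"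
    and z: "\<And>x. x \<notin> X \<Longrightarrow> f x = 0" and s: "sum f X = 1"
  shows "f \<in> realization K"
proof -
  have fin: "finite X" using K \<open>X \<in> K\<close> by (simp add: finite_simplicial_complex_def)
  have sub: "{x. f x \<noteq> 0} \<subseteq> X" using z by blast
  have sum: "(\<Sum>x | f x \<noteq> 0. f x) = sum f X"
    by (rule sum.mono_neutral_left[OF fin sub]) auto
  then have "{x. f x \<noteq> 0} \<noteq> {}" using s by (metis sum.empty zero_neq_one)
  then have "{x. f x \<noteq> 0} \<in> K" using K \<open>X \<in> K\<close> sub unfolding finite_simplicial_complex_def by meson
  then show ?thesis using nn sum s by (simp add: realization_def)
qed

lemma realization_nonneg: "f \<in> realization K \<Longrightarrow> 0 \<le> f x"
  and realization_support: "f \<in> realization K \<Longrightarrow> {x. f x \<noteq> 0} \<in> K"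
  by (auto simp: realization_def)

lemma realization_sum:
  assumes "f \<in> realization K" "finite X" "{x. f x \<noteq> 0} \<subseteq> X"
  shows "sum f X = 1"
proof -
  have "(\<Sum>x | f x \<noteq> 0. f x) = sum f X"
    by (rule sum.mono_neutral_left) (use assms in auto)
  then show ?thesis using assms(1) by (simp add: realization_def)
qed

lemma simplex_face:
  "finite_simplicial_complex K \<Longrightarrow> X \<in> K \<Longrightarrow> Y \<subseteq> X \<Longrightarrow> Y \<noteq> {} \<Longrightarrow> Y \<in> K"
  and simplex_finite: "finite_simplicial_complex K \<Longrightarrow> X \<in> K \<Longrightarrow> finite X"
  and simplex_nonempty: "finite_simplicial_complex K \<Longrightarrow> X \<in> K \<Longrightarrow> X \<noteq> {}"
  unfolding finite_simplicial_complex_def by blast+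

lemma barycentre:
  assumes K: "finite_simplicial_complex K" and "X \<in> K"
  shows "(\<lambda>x. if x \<in> X then 1 / card X else 0) \<in> realization K"
    "{x. (if x \<in> X then 1 / card X else 0 :: real) \<noteq> 0} = X"
proof -
  have "card X \<noteq> 0" using simplex_finite simplex_nonempty assms by (metis card_0_eq)
  then show "(\<lambda>x. if x \<in> X then 1 / card X else 0) \<in> realization K"
    "{x. (if x \<in> X then 1 / card X else 0 :: real) \<noteq> 0} = X"
    by (auto intro: realizationI[OF assms])
qed

text \<open>Moving \<open>p\<close> slightly towards the barycentre of \<open>X\<close> makes every
  coordinate in \<open>X\<close> positive while staying inside \<open>O'\<close>. This is how
  openness is turned into statements about incidences of simplices.\<close>

lemma open_set_meets_larger_simplex:
  assumes K: "finite_simplicial_complex K" and O': "openin (realization_space K) O'"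
    and p: "p \<in> O'" and X: "X \<in> K" "{x. p x \<noteq> 0} \<subseteq> X"
  obtains f where "f \<in> O'" "{x. f x \<noteq> 0} = X"
proof -
  define \<beta> where "\<beta> = (\<lambda>x. if x \<in> X then 1 / card X else 0 :: real)"
  have \<beta>: "\<beta> \<in> realization K" "{x. \<beta> x \<noteq> 0} = X"
    using barycentre[OF K X(1)] by (simp_all add: \<beta>_def)
  obtain G where G: "open G" "O' = realization K \<inter> G" using O' by (auto simp: openin_open)
  have pR: "p \<in> realization K" using p G by auto
  have fin: "finite X" using simplex_finite K X by blast
  define h where "h = (\<lambda>\<epsilon> x. (1 - \<epsilon>) * p x + \<epsilon> * \<beta> x)"
  have "continuous_on UNIV h"
    unfolding h_def by (intro continuous_intros)
  then have "open (h -` G)" using G(1) open_vimage by blast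
  moreover have "0 \<in> h -` G" using p G by (simp add: h_def)
  ultimately obtain e where e: "e > 0" "ball 0 e \<subseteq> h -` G" using open_contains_ball by blast
  define \<epsilon> where "\<epsilon> = min (e/2) (1/2)"
  have \<epsilon>: "0 < \<epsilon>" "\<epsilon> < 1" "\<epsilon> \<in> ball 0 e" using e by (auto simp: \<epsilon>_def)
  have nn: "0 \<le> p x" "0 \<le> \<beta> x" for x using realization_nonneg[OF pR] realization_nonneg[OF \<beta>(1)] by simp_all
  have "h \<epsilon> \<in> realization K"
  proof (rule realizationI[OF K X(1)])
    show "0 \<le> h \<epsilon> x" for x using \<epsilon> nn by (simp add: h_def)
    show "h \<epsilon> x = 0" if "x \<notin> X" for x using that X \<beta>(2) by (auto simp: h_def)
    have "sum (h \<epsilon>) X = (1 - \<epsilon>) * sum p X + \<epsilon> * sum \<beta> X"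
      by (simp add: h_def sum.distrib sum_distrib_left)
    moreover have "sum p X = 1" "sum \<beta> X = 1"
      using realization_sum fin pR X \<beta> by (metis order_refl)+
    ultimately show "sum (h \<epsilon>) X = 1" by simp
  qed
  moreover have "{x. h \<epsilon> x \<noteq> 0} = X"
  proof -
    have "h \<epsilon> x \<noteq> 0 \<longleftrightarrow> x \<in> X" for x
    proof (cases "x \<in> X")
      case True
      then have "\<beta> x > 0" using \<beta>(2) nn(2)[of x] by (auto simp: less_le)
      then have "\<epsilon> * \<beta> x > 0" "(1 - \<epsilon>) * p x \<ge> 0" using \<epsilon> nn by simp_all
      then have "h \<epsilon> x > 0" unfolding h_def by linarith
      then show ?thesis using True by simp
    next
      case False
      then show ?thesis using X \<beta>(2) by (auto simp: h_def)
    qed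
    then show ?thesis by blast
  qed
  moreover have "h \<epsilon> \<in> G" using subsetD[OF e(2) \<epsilon>(3)] by simp
  ultimately show ?thesis using that G by blast
qed

section \<open>Local structure: edges, maximal simplices, vertex links\<close>

lemma openin_positive_coordinates:
  assumes "finite X"
  shows "openin (realization_space K) {f \<in> realization K. \<forall>x\<in>X. 0 < f x}"
proof -
  have "{f \<in> realization K. \<forall>x\<in>X. 0 < f x} = realization K \<inter> (\<Inter>x\<in>X. {f. 0 < f x})" by auto
  moreover have "open (\<Inter>x\<in>X. {f :: 'a \<Rightarrow> real. 0 < f x})"
    using assms by (intro open_INT ballI open_Collect_less continuous_intros
        continuous_on_product_then_coordinatewise[OF continuous_on_id]) auto
  ultimately show ?thesis by (simp add: openin_open_Int)
qed

text \<open>The two triangles contain a planar disc around the midpoint of the edge, and this disc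
  is open. Any simplex \<open>X\<close> containing the edge then has points of its relative interior
  in the disc, hence lies in one of the two triangles. This excludes a third triangle at the edge
  and also simplices of dimension three or more.\<close>

lemma surface_edge_pages:
  assumes K: "finite_simplicial_complex K" and sf: "surface_with_boundary (realization_space K)"
    and a: "{v,x,a} \<in> K" and b: "{v,x,b} \<in> K" and d: "distinct [v,x,a,b]"
    and X: "X \<in> K" "{v,x} \<subseteq> X"
  shows "X \<subseteq> {v,x,a} \<or> X \<subseteq> {v,x,b}"
proof -
  \<comment> \<open>\<open>s\<close> slides along the edge from its midpoint; \<open>t\<close> moves
    into the page of \<open>a\<close> for positive and of \<open>b\<close> for negative values, its
    weight being taken from \<open>v\<close> alone. \<open>W\<close> is the region where the
    coordinates of \<open>v\<close> and \<open>x\<close> stay positive.\<close>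
  define g where "g = (\<lambda>(s,t) y. if y = v then 1/2 + s - \<bar>t\<bar> else if y = x then 1/2 - s
     else if y = a then max t 0 else if y = b then max (-t) 0 else (0::real))"
  define W where "W = {p::real\<times>real. \<bar>snd p\<bar> < 1/2 + fst p} \<inter> {p. fst p < 1/2}"
  have "open W" unfolding W_def
    by (intro open_Int open_Collect_less continuous_intros)
  moreover have "continuous_on W g"
  proof (rule continuous_on_coordinatewise_then_product)
    show "continuous_on W (\<lambda>p. g p y)" for y
      unfolding g_def case_prod_beta
      by (cases "y = v"; cases "y = x"; cases "y = a"; cases "y = b"; simp; intro continuous_intros)
  qed
  moreover have "inj_on g W"
  proof (rule inj_onI)
    fix p q assume "p \<in> W" "q \<in> W" and e: "g p = g q"
    have "fst p = fst q" "max (snd p) 0 = max (snd q) 0" "max (- snd p) 0 = max (- snd q) 0"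
      using fun_cong[OF e, of x] fun_cong[OF e, of a] fun_cong[OF e, of b] d
      by (auto simp: g_def case_prod_beta)
    then show "p = q" by (auto intro!: prod_eqI split: if_splits simp: max_def)
  qed
  moreover have supp: "g p y = 0" if "snd p \<ge> 0" "y \<notin> {v,x,a}" for p y
    using that by (auto simp: g_def case_prod_beta)
  have supp': "g p y = 0" if "snd p \<le> 0" "y \<notin> {v,x,b}" for p y
    using that by (auto simp: g_def case_prod_beta)
  have "g p \<in> realization K" if "p \<in> W" for p
  proof (cases "snd p \<ge> 0")
    case True
    then show ?thesis using that d supp
      by (intro realizationI[OF K a]) (auto simp: g_def W_def case_prod_beta)
  next
    case False
    then show ?thesis using that d supp'
      by (intro realizationI[OF K b]) (auto simp: g_def W_def case_prod_beta)
  qed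
  ultimately have gW: "openin (realization_space K) (g ` W)"
    using planar_disc_open[OF sf] by blast
  have "(0,0) \<in> W" by (simp add: W_def)
  moreover have "{y. g (0,0) y \<noteq> 0} \<subseteq> X" using X by (auto simp: g_def)
  ultimately obtain f where f: "f \<in> g ` W" "{x. f x \<noteq> 0} = X"
    using open_set_meets_larger_simplex[OF K gW _ X(1)] by blast
  then obtain p where "f = g p" by blast
  then show ?thesis using f supp[of p] supp'[of p] by (metis (mono_tags, lifting) linear mem_Collect_eq subsetI)
qed

text \<open>Enlarge \<open>X\<close> to a maximal simplex \<open>Y\<close>. Its open star consists
  of points with support exactly \<open>Y\<close>, so if \<open>Y\<close> had at most two vertices,
  a single coordinate would embed an open subset of the surface in the line.\<close>

lemma surface_simplex_in_triangle:
  assumes K: "finite_simplicial_complex K" and sf: "surface_with_boundary (realization_space K)"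
    and X: "X \<in> K"
  obtains T where "T \<in> K" "X \<subseteq> T" "3 \<le> card T"
proof -
  have "finite K" using K by (simp add: finite_simplicial_complex_def)
  then obtain Y where Y: "Y \<in> K" "X \<subseteq> Y" and mx: "\<And>Z. Z \<in> K \<Longrightarrow> Y \<subseteq> Z \<Longrightarrow> Z = Y"
    using finite_has_maximal2[of K X] X by metis
  have fin: "finite Y" using simplex_finite K Y by blast
  have False if "card Y < 3"
  proof -
    define O' where "O' = {f \<in> realization K. \<forall>x\<in>Y. 0 < f x}"
    have O': "openin (realization_space K) O'"
      unfolding O'_def by (rule openin_positive_coordinates[OF fin])
    have supp: "{x. f x \<noteq> 0} = Y" if "f \<in> O'" for f
      using that by (intro mx realization_support) (auto simp: O'_def)
    have "O' \<noteq> {}" using barycentre[OF K Y(1)] fin simplex_nonempty[OF K Y(1)]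
      by (force simp: O'_def card_gt_0_iff)
    obtain x y where xy: "Y = {x, y}"
    proof -
      have "card Y \<noteq> 0" using fin simplex_nonempty[OF K Y(1)] by simp
      with \<open>card Y < 3\<close> consider "card Y = 1" | "card Y = 2" by linarith
      then show ?thesis by cases (metis card_1_singletonE insert_absorb2 that, metis card_2_iff that)
    qed
    have "inj_on (\<lambda>f. f x) O'"
    proof (rule inj_onI)
      fix f g assume fg: "f \<in> O'" "g \<in> O'" "f x = g x"
      have "sum f Y = 1" "sum g Y = 1"
        using realization_sum[OF _ fin] supp fg by (auto simp: O'_def)
      then have "f y = g y" using fg(3) by (cases "x = y") (auto simp: xy)
      moreover have "f z = g z" if "z \<notin> {x,y}" for z
      proof -
        have "z \<notin> {x. f x \<noteq> 0}" "z \<notin> {x. g x \<noteq> 0}"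
          unfolding supp[OF fg(1)] supp[OF fg(2)] xy using that by simp_all
        then show ?thesis by simp
      qed
      ultimately show "f = g" using fg(3) by (intro ext) (metis insertE singletonD)
    qed
    moreover have "continuous_on O' (\<lambda>f. f x)"
      by (rule continuous_on_product_then_coordinatewise[OF continuous_on_id])
    ultimately show False
      using surface_not_one_dimensional[OF sf O' \<open>O' \<noteq> {}\<close>] by blast
  qed
  then show ?thesis using that Y by force
qed

text \<open>Intersecting the half plane with a ball gives a convex set of affine dimension two,
  whether or not \<open>p\<close> lies on the boundary line, and such a set stays connected when one
  point is removed.\<close>

lemma half_disc_punctured_connected:
  assumes "openin (top_of_set half_plane) V" "p \<in> V"
  obtains B where "openin (top_of_set half_plane) B" "p \<in> B" "B \<subseteq> V" "connected (B - {p})"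
proof -
  obtain O' where O': "open O'" "V = half_plane \<inter> O'" using assms by (auto simp: openin_open)
  then obtain e where e: "e > 0" "ball p e \<subseteq> O'" using assms open_contains_ball by blast
  define B where "B = half_plane \<inter> ball p e"
  have B: "openin (top_of_set half_plane) B" "p \<in> B" "B \<subseteq> V"
    using O' e assms by (auto simp: B_def)
  have "convex half_plane"
  proof -
    have "half_plane = snd -` {0..}" by (auto simp: half_plane_def)
    then show ?thesis using convex_linear_vimage[OF linear_snd] by (metis convex_real_interval(1))
  qed
  then have "convex B" by (simp add: B_def convex_Int)
  obtain W where "open W" "W \<noteq> {}" "W \<subseteq> B" using half_plane_open_contains_disc B by blast
  then have "2 \<le> aff_dim B" using aff_dim_open[of W] aff_dim_subset[of W B] by simp
  then have "connected (B - {p})" using \<open>convex B\<close> by (intro connected_punctured_convex) auto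
  then show ?thesis using that B by blast
qed

text \<open>A small punctured neighbourhood of \<open>v\<close> is connected, being a punctured half
  disc in a chart. If no link edge led from \<open>A\<close> to its complement, the points with a
  positive coordinate at a vertex of \<open>A\<close> other than \<open>v\<close> and those with one
  at a vertex outside \<open>A\<close> would split it into two disjoint nonempty open parts.\<close>

lemma surface_link_connected:
  assumes K: "finite_simplicial_complex K" and sf: "surface_with_boundary (realization_space K)"
    and a: "{v,a} \<in> K" "a \<noteq> v" "a \<in> A" and b: "{v,b} \<in> K" "b \<noteq> v" "b \<notin> A"
  shows "\<exists>x y. x \<in> A \<and> y \<notin> A \<and> x \<noteq> v \<and> y \<noteq> v \<and> {v,x,y} \<in> K"
proof (rule ccontr)
  assume no: "\<not> ?thesis"
  define R where "R = realization K"
  define \<delta> where "\<delta> = (\<lambda>y. if y = v then 1 else 0 :: real)"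
  have v: "{v} \<in> K" using simplex_face[OF K a(1)] by blast
  have \<delta>: "\<delta> \<in> R" unfolding R_def \<delta>_def by (intro realizationI[OF K v]) auto
  obtain U V h k where U: "openin (top_of_set R) U" "\<delta> \<in> U"
    and V: "openin (top_of_set half_plane) V" and hk: "homeomorphism U V h k"
    using surface_chart[OF sf[folded R_def] \<delta>] by metis
  define St where "St = {f \<in> R. \<forall>x\<in>{v}. 0 < f x}"
  have St: "openin (top_of_set R) St"
    unfolding St_def R_def by (rule openin_positive_coordinates) simp
  have "openin (top_of_set half_plane) (h ` (U \<inter> St))"
    by (rule chart_image_openin[OF hk U(1) V St])
  moreover have "h \<delta> \<in> h ` (U \<inter> St)" using U \<delta> by (auto simp: St_def \<delta>_def)
  ultimately obtain B where B: "openin (top_of_set half_plane) B" "h \<delta> \<in> B" "B \<subseteq> h ` (U \<inter> St)"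
    "connected (B - {h \<delta>})" using half_disc_punctured_connected by metis
  have kh: "k (h f) = f" if "f \<in> U" for f using that hk by (auto simp: homeomorphism_def)
  have BV: "B \<subseteq> V" using B hk by (auto simp: homeomorphism_def)
  have kc: "continuous_on B k" using hk BV by (meson continuous_on_subset homeomorphism_def)
  define C where "C = k ` (B - {h \<delta>})"
  have Cconn: "connected C" unfolding C_def
    by (rule connected_continuous_image[OF continuous_on_subset[OF kc] B(4)]) blast
  have CS: "f \<in> St \<and> f \<noteq> \<delta>" if "f \<in> C" for f
    using that B(3) kh by (auto simp: C_def)
  have "openin (top_of_set V) B" using B(1) BV V by (meson openin_imp_subset openin_subset_trans)
  then have "openin (top_of_set U) (k ` B)"
    using hk homeomorphism_imp_open_map homeomorphism_symD by blast
  then have kB: "openin (realization_space K) (k ` B)" using U openin_trans R_def by metis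
  have \<delta>kB: "\<delta> \<in> k ` B" using B kh U by force
  \<comment> \<open>Every neighbour \<open>c\<close> of \<open>v\<close> is visible close to
    \<open>v\<close>: some point of \<open>C\<close> lies in the open edge from \<open>v\<close> to
    \<open>c\<close>. This makes both parts of the separation nonempty.\<close>
  have meet: "\<exists>f\<in>C. {x. f x \<noteq> 0} = {v,c}" if "{v,c} \<in> K" "c \<noteq> v" for c
  proof -
    obtain f where f: "f \<in> k ` B" "{x. f x \<noteq> 0} = {v,c}"
    proof (rule open_set_meets_larger_simplex[OF K kB \<delta>kB \<open>{v,c} \<in> K\<close>])
      show "{x. \<delta> x \<noteq> 0} \<subseteq> {v,c}" by (auto simp: \<delta>_def)
    qed
    have "c \<in> {x. f x \<noteq> 0}" using f by simp
    then have "f \<noteq> \<delta>" using that by (auto simp: \<delta>_def)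
    then have "f \<in> C" using f(1) kh U by (auto simp: C_def)
    then show ?thesis using f by blast
  qed
  define G where "G M = (\<Union>x\<in>M - {v}. {f :: 'a \<Rightarrow> real. 0 < f x})" for M
  have Go: "open (G M)" for M unfolding G_def
    by (intro open_UN ballI open_Collect_less continuous_intros
        continuous_on_product_then_coordinatewise[OF continuous_on_id])
  have "C \<subseteq> G A \<union> G (- A)"
  proof
    fix f assume f: "f \<in> C"
    then have fR: "f \<in> R" "f \<noteq> \<delta>" using CS by (auto simp: St_def)
    show "f \<in> G A \<union> G (- A)"
    proof (rule ccontr)
      assume n: "\<not> ?thesis"
      have z: "f x = 0" if "x \<noteq> v" for x
        using n that realization_nonneg[OF fR(1)[unfolded R_def], of x] by (force simp: G_def)
      then have "sum f {v} = 1" using fR(1) unfolding R_def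
        by (intro realization_sum) auto
      then have "f = \<delta>" using z by (auto simp: \<delta>_def)
      then show False using fR by blast
    qed
  qed
  moreover have "G A \<inter> G (- A) \<inter> C = {}"
  proof (rule ccontr)
    assume "\<not> ?thesis"
    then obtain f x y where f: "f \<in> C" "x \<in> A" "x \<noteq> v" "0 < f x" "y \<notin> A" "y \<noteq> v" "0 < f y"
      by (auto simp: G_def)
    then have "{v,x,y} \<subseteq> {x. f x \<noteq> 0}" "{x. f x \<noteq> 0} \<in> K"
      using CS[OF f(1)] by (auto simp: St_def R_def realization_support)
    then have "{v,x,y} \<in> K" using simplex_face[OF K] by blast
    then show False using f no by blast
  qed
  moreover have "G A \<inter> C \<noteq> {}" "G (- A) \<inter> C \<noteq> {}"
  proof -
    obtain f where f: "f \<in> C" "{x. f x \<noteq> 0} = {v,a}" using meet a by blast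
    then have "f a > 0" using realization_nonneg[of f K a] CS[OF f(1)]
      by (force simp: St_def R_def less_le)
    then show "G A \<inter> C \<noteq> {}" using f a by (auto simp: G_def)
    obtain f where f: "f \<in> C" "{x. f x \<noteq> 0} = {v,b}" using meet b by blast
    then have "f b > 0" using realization_nonneg[of f K b] CS[OF f(1)]
      by (force simp: St_def R_def less_le)
    then show "G (- A) \<inter> C \<noteq> {}" using f b by (auto simp: G_def)
  qed
  ultimately show False using Cconn Go unfolding connected_def by blast
qed

section \<open>Combinatorial surfaces\<close>

definition tri :: "'a set set \<Rightarrow> 'a \<Rightarrow> 'a \<Rightarrow> 'a \<Rightarrow> bool" where
  "tri K x y z \<longleftrightarrow> x \<noteq> y \<and> y \<noteq> z \<and> x \<noteq> z \<and> {x,y,z} \<in> K"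

lemma tri_swap: "tri K x y z \<Longrightarrow> tri K y x z"
  and tri_rotate: "tri K x y z \<Longrightarrow> tri K y z x"
  by (auto simp: tri_def insert_commute)

text \<open>Kept apart from purity and link connectedness because subcomplexes inherit it; it is the
  property of the ambient complex that is handed on through a vertex split.\<close>

definition thin_complex :: "'a set set \<Rightarrow> bool" where
  "thin_complex K \<longleftrightarrow> finite_simplicial_complex K \<and> (\<forall>X\<in>K. card X \<le> 3) \<and>
     (\<forall>x y a b c. tri K x y a \<and> tri K x y b \<and> tri K x y c \<longrightarrow> a = b \<or> b = c \<or> a = c)"

lemma thin_complexI:
  assumes "finite_simplicial_complex K" "\<And>X. X \<in> K \<Longrightarrow> card X \<le> 3"
    "\<And>x y a b c. tri K x y a \<Longrightarrow> tri K x y b \<Longrightarrow> tri K x y c \<Longrightarrow>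
      a = b \<or> b = c \<or> a = c"
  shows "thin_complex K"
  unfolding thin_complex_def
proof (intro conjI ballI allI impI)
  fix x y a b c
  assume "tri K x y a \<and> tri K x y b \<and> tri K x y c"
  then show "a = b \<or> b = c \<or> a = c" using assms(3)[of x y a b c] by blast
qed (use assms in auto)

lemma thin_complex_card: "thin_complex K \<Longrightarrow> X \<in> K \<Longrightarrow> card X \<le> 3"
  and thin_complex_edge: "thin_complex K \<Longrightarrow> tri K x y a \<Longrightarrow> tri K x y b \<Longrightarrow>
      tri K x y c \<Longrightarrow> a = b \<or> b = c \<or> a = c"
  and thin_complex_complex: "thin_complex K \<Longrightarrow> finite_simplicial_complex K"
  unfolding thin_complex_def by blast+

text \<open>The last condition says that vertex links are connected.\<close>

definition comb_surface :: "'a set set \<Rightarrow> bool" where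
  "comb_surface K \<longleftrightarrow> thin_complex K \<and> (\<forall>X\<in>K. \<exists>T\<in>K. X \<subseteq> T \<and> card T = 3) \<and>
     (\<forall>v A a b. {v,a} \<in> K \<and> a \<noteq> v \<and> a \<in> A \<and> {v,b} \<in> K \<and> b \<noteq> v \<and> b \<notin> A \<longrightarrow>
        (\<exists>x y. x \<in> A \<and> y \<notin> A \<and> tri K v x y))"

lemma comb_surface_thin: "comb_surface K \<Longrightarrow> thin_complex K"
  by (simp add: comb_surface_def)

lemma comb_surface_complex: "comb_surface K \<Longrightarrow> finite_simplicial_complex K"
  by (simp add: comb_surface_thin thin_complex_complex)

lemma surface_imp_comb_surface:
  assumes K: "finite_simplicial_complex K" and sf: "surface_with_boundary (realization_space K)"
  shows "comb_surface K"
proof -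
  have card: "card X \<le> 3" if "X \<in> K" for X
  proof (rule ccontr)
    assume "\<not> card X \<le> 3"
    then have "Suc (Suc (Suc (Suc 0))) \<le> card X" by simp
    then obtain v x a b where vx: "{v,x,a,b} \<subseteq> X" "distinct [v,x,a,b]"
      unfolding card_le_Suc_iff by auto
    then have "X \<subseteq> {v,x,a} \<or> X \<subseteq> {v,x,b}"
      using that simplex_face[OF K that] by (intro surface_edge_pages[OF K sf]) auto
    then show False using vx by auto
  qed
  have deg: "a = b \<or> b = c \<or> a = c" if "tri K x y a" "tri K x y b" "tri K x y c" for x y a b c
  proof (rule ccontr)
    assume n: "\<not> ?thesis"
    have "{x,y,c} \<subseteq> {x,y,a} \<or> {x,y,c} \<subseteq> {x,y,b}"
      by (intro surface_edge_pages[OF K sf]) (use that n in \<open>auto simp: tri_def\<close>)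
    then show False using that n by (auto simp: tri_def)
  qed
  have "thin_complex K"
    by (rule thin_complexI[OF K card deg])
  moreover have "\<exists>T\<in>K. X \<subseteq> T \<and> card T = 3" if "X \<in> K" for X
    using surface_simplex_in_triangle[OF K sf that] card by (metis le_antisym)
  moreover have "\<exists>x y. x \<in> A \<and> y \<notin> A \<and> tri K v x y"
    if h: "{v,a} \<in> K" "a \<noteq> v" "a \<in> A" "{v,b} \<in> K" "b \<noteq> v" "b \<notin> A" for v A a b
    using surface_link_connected[OF K sf h] unfolding tri_def by metis
  ultimately show ?thesis unfolding comb_surface_def by blast
qed

section \<open>Free edges and the boundary\<close>

lemma free_edge_not_interior:
  assumes K: "finite_simplicial_complex K" and d: "x \<noteq> y" "z \<noteq> x" "z \<noteq> y"
    and free: "\<And>X. X \<in> K \<Longrightarrow> {x,y} \<subseteq> X \<Longrightarrow> X \<subseteq> {x,y,z}"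
    and f: "{u. f u \<noteq> 0} = {x,y}"
  shows "f \<notin> surface_interior (realization_space K)"
proof
  define R where "R = realization K"
  assume "f \<in> surface_interior (realization_space K)"
  then have fR: "f \<in> R" and "\<exists>U (V :: (real \<times> real) set) h k. openin (top_of_set R) U \<and> f \<in> U \<and> open V \<and>
        homeomorphism U V h k"
    unfolding surface_interior_top_of_set R_def by simp_all
  then obtain U h k and V :: "(real \<times> real) set" where U: "openin (top_of_set R) U" "f \<in> U"
    and V: "open V" and hk: "homeomorphism U V h k" by blast
  define St where "St = {g \<in> R. \<forall>u\<in>{x,y}. 0 < g u}"
  have St: "openin (top_of_set R) St"
    unfolding St_def R_def by (rule openin_positive_coordinates) simp
  have Wo: "open (h ` (U \<inter> St))"
    using chart_image_openin[OF hk U(1) _ St, of UNIV] V by simp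
  define W where "W = h ` (U \<inter> St)"
  \<comment> \<open>On the open star of a free edge the coordinates at \<open>x\<close> and
    \<open>z\<close> determine the point. In a planar chart they would map a neighbourhood of
    \<open>f\<close> onto an open planar set, but the coordinate at \<open>z\<close> vanishes at
    \<open>f\<close> and is nowhere negative.\<close>
  define q where "q = (\<lambda>g. (g x, g z)) \<circ> k"
  have kh: "k (h g) = g" if "g \<in> U" for g using that hk by (auto simp: homeomorphism_def)
  have kW: "k w \<in> St" "h (k w) = w" if "w \<in> W" for w using that kh by (auto simp: W_def)
  have "W \<subseteq> V" using hk by (auto simp: W_def homeomorphism_def)
  then have "continuous_on W k" using hk by (meson continuous_on_subset homeomorphism_def)
  then have "continuous_on W q" unfolding q_def
    by (rule continuous_on_compose)
      (intro continuous_intros continuous_on_product_then_coordinatewise[OF continuous_on_id])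
  moreover have "inj_on q W"
  proof -
    have "inj_on (\<lambda>g. (g x, g z)) St"
    proof (rule inj_onI)
      fix g g' assume g: "g \<in> St" "g' \<in> St" "(g x, g z) = (g' x, g' z)"
      have sub: "{u. l u \<noteq> 0} \<subseteq> {x,y,z}" if "l \<in> St" for l
        using that by (intro free realization_support) (auto simp: St_def R_def)
      have "sum l {x,y,z} = 1" if "l \<in> St" for l
        using sub[OF that] that by (intro realization_sum) (auto simp: St_def R_def)
      then have "l x + l y + l z = 1" if "l \<in> St" for l using that d by force
      then have "g x + g y + g z = 1" "g' x + g' y + g' z = 1" using g by blast+
      then have "g y = g' y" using g(3) by simp
      moreover have "g u = g' u" if "u \<notin> {x,y,z}" for u
      proof -
        have "u \<notin> {u. g u \<noteq> 0}" "u \<notin> {u. g' u \<noteq> 0}" using sub[OF g(1)] sub[OF g(2)] that by blast+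
        then show ?thesis by simp
      qed
      ultimately show "g = g'" using g(3) by (intro ext) (metis insertE singletonD prod.inject)
    qed
    then show ?thesis unfolding q_def inj_on_def comp_def using kW by metis
  qed
  ultimately have qW: "open (q ` W)" using Wo invariance_of_domain unfolding W_def by blast
  have "z \<notin> {u. f u \<noteq> 0}" "x \<in> {u. f u \<noteq> 0}" "y \<in> {u. f u \<noteq> 0}" unfolding f using d by auto
  then have fz: "f z = 0" and "f \<in> St" using fR realization_nonneg[of f K]
    by (auto simp: St_def R_def less_le)
  then have "(f x, 0) \<in> q ` W" using U kh by (force simp: W_def q_def)
  then obtain e where e: "e > 0" "ball (f x, 0) e \<subseteq> q ` W" using qW open_contains_ball by blast
  have "(f x, - (e/2)) \<in> ball (f x, 0) e" using e by (simp add: dist_Pair_Pair dist_real_def)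
  then obtain w where w: "w \<in> W" "q w = (f x, - (e/2))" using e by force
  then have "k w z < 0" using e by (simp add: q_def)
  moreover have "0 \<le> k w z" using kW(1)[OF w(1)] realization_nonneg by (auto simp: St_def R_def)
  ultimately show False by simp
qed

lemma openin_surface_interior:
  "openin (top_of_set R) (surface_interior (top_of_set R))"
proof (subst openin_subopen, intro ballI)
  fix p assume "p \<in> surface_interior (top_of_set R)"
  then obtain U h k and V :: "(real \<times> real) set" where U: "openin (top_of_set R) U" "p \<in> U" "open V"
      "homeomorphism U V h k" unfolding surface_interior_top_of_set by blast
  then have "U \<subseteq> surface_interior (top_of_set R)"
    using openin_imp_subset[OF U(1)] unfolding surface_interior_top_of_set by blast
  then show "\<exists>T. openin (top_of_set R) T \<and> p \<in> T \<and> T \<subseteq> surface_interior (top_of_set R)"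
    using U by blast
qed

lemma comb_surface_edge_triangle:
  assumes "comb_surface K" "{x,y} \<in> K" "x \<noteq> y"
  obtains z where "tri K x y z"
proof -
  obtain T where T: "T \<in> K" "{x,y} \<subseteq> T" "card T = 3"
    using assms unfolding comb_surface_def by meson
  then have "card (T - {x,y}) = 1" using assms(3) by (simp add: card_Diff_subset)
  then obtain z where z: "T - {x,y} = {z}" by (rule card_1_singletonE)
  then have "T = {x,y,z}" "z \<noteq> x" "z \<noteq> y" using T by auto
  then show ?thesis using that[of z] T assms(3) by (auto simp: tri_def)
qed

lemma path_complex_in_edge:
  assumes "Y \<in> path_complex ys" "2 \<le> length ys"
  obtains j where "Suc j < length ys" "Y \<subseteq> {ys ! j, ys ! Suc j}"
proof -
  have "\<exists>j. Suc j < length ys \<and> {ys ! i} \<subseteq> {ys ! j, ys ! Suc j}" if "i < length ys" for i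
    using that assms(2) by (cases "Suc i < length ys"; cases i) (auto intro: exI[of _ i] exI[of _ "i - 1"])
  with assms(1) that show thesis
    by (fastforce simp: path_complex_def in_set_conv_nth)
qed

text \<open>Points of open path edges are excluded from the interior because the edges are free.
  Vertices follow by openness of the interior: an interior vertex would have interior points of an
  adjacent path edge nearby.\<close>

lemma path_in_boundary:
  assumes K: "comb_surface K" and xs: "distinct xs" "2 \<le> length xs"
    and e: "\<And>i. Suc i < length xs \<Longrightarrow> {xs ! i, xs ! Suc i} \<in> K"
    and free: "\<And>i a b. Suc i < length xs \<Longrightarrow> tri K (xs ! i) (xs ! Suc i) a \<Longrightarrow>
        tri K (xs ! i) (xs ! Suc i) b \<Longrightarrow> a = b"
  shows "realization (path_complex xs) \<subseteq> surface_boundary (realization_space K)"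
proof
  note fK = comb_surface_complex[OF K]
  fix f assume f: "f \<in> realization (path_complex xs)"
  define Z where "Z = {x. f x \<noteq> 0}"
  have "Z \<in> path_complex xs" using realization_support[OF f] by (simp add: Z_def)
  then obtain i where i: "Suc i < length xs" "Z \<subseteq> {xs ! i, xs ! Suc i}" "Z \<noteq> {}"
    using path_complex_in_edge[OF _ xs(2)] by (auto simp: path_complex_def)
  let ?x = "xs ! i" and ?y = "xs ! Suc i"
  have xy: "?x \<noteq> ?y" "{?x,?y} \<in> K" using xs i e by (auto simp: nth_eq_iff_index_eq)
  have "Z \<in> K" using simplex_face[OF fK xy(2)] i by blast
  have fR: "f \<in> realization K"
    using f \<open>Z \<in> K\<close> by (auto simp: realization_def Z_def)
  obtain z where z: "tri K ?x ?y z" using comb_surface_edge_triangle[OF K xy(2,1)] .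
  have fr: "X \<subseteq> {?x,?y,z}" if "X \<in> K" "{?x,?y} \<subseteq> X" for X
  proof
    fix u assume "u \<in> X"
    then have "{?x,?y,u} \<in> K" using simplex_face[OF fK that(1), of "{?x,?y,u}"] that by simp
    then show "u \<in> {?x,?y,z}" using free[OF i(1) z, of u] xy unfolding tri_def by blast
  qed
  have "f \<notin> surface_interior (realization_space K)"
  proof
    assume fi: "f \<in> surface_interior (realization_space K)"
    have "{x. f x \<noteq> 0} \<subseteq> {?x,?y}" using i(2) by (simp add: Z_def)
    then obtain g where "g \<in> surface_interior (realization_space K)" "{x. g x \<noteq> 0} = {?x,?y}"
      using open_set_meets_larger_simplex[OF fK openin_surface_interior fi xy(2)] by metis
    moreover have "z \<noteq> ?x" "z \<noteq> ?y" using z by (auto simp: tri_def)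
    ultimately show False using free_edge_not_interior[OF fK xy(1) _ _ fr] by blast
  qed
  then show "f \<in> surface_boundary (realization_space K)"
    using fR by (simp add: surface_boundary_def)
qed

section \<open>Vertex links as paths or cycles\<close>

lemma graph_path_or_cycle:
  assumes V: "finite V" and EV: "\<And>x y. E x y \<Longrightarrow> x \<in> V"
    and sym: "\<And>x y. E x y \<Longrightarrow> E y x" and irr: "\<And>x. \<not> E x x"
    and deg: "\<And>x a b c. E x a \<Longrightarrow> E x b \<Longrightarrow> E x c \<Longrightarrow> a = b \<or> b = c \<or> a = c"
    and ne: "E x0 y0"
    and conn: "\<And>A a b. a \<in> A \<Longrightarrow> a \<in> V \<Longrightarrow> b \<notin> A \<Longrightarrow> b \<in> V \<Longrightarrow> \<exists>x y. x \<in> A \<and> y \<notin> A \<and> E x y"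
  obtains xs where "distinct xs" "2 \<le> length xs" "set xs = V"
    "(\<forall>a b. E a b \<longleftrightarrow> (\<exists>i. Suc i < length xs \<and> {a,b} = {xs ! i, xs ! Suc i})) \<or>
     3 \<le> length xs \<and> (\<forall>a b. E a b \<longleftrightarrow> (\<exists>i. Suc i < length xs \<and> {a,b} = {xs ! i, xs ! Suc i})
        \<or> {a,b} = {last xs, hd xs})"
proof -
  \<comment> \<open>A longest path is taken. Its ends have no neighbours outside it and its inner
    vertices have spent both neighbours on it, so by connectedness it exhausts \<open>V\<close>; the
    only further edge that the degree bound permits joins the two ends.\<close>
  define P where "P xs \<longleftrightarrow> distinct xs \<and> set xs \<subseteq> V \<and> (\<forall>i. Suc i < length xs \<longrightarrow> E (xs ! i) (xs ! Suc i))"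
    for xs
  have P0: "P [x0,y0]" using ne irr EV[OF ne] EV[OF sym[OF ne]] unfolding P_def
    by (auto simp: less_Suc_eq)
  have "length ys < Suc (card V)" if "P ys" for ys
    using that V unfolding P_def by (metis card_mono distinct_card less_Suc_eq_le)
  then obtain xs where xs: "P xs" and mx: "\<And>ys. P ys \<Longrightarrow> length ys \<le> length xs"
    using ex_has_greatest_nat[of P "[x0,y0]" length "Suc (card V)"] P0 by metis
  let ?n = "length xs"
  have n2: "2 \<le> ?n" using mx[OF P0] by simp
  then have ne': "xs \<noteq> []" by auto
  have dist: "distinct xs" and sV: "set xs \<subseteq> V" using xs by (auto simp: P_def)
  have E: "E (xs ! i) (xs ! Suc i)" if "Suc i < ?n" for i using xs that by (auto simp: P_def)
  have hd: "y \<in> set xs" if "E (xs ! 0) y" for y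
  proof (rule ccontr)
    assume "y \<notin> set xs"
    then have "P (y # xs)" using xs that sym EV unfolding P_def
      by (auto simp: nth_Cons split: nat.split)
    then show False using mx by force
  qed
  have last: "y \<in> set xs" if "E (xs ! (?n - 1)) y" for y
  proof (rule ccontr)
    assume y: "y \<notin> set xs"
    have "E ((xs @ [y]) ! i) ((xs @ [y]) ! Suc i)" if "Suc i < length (xs @ [y])" for i
    proof (cases "Suc i < ?n")
      case True
      then show ?thesis using E[of i] by (simp add: nth_append)
    next
      case False
      then have "i = ?n - 1" using that by simp
      moreover have "Suc (?n - 1) = ?n" using n2 by simp
      ultimately show ?thesis using \<open>E (xs ! (?n - 1)) y\<close> n2 by (simp add: nth_append)
    qed
    then have "P (xs @ [y])" using y xs EV[OF sym[OF that]] unfolding P_def by auto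
    then show False using mx by force
  qed
  have inner: "y = xs ! (i - 1) \<or> y = xs ! Suc i" if "E (xs ! i) y" "0 < i" "Suc i < ?n" for i y
  proof -
    have "E (xs ! i) (xs ! (i - 1))" using E[of "i - 1"] sym that by simp
    moreover have "xs ! (i - 1) \<noteq> xs ! Suc i" using dist that by (simp add: nth_eq_iff_index_eq)
    ultimately show ?thesis using deg[OF that(1) _ E[OF that(3)]] by blast
  qed
  have closed: "y \<in> set xs" if x: "x \<in> set xs" and xy: "E x y" for x y
  proof -
    obtain i where i: "i < ?n" "x = xs ! i"
      using x by (metis in_set_conv_nth)
    consider "i = 0" | "i = ?n - 1" | "0 < i" "Suc i < ?n" using i by linarith
    then show ?thesis
    proof cases
      case 3
      then have "y = xs ! (i - 1) \<or> y = xs ! Suc i" using inner[OF xy[unfolded i(2)] 3] by simp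
      moreover have "xs ! (i - 1) \<in> set xs" "xs ! Suc i \<in> set xs" using 3 by simp_all
      ultimately show ?thesis by blast
    next
      case 1
      then show ?thesis using hd[of y] xy i(2) by simp
    next
      case 2
      then show ?thesis using last[of y] xy i(2) by simp
    qed
  qed
  have "set xs = V"
  proof (rule ccontr)
    assume "set xs \<noteq> V"
    then obtain b where "b \<in> V" "b \<notin> set xs" using sV by blast
    moreover have "xs ! 0 \<in> set xs" using ne' by simp
    ultimately show False using conn[of "xs ! 0" "set xs" b] sV closed by blast
  qed
  define C where "C a b \<longleftrightarrow> (\<exists>i. Suc i < length xs \<and> {a,b} = {xs ! i, xs ! Suc i})" for a b
  have CE: "E a b" if "C a b" for a b
    using that E sym unfolding C_def by (metis doubleton_eq_iff)
  have idx: "j = Suc i \<or> i = 0 \<and> j = ?n - 1" if "E (xs ! i) (xs ! j)" "i < j" "j < ?n" for i j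
  proof (cases "i = 0")
    case False
    then show ?thesis using inner[OF that(1)] that dist by (auto simp: nth_eq_iff_index_eq)
  next
    case True
    show ?thesis
    proof (cases "j = ?n - 1")
      case False
      then show ?thesis using inner[OF sym[OF that(1)]] that dist by (auto simp: nth_eq_iff_index_eq)
    qed (use True in simp)
  qed
  have EC: "C a b \<or> {a,b} = {last xs, hd xs}" if "E a b" for a b
  proof -
    have "a \<in> set xs" "b \<in> set xs" using that EV sym \<open>set xs = V\<close> by blast+
    then obtain i j where ij: "i < ?n" "a = xs ! i" "j < ?n" "b = xs ! j" by (metis in_set_conv_nth)
    have "i \<noteq> j" using that irr ij by auto
    then consider "i < j" | "j < i" by linarith
    then show ?thesis
    proof cases
      case 1
      then show ?thesis using idx[of i j] that ij ne' by (auto simp: C_def last_conv_nth hd_conv_nth)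
    next
      case 2
      then show ?thesis using idx[of j i] sym[OF that] ij ne'
        by (auto simp: C_def last_conv_nth hd_conv_nth)
    qed
  qed
  \<comment> \<open>With only two vertices the pair of ends is the path edge itself, so it does not
    count as a closing edge; a genuine cycle needs three vertices.\<close>
  show ?thesis
  proof (cases "?n = 2 \<or> \<not> E (last xs) (hd xs)")
    case True
    have "E a b \<longleftrightarrow> C a b" for a b
    proof
      assume ab: "E a b"
      have "C a b" if h: "{a,b} = {last xs, hd xs}"
      proof -
        have "E (last xs) (hd xs)" using h ab sym by (metis doubleton_eq_iff)
        with True have "?n = 2" by blast
        then show ?thesis unfolding C_def using h ne'
          by (intro exI[of _ 0]) (auto simp: last_conv_nth hd_conv_nth)
      qed
      then show "C a b" using EC[OF ab] by blast
    qed (rule CE)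
    then show ?thesis using that[of xs] dist n2 \<open>set xs = V\<close> unfolding C_def by blast
  next
    case False
    have "E a b \<longleftrightarrow> C a b \<or> {a,b} = {last xs, hd xs}" for a b
      using EC CE False sym by (metis doubleton_eq_iff)
    moreover have "3 \<le> ?n" using False n2 by simp
    ultimately show ?thesis using that[of xs] dist n2 \<open>set xs = V\<close> unfolding C_def by blast
  qed
qed

text \<open>The triangles at \<open>v\<close> are the edges of a graph on its neighbours. Thinness
  bounds the degrees by two and excludes larger link simplices, so this graph carries the whole
  link.\<close>

lemma comb_surface_link:
  assumes K: "comb_surface K" and v: "{v} \<in> K"
  obtains xs where "distinct xs" "v \<notin> set xs"
    "2 \<le> length xs \<and> link K v = path_complex xs \<or> 3 \<le> length xs \<and> link K v = cycle_complex xs"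
proof -
  note fK = comb_surface_complex[OF K]
  define V where "V = {x. x \<noteq> v \<and> {v,x} \<in> K}"
  have "V \<subseteq> \<Union>K" by (auto simp: V_def)
  moreover have "finite (\<Union>K)" using fK by (auto simp: finite_simplicial_complex_def)
  ultimately have fV: "finite V" by (rule finite_subset)
  have EV: "x \<in> V" if "tri K v x y" for x y
    using that simplex_face[OF fK, of "{v,x,y}" "{v,x}"] by (auto simp: tri_def V_def)
  have sym: "tri K v y x" if "tri K v x y" for x y
    using that by (auto simp: tri_def insert_commute)
  have deg: "a = b \<or> b = c \<or> a = c" if "tri K v x a" "tri K v x b" "tri K v x c" for x a b c
    using thin_complex_edge[OF comb_surface_thin[OF K]] that .
  have irr: "\<not> tri K v x x" for x by (simp add: tri_def)
  have conn: "\<exists>x y. x \<in> A \<and> y \<notin> A \<and> tri K v x y" if "a \<in> A" "a \<in> V" "b \<notin> A" "b \<in> V" for A a b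
    using that K unfolding comb_surface_def V_def by blast
  obtain T where T: "T \<in> K" "{v} \<subseteq> T" "card T = 3"
    using v K unfolding comb_surface_def by meson
  then have "card (T - {v}) = 2" by (simp add: card_Diff_subset)
  then obtain x0 y0 where "T - {v} = {x0,y0}" "x0 \<noteq> y0" by (meson card_2_iff)
  then have "T = {v,x0,y0}" "x0 \<noteq> v" "y0 \<noteq> v" "x0 \<noteq> y0" using T by auto
  then have ne: "tri K v x0 y0" using T by (auto simp: tri_def)
  obtain xs where xs: "distinct xs" "2 \<le> length xs" "set xs = V"
    "(\<forall>a b. tri K v a b \<longleftrightarrow> (\<exists>i. Suc i < length xs \<and> {a,b} = {xs ! i, xs ! Suc i})) \<or>
     3 \<le> length xs \<and> (\<forall>a b. tri K v a b \<longleftrightarrow>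
       (\<exists>i. Suc i < length xs \<and> {a,b} = {xs ! i, xs ! Suc i}) \<or> {a,b} = {last xs, hd xs})"
    using graph_path_or_cycle[OF fV EV sym irr deg ne conn] .
  have link: "Y \<in> link K v \<longleftrightarrow> (\<exists>x\<in>V. Y = {x}) \<or> (\<exists>x y. Y = {x,y} \<and> tri K v x y)" for Y
  proof
    assume "Y \<in> link K v"
    then have Y: "Y \<noteq> {}" "v \<notin> Y" "insert v Y \<in> K" by (auto simp: link_def)
    then have "card (insert v Y) \<le> 3" "finite (insert v Y)"
      using thin_complex_card[OF comb_surface_thin[OF K]] simplex_finite[OF fK Y(3)] Y(3)
      by blast+
    then have "card Y = 1 \<or> card Y = 2" using Y by (auto simp: card_gt_0_iff le_Suc_eq numeral_3_eq_3)
    then show "(\<exists>x\<in>V. Y = {x}) \<or> (\<exists>x y. Y = {x,y} \<and> tri K v x y)"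
    proof
      assume "card Y = 1"
      then obtain x where "Y = {x}" by (rule card_1_singletonE)
      then show ?thesis using Y by (auto simp: V_def)
    next
      assume "card Y = 2"
      then obtain x y where "Y = {x,y}" "x \<noteq> y" by (meson card_2_iff)
      then show ?thesis using Y by (auto simp: tri_def)
    qed
  next
    assume "(\<exists>x\<in>V. Y = {x}) \<or> (\<exists>x y. Y = {x,y} \<and> tri K v x y)"
    then show "Y \<in> link K v" by (auto simp: link_def V_def tri_def)
  qed
  have "v \<notin> set xs" using xs by (auto simp: V_def)
  from xs(4) show ?thesis
  proof
    assume E: "\<forall>a b. tri K v a b \<longleftrightarrow> (\<exists>i. Suc i < length xs \<and> {a,b} = {xs ! i, xs ! Suc i})"
    then have E': "tri K v a b \<longleftrightarrow> (\<exists>i. Suc i < length xs \<and> {a,b} = {xs ! i, xs ! Suc i})"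
      for a b by blast
    have "link K v = path_complex xs"
      unfolding set_eq_iff link path_complex_def xs(3) by (auto simp: E')
    with xs(2) show ?thesis by (intro that[OF xs(1) \<open>v \<notin> set xs\<close>] disjI1 conjI)
  next
    assume E: "3 \<le> length xs \<and> (\<forall>a b. tri K v a b \<longleftrightarrow>
       (\<exists>i. Suc i < length xs \<and> {a,b} = {xs ! i, xs ! Suc i}) \<or> {a,b} = {last xs, hd xs})"
    then have E': "tri K v a b \<longleftrightarrow>
       (\<exists>i. Suc i < length xs \<and> {a,b} = {xs ! i, xs ! Suc i}) \<or> {a,b} = {last xs, hd xs}" for a b by blast
    have "link K v = cycle_complex xs"
      unfolding set_eq_iff link cycle_complex_def path_complex_def xs(3) by (auto simp: E')
    with E show ?thesis by (intro that[OF xs(1) \<open>v \<notin> set xs\<close>] disjI2 conjI) (elim conjE)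
  qed
qed

text \<open>If the link of \<open>v\<close> were a path, the edge from \<open>v\<close> to its first
  vertex would lie in a single triangle and so belong to the boundary; already \<open>v\<close>
  itself would be a boundary point.\<close>

lemma closed_surface_link:
  assumes K: "comb_surface K" and bd: "surface_boundary (realization_space K) = {}"
    and v: "{v} \<in> K"
  obtains xs where "distinct xs" "v \<notin> set xs" "3 \<le> length xs" "link K v = cycle_complex xs"
proof -
  obtain xs where xs: "distinct xs" "v \<notin> set xs"
    "2 \<le> length xs \<and> link K v = path_complex xs \<or> 3 \<le> length xs \<and> link K v = cycle_complex xs"
    using comb_surface_link[OF K v] .
  have False if l: "2 \<le> length xs" "link K v = path_complex xs"
  proof -
    let ?x = "xs ! 0"
    have "?x \<in> set xs" using l by (intro nth_mem) auto
    then have x: "?x \<noteq> v" "{?x} \<in> link K v" using xs l by (auto simp: path_complex_def)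
    then have e: "{v,?x} \<in> K" by (simp add: link_def)
    have a: "a = xs ! 1" if "tri K v ?x a" for a
    proof -
      have "{?x,a} \<in> path_complex xs" "?x \<noteq> a"
        using that unfolding l(2)[symmetric] by (auto simp: tri_def link_def)
      then obtain i where i: "Suc i < length xs" "{?x,a} = {xs ! i, xs ! Suc i}"
        by (auto simp: path_complex_def)
      then have "?x = xs ! i \<and> a = xs ! Suc i \<or> ?x = xs ! Suc i" by (auto simp: doubleton_eq_iff)
      moreover have "0 < length xs" using l by linarith
      ultimately show ?thesis using xs(1) i(1) by (auto simp: nth_eq_iff_index_eq)
    qed
    have "realization (path_complex [v,?x]) \<subseteq> surface_boundary (realization_space K)"
    proof (rule path_in_boundary[OF K])
      fix i b c assume "Suc i < length [v,?x]" "tri K ([v,?x] ! i) ([v,?x] ! Suc i) b"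
        "tri K ([v,?x] ! i) ([v,?x] ! Suc i) c"
      then show "b = c" using a[of b] a[of c] by (simp add: less_Suc_eq)
    qed (use x e in \<open>auto simp: less_Suc_eq\<close>)
    moreover have "(\<lambda>y. if y = v then 1 else 0) \<in> realization (path_complex [v,?x])"
    proof -
      have "{y. (if y = v then 1 else 0 :: real) \<noteq> 0} = {v}" by auto
      then show ?thesis by (simp add: realization_def path_complex_def)
    qed
    ultimately show False using bd by blast
  qed
  then show ?thesis using that xs by blast
qed

section \<open>Charts on the open star of a vertex\<close>

text \<open>The tent of height \<open>s\<close> over the grid point \<open>i * s\<close>. Between 0
  and \<open>n * s\<close> the tents with numbers 0 to \<open>n\<close> add up to \<open>s\<close>,
  so they distribute a total weight \<open>s\<close> over the vertices of a path. Scaling with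
  \<open>s\<close> instead of normalising keeps the formula continuous down to \<open>s = 0\<close>,
  the apex of the fan.\<close>

definition hat :: "real \<Rightarrow> real \<Rightarrow> nat \<Rightarrow> real" where
  "hat s b i = max 0 (s - \<bar>b - real i * s\<bar>)"

lemma hat_interval:
  assumes "real j * s \<le> b" "b \<le> real (Suc j) * s"
  shows "hat s b j = real (Suc j) * s - b" "hat s b (Suc j) = b - real j * s"
    "i \<noteq> j \<Longrightarrow> i \<noteq> Suc j \<Longrightarrow> hat s b i = 0"
proof -
  have s: "s \<ge> 0" using assms by (simp add: algebra_simps)
  show "hat s b j = real (Suc j) * s - b" "hat s b (Suc j) = b - real j * s"
    using assms s by (auto simp: hat_def algebra_simps)
  assume "i \<noteq> j" "i \<noteq> Suc j"
  then consider "Suc i \<le> j" | "Suc (Suc j) \<le> i" by linarith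
  then show "hat s b i = 0"
  proof cases
    case 1
    then have "real (Suc i) * s \<le> real j * s" using s by (intro mult_right_mono) auto
    then show ?thesis using assms s by (auto simp: hat_def algebra_simps)
  next
    case 2
    then have "real (Suc (Suc j)) * s \<le> real i * s" using s by (intro mult_right_mono) auto
    then show ?thesis using assms s by (auto simp: hat_def algebra_simps)
  qed
qed

lemma hat_location:
  fixes s b :: real
  assumes "0 < n" "0 \<le> b" "b \<le> real n * s"
  obtains j where "j < n" "real j * s \<le> b" "b \<le> real (Suc j) * s"
proof -
  have "\<exists>j<n. real j * s \<le> b \<and> b \<le> real (Suc j) * s"
    using assms
  proof (induction n)
    case (Suc n)
    then show ?case
      by (cases "b \<le> real n * s \<and> n \<noteq> 0") (force simp: less_Suc_eq)+
  qed simp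
  then show ?thesis using that by blast
qed

text \<open>The point of the cone with apex \<open>v\<close> over the path \<open>ys\<close> (subdividing \<open>[0, 1]\<close> equally) that lies
  at height \<open>s\<close> over the parameter \<open>\<beta> / s\<close>. The number \<open>t\<close> is only used when the first and the
  last vertex of \<open>ys\<close> are joined by an edge: it moves the point into the closing triangle.\<close>

definition fan_point :: "'a \<Rightarrow> 'a list \<Rightarrow> real \<Rightarrow> real \<Rightarrow> real \<Rightarrow> 'a \<Rightarrow> real" where
  "fan_point v ys s \<beta> t x =
     (if x = v then 1 - s - 2 * t
      else (\<Sum>i<length ys. if ys ! i = x then hat s (real (length ys - 1) * \<beta>) i else 0)
        + (if x = hd ys \<or> x = last ys then t else 0))"

text \<open>Recovers \<beta> as the weighted mean of the positions
  \<open>i / (length ys - 1)\<close>. The closing weight sits at the first and the last position, so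
  it contributes exactly \<open>t\<close> to the mean and is subtracted.\<close>

definition fan_height :: "'a list \<Rightarrow> real \<Rightarrow> ('a \<Rightarrow> real) \<Rightarrow> real" where
  "fan_height ys t f = (\<Sum>i<length ys. real i * f (ys ! i)) / real (length ys - 1) - t"

lemma fan_point_vertex:
  assumes "distinct ys" "v \<notin> set ys" "i < length ys"
  shows "fan_point v ys s \<beta> t (ys ! i) = hat s (real (length ys - 1) * \<beta>) i
     + (if i = 0 \<or> i = length ys - 1 then t else 0)"
proof -
  have "ys \<noteq> []" using assms by auto
  then have "ys ! i = hd ys \<longleftrightarrow> i = 0" "ys ! i = last ys \<longleftrightarrow> i = length ys - 1"
    using assms by (auto simp: hd_conv_nth last_conv_nth nth_eq_iff_index_eq)
  moreover have "ys ! i \<noteq> v" using assms nth_mem by blast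
  moreover have "(\<Sum>k<length ys. if ys ! k = ys ! i then hat s (real (length ys - 1) * \<beta>) k else 0)
      = (\<Sum>k<length ys. if k = i then hat s (real (length ys - 1) * \<beta>) k else 0)"
    using assms by (intro sum.cong refl) (simp add: nth_eq_iff_index_eq)
  ultimately show ?thesis using assms(3) by (simp add: fan_point_def)
qed

lemma fan_point_apex: "fan_point v ys s \<beta> t v = 1 - s - 2 * t"
  by (simp add: fan_point_def)

lemma fan_point_other:
  assumes "ys \<noteq> []" "x \<noteq> v" "x \<notin> set ys"
  shows "fan_point v ys s \<beta> t x = 0"
proof -
  have "ys ! i \<noteq> x" if "i < length ys" for i using assms(3) that nth_mem by blast
  then show ?thesis using assms by (auto simp: fan_point_def)
qed

lemma fan_point_nth_zero:
  assumes ys: "distinct ys" "v \<notin> set ys" "ys \<noteq> []"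
    and x: "x \<noteq> v" "\<And>i. i < length ys \<Longrightarrow> x = ys ! i \<Longrightarrow>
      hat s (real (length ys - 1) * \<beta>) i + (if i = 0 \<or> i = length ys - 1 then t else 0) = 0"
  shows "fan_point v ys s \<beta> t x = 0"
proof (cases "x \<in> set ys")
  case True
  then show ?thesis using x fan_point_vertex[OF ys(1,2)] by (metis in_set_conv_nth)
qed (rule fan_point_other[OF ys(3) x(1)])

lemma sum_two_indices:
  fixes g :: "nat \<Rightarrow> real"
  assumes "Suc j < m" "\<And>i. i < m \<Longrightarrow> i \<noteq> j \<Longrightarrow> i \<noteq> Suc j \<Longrightarrow> g i = 0"
  shows "(\<Sum>i<m. g i) = g j + g (Suc j)"
proof -
  have "(\<Sum>i<m. g i) = (\<Sum>i\<in>{j, Suc j}. g i)"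
    by (rule sum.mono_neutral_right) (use assms in auto)
  then show ?thesis by simp
qed

lemma sum_end_indices:
  assumes "1 < m"
  shows "(\<Sum>i<m. real i * (if i = 0 \<or> i = m - 1 then t else 0)) = real (m - 1) * t"
proof -
  have "(\<Sum>i<m. real i * (if i = 0 \<or> i = m - 1 then t else 0))
      = (\<Sum>i<m. if i = m - 1 then real (m - 1) * t else 0)"
    by (rule sum.cong) auto
  then show ?thesis using assms by simp
qed

lemma fan_height_fan_point:
  assumes ys: "distinct ys" "v \<notin> set ys" "2 \<le> length ys" and \<beta>: "0 \<le> \<beta>" "\<beta> \<le> s"
  shows "fan_height ys t (fan_point v ys s \<beta> t) = \<beta>"
proof -
  define n where "n = length ys - 1"
  have n: "0 < n" "length ys = Suc n" using ys by (auto simp: n_def)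
  obtain j where j: "j < n" "real j * s \<le> real n * \<beta>" "real n * \<beta> \<le> real (Suc j) * s"
    using hat_location[of n "real n * \<beta>" s] n \<beta> by (auto intro: mult_left_mono)
  have "(\<Sum>i<length ys. real i * fan_point v ys s \<beta> t (ys ! i))
     = (\<Sum>i<length ys. real i * hat s (real n * \<beta>) i)
       + (\<Sum>i<length ys. real i * (if i = 0 \<or> i = length ys - 1 then t else 0))"
    unfolding sum.distrib[symmetric]
    by (rule sum.cong) (use fan_point_vertex[OF ys(1,2)] in \<open>auto simp: n_def algebra_simps\<close>)
  also have "(\<Sum>i<length ys. real i * hat s (real n * \<beta>) i)
      = real j * hat s (real n * \<beta>) j + real (Suc j) * hat s (real n * \<beta>) (Suc j)"
    by (rule sum_two_indices) (use j n hat_interval(3)[OF j(2,3)] in auto)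
  also have "\<dots> = real n * \<beta>"
    unfolding hat_interval(1,2)[OF j(2,3)] by (simp add: algebra_simps)
  also have "(\<Sum>i<length ys. real i * (if i = 0 \<or> i = length ys - 1 then t else 0)) = real n * t"
    using sum_end_indices[of "length ys" t] n by simp
  finally show ?thesis using n by (simp add: fan_height_def field_simps)
qed

text \<open>\<open>c\<close> is what remains of \<open>f\<close> on the path when \<open>t\<close>
  is removed from both ends. Carried by two adjacent positions, it is a pair of tents over one
  subinterval, which the apex coordinate and the height recover. It is applied with
  \<open>t = 0\<close> over path edges and, on the closing triangle, with the smaller of the two end
  coordinates.\<close>

lemma fan_point_unique:
  assumes ys: "distinct ys" "v \<notin> set ys" "2 \<le> length ys" and j: "Suc j < length ys"
    and c: "\<And>i. i < length ys \<Longrightarrow> f (ys ! i) = c i + (if i = 0 \<or> i = length ys - 1 then t else 0)"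
    and c0: "\<And>i. i < length ys \<Longrightarrow> i \<noteq> j \<Longrightarrow> i \<noteq> Suc j \<Longrightarrow> c i = 0"
    and cn: "0 \<le> c j" "0 \<le> c (Suc j)" and fv: "f v = 1 - c j - c (Suc j) - 2 * t"
    and fx: "\<And>x. x \<noteq> v \<Longrightarrow> x \<notin> set ys \<Longrightarrow> f x = 0"
  defines "s \<equiv> 1 - f v - 2 * t"
  shows "f = fan_point v ys s (fan_height ys t f) t" "0 \<le> fan_height ys t f" "fan_height ys t f \<le> s"
proof -
  define n where "n = length ys - 1"
  have n: "0 < n" "length ys = Suc n" "ys \<noteq> []" using ys by (auto simp: n_def)
  have s: "s = c j + c (Suc j)" using fv by (simp add: s_def)
  have "(\<Sum>i<length ys. real i * f (ys ! i)) = (\<Sum>i<length ys. real i * c i)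
       + (\<Sum>i<length ys. real i * (if i = 0 \<or> i = length ys - 1 then t else 0))"
    unfolding sum.distrib[symmetric]
    by (rule sum.cong) (use c in \<open>auto simp: algebra_simps\<close>)
  also have "(\<Sum>i<length ys. real i * c i) = real j * c j + real (Suc j) * c (Suc j)"
    by (rule sum_two_indices) (use j c0 in auto)
  also have "(\<Sum>i<length ys. real i * (if i = 0 \<or> i = length ys - 1 then t else 0)) = real n * t"
    using sum_end_indices[of "length ys" t] n by simp
  finally have h: "real n * fan_height ys t f = real j * c j + real (Suc j) * c (Suc j)"
    using n by (simp add: fan_height_def field_simps)
  have jn: "real (Suc j) \<le> real n" using j n by simp
  have "0 \<le> real n * fan_height ys t f" unfolding h using cn by simp
  then show "0 \<le> fan_height ys t f" using n by (simp add: zero_le_mult_iff)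
  have "real n * fan_height ys t f \<le> real n * c j + real n * c (Suc j)"
    unfolding h using jn cn by (intro add_mono mult_right_mono) auto
  also have "\<dots> = real n * s" by (simp add: s algebra_simps)
  finally show "fan_height ys t f \<le> s" using n by simp
  have J: "real j * s \<le> real n * fan_height ys t f" "real n * fan_height ys t f \<le> real (Suc j) * s"
    unfolding h s using cn by (auto simp: algebra_simps)
  show "f = fan_point v ys s (fan_height ys t f) t"
  proof
    fix x
    consider "x = v" | i where "i < length ys" "x = ys ! i" | "x \<noteq> v" "x \<notin> set ys"
      by (metis in_set_conv_nth)
    then show "f x = fan_point v ys s (fan_height ys t f) t x"
    proof cases
      case 1
      then show ?thesis by (simp add: fan_point_apex s_def)
    next
      case 2
      have "hat s (real n * fan_height ys t f) i = c i"
      proof -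
        consider "i = j" | "i = Suc j" | "i \<noteq> j" "i \<noteq> Suc j" by blast
        then show ?thesis
          by cases (use hat_interval[OF J] c0 2 in \<open>auto simp: h s algebra_simps\<close>)
      qed
      then show ?thesis using fan_point_vertex[OF ys(1,2) 2(1)] c[OF 2(1)] 2(2) by (simp add: n_def)
    next
      case 3
      then show ?thesis using fan_point_other fx n by metis
    qed
  qed
qed

text \<open>With \<open>u = s - \<beta>\<close> and \<open>w = \<beta>\<close> the sector becomes a
  quadrant, which \<open>(u, w) \<mapsto> (u - w, min u w)\<close> unfolds onto the half plane, its
  two bounding rays forming the boundary line. The identities say that
  \<open>s = 2 * y + |x|\<close> and \<open>\<beta> = y + max (- x) 0\<close> invert this
  map.\<close>

lemma quadrant_half_plane:
  fixes s \<beta> x y :: real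
  shows "0 \<le> \<beta> \<Longrightarrow> \<beta> \<le> s \<Longrightarrow> 2 * min (s - \<beta>) \<beta> + \<bar>s - 2 * \<beta>\<bar> = s"
    "0 \<le> \<beta> \<Longrightarrow> \<beta> \<le> s \<Longrightarrow> min (s - \<beta>) \<beta> + max (2 * \<beta> - s) 0 = \<beta>"
    "(2 * y + \<bar>x\<bar>) - 2 * (y + max (- x) 0) = x"
    "min ((2 * y + \<bar>x\<bar>) - (y + max (- x) 0)) (y + max (- x) 0) = y"
  by (auto simp: min_def max_def abs_if)

lemma continuous_on_fan_point:
  fixes s \<beta> t :: "'b::topological_space \<Rightarrow> real"
  assumes "continuous_on A s" "continuous_on A \<beta>" "continuous_on A t"
  shows "continuous_on A (\<lambda>p. fan_point v ys (s p) (\<beta> p) (t p))"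
proof (rule continuous_on_coordinatewise_then_product)
  fix x
  show "continuous_on A (\<lambda>p. fan_point v ys (s p) (\<beta> p) (t p) x)"
  proof (cases "x = v")
    case True
    then show ?thesis by (simp add: fan_point_apex) (intro continuous_intros assms)
  next
    case False
    have "continuous_on A (\<lambda>p. if ys ! i = x then hat (s p) (real (length ys - 1) * \<beta> p) i else 0)" for i
      unfolding hat_def by (cases "ys ! i = x"; simp; intro continuous_intros assms)
    moreover have "continuous_on A (\<lambda>p. if x = hd ys \<or> x = last ys then t p else 0)"
      by (cases "x = hd ys \<or> x = last ys"; simp add: assms)
    ultimately show ?thesis unfolding fan_point_def using False
      by simp (intro continuous_intros)
  qed
qed

lemma continuous_on_coordinate: "continuous_on A (\<lambda>f :: 'a \<Rightarrow> real. f x)"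
  by (rule continuous_on_product_then_coordinatewise[OF continuous_on_id])

lemma continuous_on_fan_height:
  assumes "continuous_on A t"
  shows "continuous_on A (\<lambda>f. fan_height ys (t f) f)"
proof (cases "length ys - 1 = 0")
  case True
  then show ?thesis unfolding fan_height_def True by simp (intro continuous_intros assms)
next
  case False
  then show ?thesis unfolding fan_height_def
    by (intro continuous_intros continuous_on_coordinate assms) simp
qed

section \<open>Points of an open star and the charts\<close>

lemma star_support:
  assumes K: "finite_simplicial_complex K" and f: "f \<in> realization K" "0 < f v"
  shows "{x. f x \<noteq> 0} = {v} \<or> (\<exists>Y\<in>link K v. {x. f x \<noteq> 0} = insert v Y)"
proof -
  let ?X = "{x. f x \<noteq> 0}"
  have v: "v \<in> ?X" using f by simp
  then have i: "insert v (?X - {v}) = ?X" by blast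
  show ?thesis
  proof (cases "?X - {v} = {}")
    case True
    then show ?thesis using v by blast
  next
    case False
    then have "?X - {v} \<in> link K v" using realization_support[OF f(1)] i by (simp add: link_def)
    then show ?thesis using i by metis
  qed
qed

lemma fan_point_in_realization:
  assumes K: "finite_simplicial_complex K" and vn: "v \<notin> set ys"
    and ys: "distinct ys" "2 \<le> length ys" and L: "path_complex ys \<subseteq> link K v"
    and b: "0 \<le> b" "b \<le> s" "s < 1"
  shows "fan_point v ys s b 0 \<in> realization K" (is "?f \<in> _")
proof -
  have n: "ys \<noteq> []" "0 < length ys - 1" using ys by auto
  have "real (length ys - 1) * b \<le> real (length ys - 1) * s" using b by (intro mult_left_mono) auto
  then obtain j where j: "j < length ys - 1" "real j * s \<le> real (length ys - 1) * b"
      "real (length ys - 1) * b \<le> real (Suc j) * s"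
    using hat_location[OF n(2), of "real (length ys - 1) * b" s] b n by auto
  have d: "v \<noteq> ys ! j" "v \<noteq> ys ! Suc j" "ys ! j \<noteq> ys ! Suc j"
    using j(1) vn ys nth_mem[of j ys] nth_mem[of "Suc j" ys] by (auto simp: nth_eq_iff_index_eq)
  have "{ys ! j, ys ! Suc j} \<in> path_complex ys"
    unfolding path_complex_def using j(1) by (intro UnI2 CollectI exI[of _ j]) simp
  then have "{ys ! j, ys ! Suc j} \<in> link K v" using L by blast
  then have X: "{v, ys ! j, ys ! Suc j} \<in> K" by (simp add: link_def)
  have val: "?f (ys ! i) = hat s (real (length ys - 1) * b) i" if "i < length ys" for i
    using fan_point_vertex[OF ys(1) vn that, of s b 0] by simp
  show "?f \<in> realization K"
  proof (rule realizationI[OF K X])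
    show z: "?f x = 0" if "x \<notin> {v, ys ! j, ys ! Suc j}" for x
    proof (rule fan_point_nth_zero[OF ys(1) vn n(1)])
      fix i assume "x = ys ! i"
      then have "i \<noteq> j" "i \<noteq> Suc j" using that by auto
      then show "hat s (real (length ys - 1) * b) i + (if i = 0 \<or> i = length ys - 1 then 0 else 0) = 0"
        using hat_interval(3)[OF j(2,3)] by simp
    qed (use that in simp)
    have "?f x \<ge> 0" if "x \<in> {v, ys ! j, ys ! Suc j}" for x
      using that b j(1) val[of j] val[of "Suc j"] by (auto simp: fan_point_apex hat_def)
    then show "0 \<le> ?f x" for x using z[of x] by fastforce
    show "sum (?f) {v, ys ! j, ys ! Suc j} = 1"
      using d j(1) val[of j] val[of "Suc j"] hat_interval(1,2)[OF j(2,3)]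
      by (simp add: fan_point_apex algebra_simps)
  qed
qed

lemma fan_point_of_edge:
  assumes ys: "distinct ys" "v \<notin> set ys" "2 \<le> length ys" and f: "f \<in> realization K"
    and j: "Suc j < length ys" "{x. f x \<noteq> 0} \<subseteq> {v, ys ! j, ys ! Suc j}"
  shows "f = fan_point v ys (1 - f v) (fan_height ys 0 f) 0" "0 \<le> fan_height ys 0 f"
    "fan_height ys 0 f \<le> 1 - f v" "i < length ys \<Longrightarrow> i \<noteq> j \<Longrightarrow> i \<noteq> Suc j \<Longrightarrow> f (ys ! i) = 0"
proof -
  have z: "f x = 0" if "x \<notin> {v, ys ! j, ys ! Suc j}" for x using j(2) that by blast
  have d: "v \<noteq> ys ! j" "v \<noteq> ys ! Suc j" "ys ! j \<noteq> ys ! Suc j"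
    using j(1) ys nth_mem[of j ys] nth_mem[of "Suc j" ys] by (auto simp: nth_eq_iff_index_eq)
  have "sum f {v, ys ! j, ys ! Suc j} = 1" using realization_sum[OF f _ j(2)] by simp
  then have fv: "f v = 1 - f (ys ! j) - f (ys ! Suc j)" using d by simp
  have ij: "f (ys ! i) = 0" if "i < length ys" "i \<noteq> j" "i \<noteq> Suc j" for i
    using that j(1) ys nth_mem[of i ys] by (intro z) (auto simp: nth_eq_iff_index_eq)
  then show "i < length ys \<Longrightarrow> i \<noteq> j \<Longrightarrow> i \<noteq> Suc j \<Longrightarrow> f (ys ! i) = 0" .
  have zo: "f x = 0" if "x \<noteq> v" "x \<notin> set ys" for x
    using that j(1) nth_mem[of j ys] nth_mem[of "Suc j" ys] by (intro z) auto
  have "f = fan_point v ys (1 - f v - 2 * 0) (fan_height ys 0 f) 0 \<and> 0 \<le> fan_height ys 0 f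
      \<and> fan_height ys 0 f \<le> 1 - f v - 2 * 0"
    by (intro conjI fan_point_unique[OF ys j(1), where c = "\<lambda>i. f (ys ! i)"])
      (use ij fv realization_nonneg[OF f] zo j(1) in auto)
  then show "f = fan_point v ys (1 - f v) (fan_height ys 0 f) 0" "0 \<le> fan_height ys 0 f"
    "fan_height ys 0 f \<le> 1 - f v" by simp_all
qed

text \<open>On the open star of \<open>v\<close> the pair of \<open>s = 1 - f v\<close> and the
  height \<beta> ranges over the sector \<open>0 \<le> \<beta> \<le> s < 1\<close>, which the
  unfolding of the quadrant turns into a piecewise linear half disc. The vertex goes to the origin,
  and the edges to the two ends of the path go to the boundary line.\<close>

lemma star_chart_path:
  assumes K: "finite_simplicial_complex K" and v: "{v} \<in> K" "v \<notin> set ys"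
    and ys: "distinct ys" "2 \<le> length ys" and L: "link K v = path_complex ys"
  shows "\<exists>V h k. openin (top_of_set half_plane) V \<and> homeomorphism {f \<in> realization K. 0 < f v} V h k"
proof -
  define St where "St = {f \<in> realization K. 0 < f v}"
  define V where "V = half_plane \<inter> {p. 2 * snd p + \<bar>fst p\<bar> < 1}"
  define \<beta> where "\<beta> f = fan_height ys 0 f" for f
  define h where "h f = ((1 - f v) - 2 * \<beta> f, min ((1 - f v) - \<beta> f) (\<beta> f))" for f
  define k where "k p = fan_point v ys (2 * snd p + \<bar>fst p\<bar>) (snd p + max (- fst p) 0) 0" for p
  have "open {p::real\<times>real. 2 * snd p + \<bar>fst p\<bar> < 1}" by (intro open_Collect_less continuous_intros)
  then have V: "openin (top_of_set half_plane) V" unfolding V_def by (simp add: openin_open_Int)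
  have f: "f = fan_point v ys (1 - f v) (\<beta> f) 0 \<and> 0 \<le> \<beta> f \<and> \<beta> f \<le> 1 - f v" if "f \<in> St" for f
  proof -
    have fR: "f \<in> realization K" "0 < f v" using that by (auto simp: St_def)
    obtain j where j: "Suc j < length ys" "{x. f x \<noteq> 0} \<subseteq> {v, ys ! j, ys ! Suc j}"
    proof -
      have "\<exists>j. Suc j < length ys \<and> {x. f x \<noteq> 0} \<subseteq> {v, ys ! j, ys ! Suc j}"
        using star_support[OF K fR]
      proof
        assume "{x. f x \<noteq> 0} = {v}"
        then show ?thesis using ys by (intro exI[of _ 0]) auto
      next
        assume "\<exists>Y\<in>link K v. {x. f x \<noteq> 0} = insert v Y"
        then obtain Y where "Y \<in> path_complex ys" "{x. f x \<noteq> 0} = insert v Y" using L by blast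
        then show ?thesis using path_complex_in_edge[OF _ ys(2)] by (metis insert_mono)
      qed
      then show ?thesis using that by blast
    qed
    show ?thesis using fan_point_of_edge(1-3)[OF ys(1) v(2) ys(2) fR(1) j] by (simp add: \<beta>_def)
  qed
  have k: "k p \<in> St" "1 - k p v = 2 * snd p + \<bar>fst p\<bar>" "\<beta> (k p) = snd p + max (- fst p) 0" if "p \<in> V" for p
  proof -
    define s b where "s = 2 * snd p + \<bar>fst p\<bar>" and "b = snd p + max (- fst p) 0"
    have b: "0 \<le> b" "b \<le> s" "s < 1" using that by (auto simp: V_def half_plane_def s_def b_def)
    have kp: "k p = fan_point v ys s b 0" by (simp add: k_def s_def b_def)
    show "1 - k p v = 2 * snd p + \<bar>fst p\<bar>" by (simp add: kp fan_point_apex s_def)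
    show "\<beta> (k p) = snd p + max (- fst p) 0"
      unfolding \<beta>_def kp using fan_height_fan_point[OF ys(1) v(2) ys(2) b(1,2)] by (simp add: b_def)
    have "k p \<in> realization K"
      unfolding kp using b L by (intro fan_point_in_realization[OF K v(2) ys]) auto
    then show "k p \<in> St" using b by (simp add: St_def kp fan_point_apex)
  qed
  have "homeomorphism St V h k"
  proof (rule homeomorphismI)
    show "continuous_on St h" unfolding h_def \<beta>_def
      by (intro continuous_intros continuous_on_coordinate continuous_on_fan_height)
    show "continuous_on V k" unfolding k_def
      by (intro continuous_on_fan_point continuous_intros)
    show "h ` St \<subseteq> V"
    proof (rule image_subsetI)
      fix g assume g: "g \<in> St"
      then have "0 < g v" by (simp add: St_def)
      then show "h g \<in> V"
        using f[OF g] quadrant_half_plane(1)[of "\<beta> g" "1 - g v"] by (auto simp: h_def V_def half_plane_def)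
    qed
    show "k ` V \<subseteq> St" using k(1) by blast
    show "k (h g) = g" if g: "g \<in> St" for g
    proof -
      have "k (h g) = fan_point v ys (1 - g v) (\<beta> g) 0"
        using f[OF g] quadrant_half_plane(1,2)[of "\<beta> g" "1 - g v"] by (simp add: k_def h_def)
      then show ?thesis using f[OF g] by simp
    qed
    show "h (k p) = p" if "p \<in> V" for p
      unfolding h_def k(2,3)[OF that] quadrant_half_plane(3,4) by simp
  qed
  then show ?thesis using V unfolding St_def by blast
qed

text \<open>Cutting the cycle at its closing edge leaves a fan, charted as for a path, that fills
  the lower half of a diamond; the closing triangle fills the upper half. In that triangle the
  common weight \<open>t\<close> of the two end vertices measures the distance from the cut, and
  what remains lies on one of the two rays where the halves meet.\<close>

lemma star_chart_cycle:
  assumes K: "finite_simplicial_complex K" and v: "{v} \<in> K" "v \<notin> set ys"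
    and ys: "distinct ys" "3 \<le> length ys" and L: "link K v = cycle_complex ys"
  shows "\<exists>V h k. openin (top_of_set half_plane) V \<and> homeomorphism {f \<in> realization K. 0 < f v} V h k"
proof -
  define St where "St = {f \<in> realization K. 0 < f v}"
  \<comment> \<open>The centre \<open>(0, 2)\<close> is high enough for the whole diamond to lie
    above the boundary line: its second coordinates exceed 3/2. So this planar open set is also open
    in the half plane.\<close>
  define V where "V = {p::real\<times>real. 2 * \<bar>snd p - 2\<bar> + \<bar>fst p\<bar> < 1}"
  define t where "t f = min (f (hd ys)) (f (last ys))" for f :: "'a \<Rightarrow> real"
  define \<beta> where "\<beta> f = fan_height ys (t f) f" for f
  define s where "s f = 1 - f v - 2 * t f" for f
  define h where "h f = (s f - 2 * \<beta> f, 2 + t f - min (s f - \<beta> f) (\<beta> f))" for f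
  define k where "k p = fan_point v ys (2 * max (2 - snd p) 0 + \<bar>fst p\<bar>)
    (max (2 - snd p) 0 + max (- fst p) 0) (max (snd p - 2) 0)" for p
  have "open V" unfolding V_def by (intro open_Collect_less continuous_intros)
  moreover have "V \<subseteq> half_plane" by (auto simp: V_def half_plane_def abs_if split: if_splits)
  ultimately have V: "openin (top_of_set half_plane) V" by (rule open_subset[rotated])
  define n where "n = length ys - 1"
  have ys2: "2 \<le> length ys" and ne: "ys \<noteq> []" and n: "2 \<le> n" "length ys = Suc n" "0 < length ys - 1"
    using ys by (auto simp: n_def)
  have hl: "hd ys = ys ! 0" "last ys = ys ! n" using ne by (simp_all add: hd_conv_nth last_conv_nth n_def)
  have hlv: "hd ys \<noteq> v" "last ys \<noteq> v" "hd ys \<noteq> last ys"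
    using v ne hd_in_set last_in_set ys n by (auto simp: hl nth_eq_iff_index_eq)
  have path: "path_complex ys \<subseteq> link K v" unfolding L cycle_complex_def by blast
  have "{last ys, hd ys} \<in> link K v" unfolding L cycle_complex_def by blast
  then have T: "{v, hd ys, last ys} \<in> K" by (simp add: link_def insert_commute)
  have f: "f = fan_point v ys (s f) (\<beta> f) (t f) \<and> 0 \<le> \<beta> f \<and> \<beta> f \<le> s f \<and> 0 \<le> t f
      \<and> (t f = 0 \<or> min (s f - \<beta> f) (\<beta> f) = 0)" if "f \<in> St" for f
  proof -
    have fR: "f \<in> realization K" "0 < f v" using that by (auto simp: St_def)
    note nn = realization_nonneg[OF fR(1)]
    have t0: "0 \<le> t f" using nn by (simp add: t_def)
    consider j where "Suc j < length ys" "{x. f x \<noteq> 0} \<subseteq> {v, ys ! j, ys ! Suc j}"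
      | "{x. f x \<noteq> 0} \<subseteq> {v, hd ys, last ys}"
    proof -
      have "(\<exists>j. Suc j < length ys \<and> {x. f x \<noteq> 0} \<subseteq> {v, ys ! j, ys ! Suc j})
          \<or> {x. f x \<noteq> 0} \<subseteq> {v, hd ys, last ys}"
        using star_support[OF K fR]
      proof
        assume "{x. f x \<noteq> 0} = {v}"
        then show ?thesis by auto
      next
        assume "\<exists>Y\<in>link K v. {x. f x \<noteq> 0} = insert v Y"
        then obtain Y where Y: "Y \<in> cycle_complex ys" "{x. f x \<noteq> 0} = insert v Y" using L by blast
        show ?thesis
        proof (cases "Y \<in> path_complex ys")
          case True
          then show ?thesis using Y path_complex_in_edge[OF _ ys2] by (metis insert_mono)
        next
          case False
          then have "Y = {last ys, hd ys}" using Y by (simp add: cycle_complex_def)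
          then show ?thesis using Y by auto
        qed
      qed
      then show ?thesis using that by blast
    qed
    then show ?thesis
    proof cases
      case j: 1
      note F = fan_point_of_edge[OF ys(1) v(2) ys2 fR(1) j]
      \<comment> \<open>With at least three vertices no edge of the path contains both ends, so one
        end coordinate vanishes and \<open>t\<close> is zero on the fan.\<close>
      have "f (ys ! 0) = 0 \<or> f (ys ! n) = 0"
        using F(4)[of 0] F(4)[of n] n by (cases "j = 0") auto
      then have tf: "t f = 0" using nn[of "ys ! 0"] nn[of "ys ! n"] by (auto simp: t_def hl min_def)
      then show ?thesis using F(1-3) by (simp add: \<beta>_def s_def)
    next
      case 2
      have z: "f x = 0" if "x \<notin> {v, hd ys, last ys}" for x using 2 that by blast
      have "sum f {v, hd ys, last ys} = 1" using realization_sum[OF fR(1) _ 2] by simp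
      then have fv: "f v = 1 - f (hd ys) - f (last ys)" using hlv by simp
      have zi: "f (ys ! i) = 0" if "i < length ys" "i \<noteq> 0" "i \<noteq> n" for i
        using that ys v nth_mem[of i ys] n by (intro z) (auto simp: hl nth_eq_iff_index_eq)
      have zo: "f x = 0" if "x \<noteq> v" "x \<notin> set ys" for x
        using that ne hd_in_set[of ys] last_in_set[of ys] by (intro z) auto
      have m1: "Suc (n - 1) = n" using n by simp
      have "(\<Sum>i<length ys. real i * f (ys ! i))
          = real (n - 1) * f (ys ! (n - 1)) + real (Suc (n - 1)) * f (ys ! Suc (n - 1))"
        by (rule sum_two_indices) (use zi n in auto)
      also have "\<dots> = real n * f (last ys)" using zi[of "n - 1"] n unfolding m1 by (simp add: hl)
      finally have \<beta>: "\<beta> f = f (last ys) - t f"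
        using n by (simp add: \<beta>_def fan_height_def n_def[symmetric])
      have sf: "s f = f (hd ys) + f (last ys) - 2 * t f" by (simp add: s_def fv)
      have m0: "min (s f - \<beta> f) (\<beta> f) = 0" unfolding \<beta> sf t_def by (auto simp: min_def)
      \<comment> \<open>Subtracting \<open>t\<close> leaves at most one nonzero end coordinate,
        hence a point over the first or the last edge of the path, to which the uniqueness lemma
        applies.\<close>
      define c where "c i = f (ys ! i) - (if i = 0 \<or> i = n then t f else 0)" for i
      have cz: "c i = 0" if "i < length ys" "i \<noteq> 0" "i \<noteq> n" for i using zi that by (simp add: c_def)
      have chl: "c 0 = f (hd ys) - t f" "c n = f (last ys) - t f" by (simp_all add: c_def hl)
      have "\<exists>j. Suc j < length ys \<and> (\<forall>i<length ys. i \<noteq> j \<and> i \<noteq> Suc j \<longrightarrow> c i = 0)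
          \<and> 0 \<le> c j \<and> 0 \<le> c (Suc j) \<and> c j + c (Suc j) = c 0 + c n"
      proof (cases "f (last ys) \<le> f (hd ys)")
        case True
        then have "c n = 0" "0 \<le> c 0" by (simp_all add: chl t_def)
        then show ?thesis using cz n by (intro exI[of _ 0]) force
      next
        case False
        then have "c 0 = 0" "0 \<le> c n" by (simp_all add: chl t_def)
        then show ?thesis using cz[of "n - 1"] cz n m1 by (intro exI[of _ "n - 1"]) force
      qed
      then obtain j where j: "Suc j < length ys" "\<And>i. i < length ys \<Longrightarrow> i \<noteq> j \<Longrightarrow> i \<noteq> Suc j \<Longrightarrow> c i = 0"
          "0 \<le> c j" "0 \<le> c (Suc j)" "c j + c (Suc j) = c 0 + c n" by blast
      have fv': "f v = 1 - c j - c (Suc j) - 2 * t f" using j(5) by (simp add: chl fv)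
      have "f = fan_point v ys (1 - f v - 2 * t f) (fan_height ys (t f) f) (t f) \<and> 0 \<le> fan_height ys (t f) f
        \<and> fan_height ys (t f) f \<le> 1 - f v - 2 * t f"
        by (intro conjI fan_point_unique[OF ys(1) v(2) ys2 j(1), where c = c])
          (use j fv' zo in \<open>auto simp: c_def n_def\<close>)
      then show ?thesis using m0 t0 by (simp add: \<beta>_def s_def)
    qed
  qed
  have k: "k p \<in> St \<and> t (k p) = max (snd p - 2) 0 \<and> s (k p) = 2 * max (2 - snd p) 0 + \<bar>fst p\<bar>
      \<and> \<beta> (k p) = max (2 - snd p) 0 + max (- fst p) 0" if "p \<in> V" for p
  proof -
    define s' b t' where "s' = 2 * max (2 - snd p) 0 + \<bar>fst p\<bar>"
      and "b = max (2 - snd p) 0 + max (- fst p) 0" and "t' = max (snd p - 2) 0"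
    have b: "0 \<le> b" "b \<le> s'" "0 \<le> t'" "s' + 2 * t' < 1"
      and bt: "t' = 0 \<or> b = 0 \<or> b = s'" using that
      by (auto simp: V_def half_plane_def s'_def b_def t'_def max_def abs_if split: if_splits)
    have kp: "k p = fan_point v ys s' b t'" by (simp add: k_def s'_def b_def t'_def)
    have val: "k p (ys ! i) = hat s' (real n * b) i + (if i = 0 \<or> i = n then t' else 0)"
      if "i < length ys" for i
      unfolding kp using fan_point_vertex[OF ys(1) v(2) that, of s' b t'] by (simp add: n_def)
    have kv: "k p v = 1 - s' - 2 * t'" by (simp add: kp fan_point_apex)
    \<comment> \<open>The two end tents could overlap only on a path with a single edge. As
      \<open>n\<close> is at least 2, the minimum of the end coordinates is exactly the added weight
      \<open>t'\<close>.\<close>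
    have "hat s' (real n * b) 0 = 0 \<or> hat s' (real n * b) n = 0"
    proof (rule ccontr)
      assume "\<not> ?thesis"
      then have "real n * b < s'" "real n * s' - real n * b < s'"
        using b by (auto simp: hat_def max_def split: if_splits)
      then have "real n * s' < 2 * s'" by simp
      moreover have "2 * s' \<le> real n * s'" using b n by (intro mult_right_mono) auto
      ultimately show False by simp
    qed
    moreover have "0 \<le> hat s' (real n * b) 0" "0 \<le> hat s' (real n * b) n" by (simp_all add: hat_def)
    moreover have "k p (ys ! 0) = hat s' (real n * b) 0 + t'" "k p (ys ! n) = hat s' (real n * b) n + t'"
      using val[of 0] val[of n] n by simp_all
    ultimately have tk: "t (k p) = t'" unfolding t_def hl by (auto simp: min_def)
    then have sk: "s (k p) = s'" by (simp add: s_def kv)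
    have \<beta>k: "\<beta> (k p) = b"
      unfolding \<beta>_def tk unfolding kp using fan_height_fan_point[OF ys(1) v(2) ys2 b(1,2)] .
    have "k p \<in> realization K"
    proof (cases "t' = 0")
      case True
      then show ?thesis unfolding kp using b path
        by (simp add: fan_point_in_realization[OF K v(2) ys(1) ys2])
    next
      case False
      with bt consider "b = 0" | "b = s'" by blast
      then have hats: "hat s' (real n * b) 0 + hat s' (real n * b) n = s' \<and>
          (\<forall>i. i \<noteq> 0 \<and> i < n \<longrightarrow> hat s' (real n * b) i = 0)"
      proof cases
        case 1
        then have "real 0 * s' \<le> real n * b" "real n * b \<le> real (Suc 0) * s'" using b by auto
        note H = hat_interval[OF this]
        have "hat s' (real n * b) i = 0" if "i \<noteq> 0" for i
          using H(2) H(3)[of i] that 1 by (cases "i = Suc 0") auto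
        then show ?thesis using H(1) n 1 by auto
      next
        case 2
        have m1: "Suc (n - 1) = n" using n by simp
        have "real (n - 1) * s' \<le> real n * b" "real n * b \<le> real (Suc (n - 1)) * s'"
          unfolding m1 2 using b by (auto intro: mult_right_mono)
        note H = hat_interval[OF this]
        have "hat s' (real n * b) i = 0" if "i < n" for i
          using H(1) H(3)[of i] that 2 m1 by (cases "i = n - 1") auto
        moreover have "hat s' (real n * b) n = s'"
          using H(2) m1 2 n by (simp add: algebra_simps of_nat_diff)
        ultimately show ?thesis using n by auto
      qed
      show ?thesis
      proof (rule realizationI[OF K T])
        have e0: "k p (hd ys) = hat s' (real n * b) 0 + t'" and en: "k p (last ys) = hat s' (real n * b) n + t'"
          using val[of 0] val[of n] n by (simp_all add: hl)
        show z: "k p x = 0" if x: "x \<notin> {v, hd ys, last ys}" for x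
        proof (cases "x \<in> set ys")
          case True
          then obtain i where i: "i < length ys" "x = ys ! i" by (metis in_set_conv_nth)
          have "i \<noteq> 0"
          proof
            assume "i = 0"
            then show False using i(2) x hl by simp
          qed
          have "i \<noteq> n"
          proof
            assume "i = n"
            then show False using i(2) x hl by simp
          qed
          then have "i < n" using i(1) n(2) by linarith
          then show ?thesis using val[OF i(1)] hats i(2) \<open>i \<noteq> 0\<close> by simp
        qed (use x fan_point_other[OF ne] in \<open>auto simp: kp\<close>)
        have "k p x \<ge> 0" if "x \<in> {v, hd ys, last ys}" for x
          using that b e0 en by (auto simp: kv hat_def)
        then show "0 \<le> k p x" for x using z[of x] by fastforce
        show "sum (k p) {v, hd ys, last ys} = 1"
          using hlv hats by (simp add: e0 en kv)
      qed
    qed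
    then have "k p \<in> St" using b by (simp add: St_def kv)
    then show ?thesis using tk sk \<beta>k by (simp add: s'_def b_def t'_def)
  qed
  have "homeomorphism St V h k"
  proof (rule homeomorphismI)
    show "continuous_on St h" unfolding h_def \<beta>_def s_def t_def
      by (intro continuous_intros continuous_on_coordinate continuous_on_fan_height)
    show "continuous_on V k" unfolding k_def
      by (intro continuous_on_fan_point continuous_intros)
    show "h ` St \<subseteq> V"
    proof (rule image_subsetI)
      fix g assume g: "g \<in> St"
      then have "0 < g v" by (simp add: St_def)
      then have "s g + 2 * t g < 1" by (simp add: s_def)
      then show "h g \<in> V"
        using f[OF g] quadrant_half_plane(1)[of "\<beta> g" "s g"] by (auto simp: h_def V_def abs_if)
    qed
    show "k ` V \<subseteq> St" using k by blast
    show "k (h g) = g" if g: "g \<in> St" for g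
    proof -
      define m where "m = min (s g - \<beta> g) (\<beta> g)"
      have "0 \<le> m" "t g = 0 \<or> m = 0" "0 \<le> t g" using f[OF g] by (auto simp: m_def)
      then have "max (m - t g) 0 = m" "max (t g - m) 0 = t g" by auto
      then have "k (h g) = fan_point v ys (2 * m + \<bar>s g - 2 * \<beta> g\<bar>) (m + max (2 * \<beta> g - s g) 0) (t g)"
        by (simp add: k_def h_def m_def)
      also have "\<dots> = fan_point v ys (s g) (\<beta> g) (t g)"
        using f[OF g] quadrant_half_plane(1,2)[of "\<beta> g" "s g"] by (simp add: m_def)
      finally show ?thesis using f[OF g] by simp
    qed
    show "h (k p) = p" if "p \<in> V" for p
    proof -
      have "max (snd p - 2) 0 - max (2 - snd p) 0 = snd p - 2" by (simp add: max_def)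
      moreover have "h (k p) = (fst p, 2 + max (snd p - 2) 0 - max (2 - snd p) 0)"
        using k[OF that] quadrant_half_plane(3,4)[of "max (2 - snd p) 0" "fst p"] by (simp add: h_def)
      ultimately show ?thesis by (simp add: prod_eq_iff)
    qed
  qed
  then show ?thesis using V unfolding St_def by blast
qed

section \<open>From combinatorial to topological surfaces\<close>

lemma second_countable_realization_space:
  assumes K: "finite_simplicial_complex K"
  shows "second_countable_space (realization_space K)"
proof -
  define V where "V = \<Union>K"
  have "finite V" using K by (auto simp: V_def finite_simplicial_complex_def)
  then obtain e :: "'a \<Rightarrow> nat" where e: "inj_on e V" using finite_imp_inj_to_nat_seg by metis
  \<comment> \<open>The vertex type may be uncountable, and then the full function space has no
    countable basis. Only the finitely many vertices of \<open>K\<close> matter, so the realization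
    is carried into \<open>nat \<Rightarrow> real\<close> by \<open>F\<close> and back by
    \<open>G\<close>.\<close>
  define F where "F f i = (if i \<in> e ` V then f (inv_into V e i) else 0)" for f :: "'a \<Rightarrow> real" and i
  define G where "G g x = (if x \<in> V then g (e x) else 0)" for g :: "nat \<Rightarrow> real" and x
  have GF: "G (F f) = f" if "f \<in> realization K" for f
  proof
    fix x
    have "f x = 0" if "x \<notin> V"
      using realization_support[OF \<open>f \<in> realization K\<close>] that by (auto simp: V_def)
    then show "G (F f) x = f x" using e by (simp add: G_def F_def)
  qed
  have F: "continuous_on UNIV F"
  proof (rule continuous_on_coordinatewise_then_product)
    show "continuous_on UNIV (\<lambda>f. F f i)" for i
      by (cases "i \<in> e ` V") (simp_all add: F_def)
  qed
  have G: "continuous_on UNIV G"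
  proof (rule continuous_on_coordinatewise_then_product)
    show "continuous_on UNIV (\<lambda>g. G g x)" for x
      by (cases "x \<in> V") (simp_all add: G_def)
  qed
  obtain B :: "(nat \<Rightarrow> real) set set" where B: "countable B" "topological_basis B"
    using ex_countable_basis by blast
  define C where "C = (\<lambda>b. realization K \<inter> F -` b) ` B"
  show ?thesis unfolding second_countable_space_def
  proof (intro exI[of _ C] conjI ballI allI impI)
    show "countable C" using B by (simp add: C_def)
    fix W assume "W \<in> C"
    then obtain b where b: "b \<in> B" "W = realization K \<inter> F -` b" by (auto simp: C_def)
    have "open (F -` b)" by (rule open_vimage[OF topological_basis_open[OF B(2) b(1)] F])
    then show "openin (realization_space K) W" unfolding b(2) by (rule openin_open_Int)
  next
    fix U f assume U: "openin (realization_space K) U \<and> f \<in> U"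
    then obtain O' where O': "open O'" "U = realization K \<inter> O'" by (auto simp: openin_open)
    have fR: "f \<in> realization K" using U O' by blast
    have "open (G -` O')" using G O' open_vimage by blast
    moreover have "F f \<in> G -` O'" using GF[OF fR] U O' by simp
    ultimately obtain b where b: "b \<in> B" "F f \<in> b" "b \<subseteq> G -` O'"
      using B(2) topological_basisE by metis
    have "realization K \<inter> F -` b \<subseteq> U"
    proof
      fix g assume g: "g \<in> realization K \<inter> F -` b"
      then have "G (F g) \<in> O'" using b by blast
      then show "g \<in> U" using GF[of g] g O' by simp
    qed
    then show "\<exists>W\<in>C. f \<in> W \<and> W \<subseteq> U" using b fR unfolding C_def by blast
  qed
qed

lemma comb_surface_imp_surface:
  assumes K: "comb_surface K"
  shows "surface_with_boundary (realization_space K)"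
  unfolding surface_with_boundary_top_of_set
proof (intro conjI ballI)
  note fK = comb_surface_complex[OF K]
  have "Hausdorff_space (euclidean :: ('a \<Rightarrow> real) topology)"
    unfolding euclidean_product_topology[symmetric] Hausdorff_space_product_topology by simp
  then show "Hausdorff_space (realization_space K)" by (rule Hausdorff_space_subtopology)
  show "second_countable_space (realization_space K)"
    by (rule second_countable_realization_space[OF fK])
  fix f assume f: "f \<in> realization K"
  have "{x. f x \<noteq> 0} \<noteq> {}" using simplex_nonempty[OF fK realization_support[OF f]] .
  then obtain v where v: "f v \<noteq> 0" by blast
  then have "{v} \<in> K" using simplex_face[OF fK realization_support[OF f], of "{v}"] by simp
  then obtain ys where ys: "distinct ys" "v \<notin> set ys"
    "2 \<le> length ys \<and> link K v = path_complex ys \<or> 3 \<le> length ys \<and> link K v = cycle_complex ys"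
    using comb_surface_link[OF K] by metis
  then have "\<exists>V h k. openin (top_of_set half_plane) V \<and> homeomorphism {f \<in> realization K. 0 < f v} V h k"
    using star_chart_path[OF fK \<open>{v} \<in> K\<close> ys(2,1)] star_chart_cycle[OF fK \<open>{v} \<in> K\<close> ys(2,1)] by blast
  moreover have "openin (realization_space K) {f \<in> realization K. 0 < f v}"
    using openin_positive_coordinates[of "{v}" K] by simp
  moreover have "f \<in> {f \<in> realization K. 0 < f v}"
    using f v realization_nonneg[OF f, of v] by simp
  ultimately show "\<exists>U V h k. openin (realization_space K) U \<and> f \<in> U
      \<and> openin (top_of_set half_plane) V \<and> homeomorphism U V h k" by blast
qed

section \<open>Paths, cones and relabellings\<close>

lemma path_complex_single: "path_complex [x] = {{x}}"
  by (auto simp: path_complex_def)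

lemma path_complex_Cons2: "path_complex (x # y # zs) = {{x}, {x,y}} \<union> path_complex (y # zs)"
proof -
  have "{{(x # y # zs) ! i, (x # y # zs) ! Suc i} | i. Suc i < length (x # y # zs)}
     = {{x,y}} \<union> {{(y # zs) ! i, (y # zs) ! Suc i} | i. Suc i < length (y # zs)}" (is "?l = ?r")
  proof (intro equalityI subsetI)
    fix e assume "e \<in> ?l"
    then obtain i where "e = {(x # y # zs) ! i, (x # y # zs) ! Suc i}" "Suc i < length (x # y # zs)" by blast
    then show "e \<in> ?r" by (cases i) auto
  next
    fix e assume "e \<in> ?r"
    then show "e \<in> ?l"
    proof
      assume "e \<in> {{x,y}}"
      then show ?thesis by (intro CollectI exI[of _ 0]) simp
    next
      assume "e \<in> {{(y # zs) ! i, (y # zs) ! Suc i} | i. Suc i < length (y # zs)}"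
      then obtain i where "e = {(y # zs) ! i, (y # zs) ! Suc i}" "Suc i < length (y # zs)" by blast
      then show ?thesis by (intro CollectI exI[of _ "Suc i"]) simp
    qed
  qed
  then show ?thesis unfolding path_complex_def by auto
qed

lemma singleton_in_path_complex: "{x} \<in> path_complex ys \<longleftrightarrow> x \<in> set ys"
  by (auto simp: path_complex_def)

lemma path_complex_append:
  "path_complex (as @ w # bs) = path_complex (as @ [w]) \<union> path_complex (w # bs)"
proof (induction as rule: induct_list012)
  case 1
  then show ?case by (cases bs) (auto simp: path_complex_single path_complex_Cons2)
qed (auto simp: path_complex_single path_complex_Cons2 singleton_in_path_complex)

lemma path_complex_snoc:
  "as \<noteq> [] \<Longrightarrow> path_complex (as @ [w]) = path_complex as \<union> {{w}, {last as, w}}"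
  by (induction as rule: induct_list012) (auto simp: path_complex_single path_complex_Cons2)

text \<open>A cycle is a path that returns to its start. Read this way, rotating a cycle and cutting
  it at two vertices both reduce to splitting a path at one of its vertices.\<close>

lemma cycle_complex_closed_path: "xs \<noteq> [] \<Longrightarrow> cycle_complex xs = path_complex (xs @ [hd xs])"
  unfolding cycle_complex_def by (auto simp: path_complex_snoc) (auto simp: path_complex_def)

lemma path_complex_subset: "X \<in> path_complex ys \<Longrightarrow> X \<subseteq> set ys"
  and path_complex_nonempty: "X \<in> path_complex ys \<Longrightarrow> X \<noteq> {}"
  by (auto simp: path_complex_def)

lemma path_complex_face:
  assumes "X \<in> path_complex ys" "Y \<subseteq> X" "Y \<noteq> {}"
  shows "Y \<in> path_complex ys"
proof -
  from assms(1) consider x where "X = {x}" | i where "X = {ys ! i, ys ! Suc i}" "Suc i < length ys"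
    unfolding path_complex_def by blast
  then show ?thesis
  proof cases
    case 1
    then show ?thesis using assms by (metis subset_singletonD)
  next
    case 2
    then have "Y = X \<or> Y = {ys ! i} \<or> Y = {ys ! Suc i}" using assms by blast
    moreover have "ys ! i \<in> set ys" "ys ! Suc i \<in> set ys" using 2 by auto
    ultimately show ?thesis using assms(1) singleton_in_path_complex by metis
  qed
qed

lemma path_complex_edge:
  assumes "distinct ys" "{a,b} \<in> path_complex ys" "a \<noteq> b"
  obtains i where "Suc i < length ys" "{a,b} = {ys ! i, ys ! Suc i}"
  using assms(2,3) unfolding path_complex_def by (auto dest: singleton_insert_inj_eq[THEN iffD1])

lemma path_complex_neighbour:
  assumes "distinct ys" "2 \<le> length ys" "x \<in> set ys"
  obtains y where "y \<noteq> x" "{x,y} \<in> path_complex ys"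
proof -
  obtain i where i: "i < length ys" "x = ys ! i" using assms(3) by (metis in_set_conv_nth)
  show ?thesis
  proof (cases "Suc i < length ys")
    case True
    then have "ys ! Suc i \<noteq> x" "{x, ys ! Suc i} \<in> path_complex ys"
      using i assms(1) by (auto simp: path_complex_def nth_eq_iff_index_eq)
    then show ?thesis using that by blast
  next
    case False
    then obtain k where k: "i = Suc k" using i assms(2) by (cases i) auto
    then have "ys ! k \<noteq> x" "{x, ys ! k} \<in> path_complex ys"
      using i assms(1) unfolding path_complex_def by (auto simp: nth_eq_iff_index_eq insert_commute)
    then show ?thesis using that by blast
  qed
qed

text \<open>Connectedness of a path, in the cut form used for links.\<close>

lemma path_complex_crossing:
  assumes "a \<in> set ys" "b \<in> set ys" "a \<in> A" "b \<notin> A"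
  shows "\<exists>x y. x \<in> A \<and> y \<notin> A \<and> {x,y} \<in> path_complex ys"
  using assms
proof (induction ys arbitrary: a b rule: induct_list012)
  case (3 x y zs)
  show ?case
  proof (cases "x \<in> A \<longleftrightarrow> y \<in> A")
    case True
    obtain a' b' where "a' \<in> set (y # zs)" "b' \<in> set (y # zs)" "a' \<in> A" "b' \<notin> A"
      using "3.prems" True by (cases "a = x"; cases "b = x") auto
    then have "\<exists>x y'. x \<in> A \<and> y' \<notin> A \<and> {x,y'} \<in> path_complex (y # zs)" by (rule "3.IH"(2))
    then show ?thesis unfolding path_complex_Cons2 by blast
  next
    case False
    then show ?thesis unfolding path_complex_Cons2 by (metis UnI1 insert_commute insertCI)
  qed
qed auto

section \<open>Closure properties of combinatorial surfaces\<close>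

lemma comb_surfaceI:
  assumes "thin_complex K" "\<And>X. X \<in> K \<Longrightarrow> \<exists>T\<in>K. X \<subseteq> T \<and> card T = 3"
    "\<And>v A a b. {v,a} \<in> K \<Longrightarrow> a \<noteq> v \<Longrightarrow> a \<in> A \<Longrightarrow> {v,b} \<in> K \<Longrightarrow> b \<noteq> v \<Longrightarrow> b \<notin> A \<Longrightarrow>
        \<exists>x y. x \<in> A \<and> y \<notin> A \<and> tri K v x y"
  shows "comb_surface K"
  using assms unfolding comb_surface_def by (intro conjI ballI allI impI) blast+

lemma comb_surface_pure:
  "comb_surface K \<Longrightarrow> X \<in> K \<Longrightarrow> \<exists>T\<in>K. X \<subseteq> T \<and> card T = 3"
  unfolding comb_surface_def by blast

lemma comb_surface_link_crossing:
  "comb_surface K \<Longrightarrow> {v,a} \<in> K \<Longrightarrow> a \<noteq> v \<Longrightarrow> a \<in> A \<Longrightarrow> {v,b} \<in> K \<Longrightarrow> b \<noteq> v \<Longrightarrow> b \<notin> A \<Longrightarrow>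
    \<exists>x y. x \<in> A \<and> y \<notin> A \<and> tri K v x y"
  unfolding comb_surface_def by blast

lemma thin_complex_subcomplex:
  assumes "thin_complex D" "S \<subseteq> D" "finite_simplicial_complex S"
  shows "thin_complex S"
proof (rule thin_complexI[OF assms(3)])
  have "tri S x y z \<Longrightarrow> tri D x y z" for x y z using assms(2) by (auto simp: tri_def)
  then show "a = b \<or> b = c \<or> a = c" if "tri S x y a" "tri S x y b" "tri S x y c" for x y a b c
    using thin_complex_edge[OF assms(1)] that by blast
qed (use thin_complex_card[OF assms(1)] assms(2) in blast)

text \<open>Thinness comes from the ambient complex \<open>D\<close>. The link of the apex is the
  path itself, and the link of a path vertex only gains \<open>w\<close>, attached to a path
  neighbour that is already there. The boundary claim is thinness again: every path edge lies in a
  triangle with \<open>w\<close>, so at most one triangle of \<open>S\<close> is left for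
  it.\<close>

lemma cone_over_path_surface:
  assumes S: "comb_surface S" and D: "thin_complex D" and sub: "S \<union> cone_over w (path_complex ys) \<subseteq> D"
    and ys: "distinct ys" "2 \<le> length ys" and L: "path_complex ys \<subseteq> S" and w: "w \<notin> \<Union>S"
  shows "comb_surface (S \<union> cone_over w (path_complex ys))"
    and "realization (path_complex ys) \<subseteq> surface_boundary (realization_space S)"
proof -
  define S' where "S' = S \<union> cone_over w (path_complex ys)"
  note fS = comb_surface_complex[OF S]
  have mem: "X \<in> S' \<longleftrightarrow> X \<in> S \<or> X = {w} \<or> (\<exists>Y\<in>path_complex ys. X = insert w Y)" for X
    using L by (auto simp: S'_def cone_over_def)
  have wys: "w \<notin> set ys" using w L singleton_in_path_complex by (metis UnionI singletonI subsetD)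
  have wL: "Y \<in> path_complex ys \<Longrightarrow> w \<notin> Y" for Y using wys path_complex_subset by blast
  have triS: "tri S' a b c" if "tri S a b c" for a b c
    using that by (simp add: tri_def mem)
  have triw: "tri S' w a b" if "{a,b} \<in> path_complex ys" "a \<noteq> b" for a b
    using that wL[OF that(1)] by (auto simp: tri_def mem)
  have edge: "{u,a} \<in> S" if "{u,a} \<in> S'" "u \<noteq> w" "a \<noteq> w" for u a
  proof -
    have "w \<notin> {u,a}" using that by simp
    then show ?thesis using that(1) unfolding mem by (metis insertI1)
  qed
  have edgew: "a \<in> set ys" if "{w,a} \<in> S'" "a \<noteq> w" for a
  proof -
    from that w obtain Y where "Y \<in> path_complex ys" "{w,a} = insert w Y" unfolding mem by auto
    then have "Y = {a}" using wL that(2) by (metis insert_ident singletonD)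
    then show ?thesis using \<open>Y \<in> path_complex ys\<close> by (simp add: singleton_in_path_complex)
  qed
  have fS': "finite_simplicial_complex S'"
    unfolding finite_simplicial_complex_def
  proof (intro conjI ballI allI impI)
    have "finite (path_complex ys)" using L fS by (meson finite_simplicial_complex_def finite_subset)
    then show "finite S'" using fS by (simp add: S'_def cone_over_def finite_simplicial_complex_def)
    fix X assume X: "X \<in> S'"
    show "finite X" using X L simplex_finite[OF fS] unfolding mem by auto
    show "X \<noteq> {}" using X simplex_nonempty[OF fS] unfolding mem by auto
    fix Y assume Y: "Y \<subseteq> X \<and> Y \<noteq> {}"
    from X consider "X \<in> S" | "X = {w}" | Z where "Z \<in> path_complex ys" "X = insert w Z"
      unfolding mem by blast
    then show "Y \<in> S'"
    proof cases
      case 1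
      then show ?thesis using simplex_face[OF fS 1] Y by (auto simp: mem)
    next
      case 2
      then have "Y = {w}" using Y by blast
      then show ?thesis by (simp add: mem)
    next
      case 3
      show ?thesis
      proof (cases "Y - {w} = {}")
        case True
        then have "Y = {w}" using Y by blast
        then show ?thesis by (simp add: mem)
      next
        case False
        have "Y - {w} \<subseteq> Z" using Y 3 by blast
        then have m: "Y - {w} \<in> path_complex ys" using path_complex_face[OF 3(1)] False by blast
        show ?thesis
        proof (cases "w \<in> Y")
          case True
          then have "Y = insert w (Y - {w})" by blast
          then show ?thesis using m mem by blast
        next
          case False
          then show ?thesis using m L by (auto simp: mem)
        qed
      qed
    qed
  qed
  have thin: "thin_complex S'" using thin_complex_subcomplex[OF D _ fS'] sub by (simp add: S'_def)
  have nb: "\<exists>y. y \<noteq> u \<and> {u,y} \<in> path_complex ys" if "u \<in> set ys" for u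
    using path_complex_neighbour[OF ys that] by metis
  show "comb_surface (S \<union> cone_over w (path_complex ys))"
    unfolding S'_def[symmetric]
  proof (rule comb_surfaceI[OF thin])
    fix X assume X: "X \<in> S'"
    have T: "insert w {a,b} \<in> S' \<and> card (insert w {a,b}) = 3" if "{a,b} \<in> path_complex ys" "a \<noteq> b" for a b
      using that wL[OF that(1)] by (auto simp: mem)
    from X consider "X \<in> S" | "X = {w}" | Z where "Z \<in> path_complex ys" "X = insert w Z"
      unfolding mem by blast
    then show "\<exists>T\<in>S'. X \<subseteq> T \<and> card T = 3"
    proof cases
      case 1
      then show ?thesis using comb_surface_pure[OF S 1] by (auto simp: mem)
    next
      case 2
      have "hd ys \<in> set ys" using ys by (intro hd_in_set) auto
      then obtain y where "y \<noteq> hd ys" "{hd ys,y} \<in> path_complex ys" using nb by blast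
      then show ?thesis using T[of "hd ys" y] 2 by blast
    next
      case 3
      obtain i where i: "Suc i < length ys" "Z \<subseteq> {ys ! i, ys ! Suc i}"
        using path_complex_in_edge[OF 3(1) ys(2)] .
      have "ys ! i \<noteq> ys ! Suc i" "{ys ! i, ys ! Suc i} \<in> path_complex ys"
        using i ys by (auto simp: path_complex_def nth_eq_iff_index_eq)
      then show ?thesis using T i(2) 3(2) by (metis insert_mono)
    qed
  next
    fix u A a b
    assume a: "{u,a} \<in> S'" "a \<noteq> u" "a \<in> A" and b: "{u,b} \<in> S'" "b \<noteq> u" "b \<notin> A"
    show "\<exists>x y. x \<in> A \<and> y \<notin> A \<and> tri S' u x y"
    proof (cases "u = w")
      case True
      then have ab: "a \<in> set ys" "b \<in> set ys" using edgew a b by auto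
      obtain x y where xy: "x \<in> A" "y \<notin> A" "{x,y} \<in> path_complex ys"
        using path_complex_crossing[OF ab a(3) b(3)] by blast
      then have "x \<noteq> y" by blast
      then show ?thesis using triw[OF xy(3)] True xy by blast
    next
      case False
      have cr: ?thesis if "{u,c} \<in> S" "c \<noteq> u" "c \<in> A" "{u,d} \<in> S" "d \<noteq> u" "d \<notin> A" for c d
        using comb_surface_link_crossing[OF S that] triS by blast
      \<comment> \<open>A cut between \<open>w\<close> and an old link vertex either separates
        \<open>w\<close> from this neighbour \<open>y\<close>, or separates \<open>y\<close> from
        the old vertex inside \<open>S\<close>.\<close>
      have nbw: "\<exists>y. y \<noteq> u \<and> {u,y} \<in> S \<and> tri S' u w y \<and> tri S' u y w" if "{u,w} \<in> S'"
      proof -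
        have "u \<in> set ys" using edgew[of u] that False by (simp add: insert_commute)
        then obtain y where y: "y \<noteq> u" "{u,y} \<in> path_complex ys" using nb by blast
        then have t: "tri S' w u y" using triw by blast
        have "{u,y} \<in> S" using y L by blast
        then show ?thesis using y(1) tri_swap[OF t] tri_rotate[OF t] by blast
      qed
      show ?thesis
      proof (cases "a = w")
        case True
        then obtain y where y: "y \<noteq> u" "{u,y} \<in> S" "tri S' u w y" using nbw a by blast
        have "{u,b} \<in> S" using edge b True a False by metis
        then show ?thesis using y cr[of y b] b True a by (cases "y \<in> A") blast+
      next
        case aw: False
        have aS: "{u,a} \<in> S" using edge a aw False by metis
        show ?thesis
        proof (cases "b = w")
          case True
          then obtain y where y: "y \<noteq> u" "{u,y} \<in> S" "tri S' u y w" using nbw b by blast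
          then show ?thesis using cr[of a y] aS a b True by (cases "y \<in> A") blast+
        next
          case bw: False
          have "{u,b} \<in> S" using edge b bw False by metis
          then show ?thesis using cr[of a b] aS a b by blast
        qed
      qed
    qed
  qed
  show "realization (path_complex ys) \<subseteq> surface_boundary (realization_space S)"
  proof (rule path_in_boundary[OF S ys])
    fix i assume i: "Suc i < length ys"
    let ?x = "ys ! i" and ?y = "ys ! Suc i"
    have e: "{?x,?y} \<in> path_complex ys" "?x \<noteq> ?y"
      using i ys by (auto simp: path_complex_def nth_eq_iff_index_eq)
    then show "{?x,?y} \<in> S" using L by blast
    fix a b assume ab: "tri S ?x ?y a" "tri S ?x ?y b"
    have "tri S' ?x ?y w" using tri_rotate[OF triw[OF e]] .
    then have "a = b \<or> b = w \<or> a = w" using thin_complex_edge[OF thin] triS ab by metis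
    moreover have "a \<noteq> w" "b \<noteq> w" using ab w by (auto simp: tri_def)
    ultimately show "a = b" by blast
  qed
qed

lemma comb_surface_bij_image:
  assumes S: "comb_surface S" and f: "bij f"
  shows "comb_surface ((`) f ` S)" (is "comb_surface ?S")
proof -
  note fS = comb_surface_complex[OF S]
  have inj: "inj f" using f by (rule bij_is_inj)
  have mem: "f ` X \<in> ?S \<longleftrightarrow> X \<in> S" for X
    using inj by (simp add: inj_image_mem_iff inj_on_image)
  have f_inv: "f (inv f x) = x" for x using f by (simp add: bij_is_surj surj_f_inv_f)
  have tri_f: "tri ?S (f x) (f y) (f z) \<longleftrightarrow> tri S x y z" for x y z
    using mem[of "{x,y,z}"] inj by (simp add: tri_def inj_eq)
  have tri_f': "tri ?S x y z \<longleftrightarrow> tri S (inv f x) (inv f y) (inv f z)" for x y z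
    using tri_f[of "inv f x" "inv f y" "inv f z"] by (simp add: f_inv)
  have fin: "finite_simplicial_complex ?S"
    unfolding finite_simplicial_complex_def
  proof (intro conjI ballI allI impI)
    show "finite ?S" using fS by (simp add: finite_simplicial_complex_def)
    fix X assume "X \<in> ?S"
    then obtain Z where Z: "Z \<in> S" "X = f ` Z" by blast
    show "finite X" "X \<noteq> {}" using Z simplex_finite[OF fS] simplex_nonempty[OF fS] by auto
    fix Y assume Y: "Y \<subseteq> X \<and> Y \<noteq> {}"
    then obtain Y' where "Y' \<subseteq> Z" "Y = f ` Y'" using Z(2) by (metis subset_imageE)
    then show "Y \<in> ?S" using simplex_face[OF fS Z(1)] Y by blast
  qed
  show ?thesis
  proof (rule comb_surfaceI)
    show "thin_complex ?S"
    proof (rule thin_complexI[OF fin])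
      show "card X \<le> 3" if "X \<in> ?S" for X
        using that thin_complex_card[OF comb_surface_thin[OF S]] inj
        by (auto simp: card_image inj_on_subset)
      show "a = b \<or> b = c \<or> a = c" if "tri ?S x y a" "tri ?S x y b" "tri ?S x y c"
        for x y a b c
        using thin_complex_edge[OF comb_surface_thin[OF S]] that unfolding tri_f' by (metis f_inv)
    qed
    show "\<exists>T\<in>?S. X \<subseteq> T \<and> card T = 3" if X: "X \<in> ?S" for X
    proof -
      obtain Z where Z: "Z \<in> S" "X = f ` Z" using X by blast
      then obtain T where "T \<in> S" "Z \<subseteq> T" "card T = 3" using comb_surface_pure[OF S] by blast
      then have "f ` T \<in> ?S" "X \<subseteq> f ` T" "card (f ` T) = 3"
        using Z inj by (auto simp: card_image inj_on_subset)
      then show ?thesis by blast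
    qed
    fix v A a b
    assume h: "{v,a} \<in> ?S" "a \<noteq> v" "a \<in> A" "{v,b} \<in> ?S" "b \<noteq> v" "b \<notin> A"
    have "\<exists>x y. x \<in> f -` A \<and> y \<notin> f -` A \<and> tri S (inv f v) x y"
    proof (rule comb_surface_link_crossing[OF S])
      show "{inv f v, inv f a} \<in> S" "{inv f v, inv f b} \<in> S"
        using h mem[of "{inv f v, inv f a}"] mem[of "{inv f v, inv f b}"] by (simp_all add: f_inv)
    qed (use h f_inv in \<open>auto, (metis f_inv)+\<close>)
    then show "\<exists>x y. x \<in> A \<and> y \<notin> A \<and> tri ?S v x y"
      using tri_f by (metis f_inv vimage_eq)
  qed
qed

section \<open>The complex obtained from a vertex split\<close>

lemma rename_simplex_notin: "a \<notin> X \<Longrightarrow> (\<lambda>x. if x = a then b else x) ` X = X"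
  and rename_simplex_insert: "a \<notin> X \<Longrightarrow> (\<lambda>x. if x = a then b else x) ` insert a X = insert b X"
  by (auto simp: image_iff)

lemma comb_surface_rename:
  assumes S: "comb_surface S" and b: "b \<notin> \<Union>S"
  shows "comb_surface (rename_vertex a b S)"
proof -
  have "(\<lambda>x. if x = a then b else x) ` X = Transposition.transpose a b ` X" if "X \<in> S" for X
    using b that by (intro image_cong refl) (auto simp: Transposition.transpose_def)
  then have "rename_vertex a b S = (`) (Transposition.transpose a b) ` S" unfolding rename_vertex_def by (rule image_cong[OF refl])
  then show ?thesis using comb_surface_bij_image[OF S bij_transpose] by simp
qed

text \<open>Two arcs that cover the link and share only two vertices replace the indexed cycle of
  \<open>vertex_split\<close>, so that the arcs become interchangeable. Intersecting the path
  complexes, not just the vertex sets, excludes a common edge between \<open>p\<close> and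
  \<open>q\<close>. That these vertices have a single neighbour in each arc is then a consequence of
  thinness.\<close>

locale star_split =
  fixes \<Delta> :: "'a set set" and v v' p q :: 'a and ys1 ys2 :: "'a list"
  assumes thin: "thin_complex \<Delta>" and v: "{v} \<in> \<Delta>" and v': "v' \<notin> \<Union>\<Delta>" and pq: "p \<noteq> q"
    and ys1: "distinct ys1" "2 \<le> length ys1" and ys2: "distinct ys2" "2 \<le> length ys2"
    and link: "link \<Delta> v = path_complex ys1 \<union> path_complex ys2"
    and inter: "path_complex ys1 \<inter> path_complex ys2 = {{p},{q}}"
begin

abbreviation "L1 \<equiv> path_complex ys1"
abbreviation "L2 \<equiv> path_complex ys2"

text \<open>Simplices are sorted by which of the two copies \<open>v\<close> and \<open>v'\<close>
  they contain. Arguments about the split complex thereby become case distinctions on the remaining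
  face instead of computations with unions of cones.\<close>

definition D :: "'a set set" where
  "D = {X. if v \<in> X then if v' \<in> X then X - {v,v'} \<in> {{},{p},{q}} else X - {v} \<in> insert {} L1
        else if v' \<in> X then X - {v'} \<in> insert {} L2 else X \<in> \<Delta>}"

lemma fin: "finite_simplicial_complex \<Delta>"
  using thin by (rule thin_complex_complex)

lemma vv': "v \<noteq> v'" using v v' by blast

lemma L_link: "X \<in> L1 \<union> L2 \<Longrightarrow> v \<notin> X \<and> v' \<notin> X \<and> insert v X \<in> \<Delta> \<and> X \<in> \<Delta>"
proof -
  assume "X \<in> L1 \<union> L2"
  then have X: "X \<noteq> {}" "v \<notin> X" "insert v X \<in> \<Delta>" unfolding link[symmetric] by (auto simp: link_def)
  then have "X \<in> \<Delta>" using simplex_face[OF fin X(3)] by blast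
  then show ?thesis using X v' by blast
qed

lemma in_L: "insert v X \<in> \<Delta> \<Longrightarrow> v \<notin> X \<Longrightarrow> X \<noteq> {} \<Longrightarrow> X \<in> L1 \<or> X \<in> L2"
  using link[unfolded link_def] by blast

lemma pq_L: "{p} \<in> L1" "{p} \<in> L2" "{q} \<in> L1" "{q} \<in> L2"
  using inter by blast+

lemma pq_v: "p \<noteq> v" "p \<noteq> v'" "q \<noteq> v" "q \<noteq> v'"
  using L_link pq_L by blast+

lemma D_none: "v \<notin> X \<Longrightarrow> v' \<notin> X \<Longrightarrow> X \<in> D \<longleftrightarrow> X \<in> \<Delta>"
  by (simp add: D_def)

lemma D_v: "v \<notin> Y \<Longrightarrow> v' \<notin> Y \<Longrightarrow> insert v Y \<in> D \<longleftrightarrow> Y \<in> insert {} L1"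
  using vv' by (simp add: D_def)

lemma D_v': "v \<notin> Y \<Longrightarrow> v' \<notin> Y \<Longrightarrow> insert v' Y \<in> D \<longleftrightarrow> Y \<in> insert {} L2"
  using vv' by (simp add: D_def)

lemma D_vv': "v \<notin> Y \<Longrightarrow> v' \<notin> Y \<Longrightarrow> insert v (insert v' Y) \<in> D \<longleftrightarrow> Y \<in> {{},{p},{q}}"
proof -
  assume Y: "v \<notin> Y" "v' \<notin> Y"
  then have "insert v (insert v' Y) - {v,v'} = Y" by blast
  then show ?thesis by (simp add: D_def)
qed

lemma simplex_cases:
  obtains "v \<notin> X" "v' \<notin> X"
  | Y where "X = insert v Y" "v \<notin> Y" "v' \<notin> Y"
  | Y where "X = insert v' Y" "v \<notin> Y" "v' \<notin> Y"
  | Y where "X = insert v (insert v' Y)" "v \<notin> Y" "v' \<notin> Y"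
proof -
  consider "v \<notin> X" "v' \<notin> X" | "v \<in> X" "v' \<notin> X" | "v \<notin> X" "v' \<in> X" | "v \<in> X" "v' \<in> X" by blast
  then show ?thesis
  proof cases
    case 2
    then show ?thesis using that(2)[of "X - {v}"] by blast
  next
    case 3
    then show ?thesis using that(3)[of "X - {v'}"] by blast
  next
    case 4
    then show ?thesis using that(4)[of "X - {v,v'}"] by blast
  qed (rule that(1))
qed

lemma finite_complex_D: "finite_simplicial_complex D"
  unfolding finite_simplicial_complex_def
proof (intro conjI ballI allI impI)
  have fU: "finite (insert v' (\<Union>\<Delta>))" using fin by (auto simp: finite_simplicial_complex_def)
  have sub: "X \<subseteq> insert v' (\<Union>\<Delta>)" if "X \<in> D" for X
  proof (cases X rule: simplex_cases)
    case 1
    then show ?thesis using that D_none by blast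
  next
    case (2 Y)
    then show ?thesis using that D_v L_link v by blast
  next
    case (3 Y)
    then show ?thesis using that D_v' L_link by blast
  next
    case (4 Y)
    then show ?thesis using that D_vv' pq_L L_link v by blast
  qed
  then show "finite D" by (intro finite_subset[OF _ finite_Pow_iff[THEN iffD2, OF fU]]) blast
  fix X assume X: "X \<in> D"
  show "finite X" using sub[OF X] fU by (rule finite_subset)
  have "{} \<notin> \<Delta>" using simplex_nonempty[OF fin] by blast
  then show "X \<noteq> {}" using X by (auto simp: D_def)
  fix Y assume Y: "Y \<subseteq> X \<and> Y \<noteq> {}"
  have LD: "Z \<in> D" if "Z \<in> L1 \<union> L2" for Z using L_link[OF that] D_none by blast
  have down: "Y \<in> D" if Z: "Z \<in> insert {} (path_complex ys)" "X = insert w Z" and ys: "path_complex ys \<subseteq> L1 \<union> L2"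
    and w: "\<And>Y'. Y' \<in> insert {} (path_complex ys) \<Longrightarrow> insert w Y' \<in> D" for Z ys w
  proof -
    have "Y - {w} \<subseteq> Z" using Y Z(2) by blast
    then have d: "Y - {w} \<in> insert {} (path_complex ys)"
      using Z(1) path_complex_face[of Z ys "Y - {w}"] by auto
    show ?thesis
    proof (cases "w \<in> Y")
      case True
      then show ?thesis using w[OF d] by (simp add: insert_absorb)
    next
      case False
      then show ?thesis using d Y LD ys by auto
    qed
  qed
  show "Y \<in> D"
  proof (cases X rule: simplex_cases)
    case 1
    then have "Y \<in> \<Delta>" "v \<notin> Y" "v' \<notin> Y" using Y X D_none simplex_face[OF fin] by blast+
    then show ?thesis using D_none by blast
  next
    case (2 Z)
    then have "Z \<in> insert {} L1" using D_v X by blast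
    moreover have "insert v Y' \<in> D" if "Y' \<in> insert {} L1" for Y' using that D_v[of Y'] L_link[of Y'] by blast
    ultimately show ?thesis using down[of Z ys1 v] 2(1) by blast
  next
    case (3 Z)
    then have "Z \<in> insert {} L2" using D_v' X by blast
    moreover have "insert v' Y' \<in> D" if "Y' \<in> insert {} L2" for Y' using that D_v'[of Y'] L_link[of Y'] by blast
    ultimately show ?thesis using down[of Z ys2 v'] 3(1) by blast
  next
    case (4 Z)
    then have "Z \<in> {{},{p},{q}}" using D_vv' X by blast
    moreover have "Y - {v,v'} \<subseteq> Z" using Y 4 by blast
    ultimately have d: "Y - {v,v'} = {} \<or> Y - {v,v'} = {p} \<or> Y - {v,v'} = {q}" by blast
    show ?thesis
    proof (cases Y rule: simplex_cases)
      case 1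
      then have "Y - {v,v'} = Y" by blast
      then have "Y = {p} \<or> Y = {q}" using d Y by argo
      then show ?thesis using LD pq_L by blast
    next
      case (2 Y')
      then have e: "Y - {v,v'} = Y'" by blast
      have "Y' \<in> insert {} L1" using d[unfolded e] pq_L by auto
      then show ?thesis using 2(1) D_v[OF 2(2,3)] by simp
    next
      case (3 Y')
      then have e: "Y - {v,v'} = Y'" by blast
      have "Y' \<in> insert {} L2" using d[unfolded e] pq_L by auto
      then show ?thesis using 3(1) D_v'[OF 3(2,3)] by simp
    next
      case (4 Y')
      then have e: "Y - {v,v'} = Y'" by blast
      have "Y' \<in> {{},{p},{q}}" using d[unfolded e] pq_L by auto
      then show ?thesis using 4(1) D_vv'[OF 4(2,3)] by simp
    qed
  qed
qed

section \<open>Triangles and thinness of the split complex\<close>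

lemma tri_D_none:
  "a \<notin> {v,v'} \<Longrightarrow> b \<notin> {v,v'} \<Longrightarrow> c \<notin> {v,v'} \<Longrightarrow> tri D a b c \<longleftrightarrow> tri \<Delta> a b c"
  using D_none[of "{a,b,c}"] by (auto simp: tri_def)

lemma tri_D_v:
  "a \<noteq> v' \<Longrightarrow> b \<noteq> v' \<Longrightarrow> tri D v a b \<longleftrightarrow> a \<noteq> b \<and> {a,b} \<in> L1"
  using D_v[of "{a,b}"] L_link[of "{a,b}"] by (auto simp: tri_def)

lemma tri_D_v':
  "a \<noteq> v \<Longrightarrow> b \<noteq> v \<Longrightarrow> tri D v' a b \<longleftrightarrow> a \<noteq> b \<and> {a,b} \<in> L2"
  using D_v'[of "{a,b}"] L_link[of "{a,b}"] by (auto simp: tri_def)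

lemma tri_D_vv': "tri D v v' a \<longleftrightarrow> a = p \<or> a = q"
  using D_vv'[of "{a}"] vv' pq_v by (auto simp: tri_def)

lemma tri_L: "a \<noteq> b \<Longrightarrow> {a,b} \<in> L1 \<or> {a,b} \<in> L2 \<Longrightarrow> tri \<Delta> v a b"
  using L_link[of "{a,b}"] by (auto simp: tri_def)

lemma edge_not_both: "a \<noteq> b \<Longrightarrow> {a,b} \<in> L1 \<Longrightarrow> {a,b} \<notin> L2"
proof
  assume ab: "a \<noteq> b" "{a,b} \<in> L1" "{a,b} \<in> L2"
  then have "{a,b} \<in> {{p},{q}}" unfolding inter[symmetric] by blast
  then show False using ab(1) by auto
qed

text \<open>An end lies on both arcs, and each arc takes one of its at most two neighbours in the link.\<close>

lemma arc_end_degree: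
  assumes "z = p \<or> z = q"
  shows "{z,a} \<in> L1 \<Longrightarrow> {z,b} \<in> L1 \<Longrightarrow> a \<noteq> z \<Longrightarrow> b \<noteq> z \<Longrightarrow> a = b"
    and "{z,a} \<in> L2 \<Longrightarrow> {z,b} \<in> L2 \<Longrightarrow> a \<noteq> z \<Longrightarrow> b \<noteq> z \<Longrightarrow> a = b"
proof -
  have z: "z \<in> set ys1" "z \<in> set ys2" using assms pq_L singleton_in_path_complex by metis+
  {
    assume ab: "{z,a} \<in> L1" "{z,b} \<in> L1" "a \<noteq> z" "b \<noteq> z"
    obtain c where c: "c \<noteq> z" "{z,c} \<in> L2" using path_complex_neighbour[OF ys2 z(2)] .
    have "tri \<Delta> v z a" "tri \<Delta> v z b" "tri \<Delta> v z c"
      using tri_L[OF ab(3)[symmetric] disjI1[OF ab(1)]] tri_L[OF ab(4)[symmetric] disjI1[OF ab(2)]]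
        tri_L[OF c(1)[symmetric] disjI2[OF c(2)]] .
    then have "a = b \<or> b = c \<or> a = c" by (rule thin_complex_edge[OF thin])
    then show "a = b" using edge_not_both ab c by metis
  next
    assume ab: "{z,a} \<in> L2" "{z,b} \<in> L2" "a \<noteq> z" "b \<noteq> z"
    obtain c where c: "c \<noteq> z" "{z,c} \<in> L1" using path_complex_neighbour[OF ys1 z(1)] .
    have "tri \<Delta> v z a" "tri \<Delta> v z b" "tri \<Delta> v z c"
      using tri_L[OF ab(3)[symmetric] disjI2[OF ab(1)]] tri_L[OF ab(4)[symmetric] disjI2[OF ab(2)]]
        tri_L[OF c(1)[symmetric] disjI1[OF c(2)]] .
    then have "a = b \<or> b = c \<or> a = c" by (rule thin_complex_edge[OF thin])
    then show "a = b" using edge_not_both ab c by metis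
  }
qed

lemma D_card: "X \<in> D \<Longrightarrow> card X \<le> 3"
proof -
  have ins: "card (insert w Y) \<le> 3" if "Y \<in> insert {} (L1 \<union> L2)" for w Y
  proof (cases "Y = {}")
    case False
    then have t: "Y \<in> L1 \<union> L2" using that by blast
    have fi: "finite Y" using L_link[OF t] simplex_finite[OF fin] by blast
    have "card (insert v Y) \<le> 3" using L_link[OF t] thin_complex_card[OF thin] by blast
    then have "card Y \<le> 2" using L_link[OF t] fi by simp
    then show ?thesis using fi by (simp add: card_insert_if)
  qed simp
  assume X: "X \<in> D"
  show ?thesis
  proof (cases X rule: simplex_cases)
    case 1
    then show ?thesis using X D_none thin_complex_card[OF thin] by blast
  next
    case (2 Y)
    then show ?thesis using X D_v ins by blast
  next
    case (3 Y)
    then show ?thesis using X D_v' ins by blast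
  next
    case (4 Y)
    then have "Y \<in> {{},{p},{q}}" using X D_vv' by blast
    then show ?thesis using 4 vv' pq_v by auto
  qed
qed

lemma D_edge_none:
  assumes "x \<notin> {v,v'}" "y \<notin> {v,v'}" "tri D x y a"
  shows "tri \<Delta> x y (if a = v' then v else a)"
    "a = v \<Longrightarrow> {x,y} \<in> L1" "a = v' \<Longrightarrow> {x,y} \<in> L2" "x \<noteq> y"
proof -
  have d: "tri D a x y" using tri_rotate[OF tri_rotate[OF assms(3)]] .
  show "x \<noteq> y" using assms(3) by (simp add: tri_def)
  show 1: "{x,y} \<in> L1" if "a = v" using d tri_D_v assms that by blast
  show 2: "{x,y} \<in> L2" if "a = v'" using d tri_D_v' assms that by blast
  consider "a = v" | "a = v'" | "a \<notin> {v,v'}" by blast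
  then show "tri \<Delta> x y (if a = v' then v else a)"
  proof cases
    case 3
    then show ?thesis using tri_D_none assms by auto
  qed (use 1 2 tri_L[OF \<open>x \<noteq> y\<close>] tri_rotate vv' in \<open>metis (full_types)\<close>)+
qed

text \<open>An edge avoiding both copies keeps its third vertices under contraction, and the two
  copies cannot both be among them because no edge lies in both arcs. For an edge at one copy the
  third vertices are neighbours in its arc; the other copy joins them only at \<open>p\<close> or
  \<open>q\<close>, where the arc supplies a single neighbour.\<close>

lemma thin_D: "thin_complex D"
proof (rule thin_complexI[OF finite_complex_D D_card])
  fix x y a b c
  assume t: "tri D x y a" "tri D x y b" "tri D x y c"
  have side: "a = b \<or> b = c \<or> a = c"
    if t: "tri D w y a" "tri D w y b" "tri D w y c"
      and w: "w = v \<or> w = v'" for w y a b c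
  proof -
    define w' where "w' = (if w = v then v' else v)"
    define L where "L = (if w = v then L1 else L2)"
    have y: "y \<noteq> w" using t by (auto simp: tri_def)
    have ww: "tri D w w' z \<longleftrightarrow> z = p \<or> z = q" for z
      using w tri_D_vv' tri_swap unfolding w'_def by metis
    show ?thesis
    proof (cases "y = w'")
      case True
      then show ?thesis using ww t by metis
    next
      case False
      have in_L: "z = w' \<or> z \<noteq> y \<and> {y,z} \<in> L" if "tri D w y z" for z
        using that w False tri_D_v[of y z] tri_D_v'[of y z] vv'
        unfolding w'_def L_def by (auto split: if_splits)
      have one: "d = e" if w': "tri D w y w'" and "tri D w y d" "tri D w y e"
        "d \<noteq> w'" "e \<noteq> w'" for d e
      proof -
        have "tri D w w' y" using w' by (auto simp: tri_def insert_commute)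
        then have "y = p \<or> y = q" using ww by blast
        moreover have "d \<noteq> y" "{y,d} \<in> L" "e \<noteq> y" "{y,e} \<in> L" using in_L that by blast+
        ultimately show ?thesis using arc_end_degree[of y d e] unfolding L_def by (simp split: if_splits)
      qed
      show ?thesis
      proof (cases "a = w' \<or> b = w' \<or> c = w'")
        case True
        then show ?thesis using one t by metis
      next
        case False
        have "tri \<Delta> v y z" if "tri D w y z" "z \<noteq> w'" for z
          using in_L[OF that(1)] that(2) tri_L[of y z] unfolding L_def by (auto split: if_splits)
        then show ?thesis using thin_complex_edge[OF thin] t False by metis
      qed
    qed
  qed
  consider "x = v \<or> x = v'" | "y = v \<or> y = v'" | "x \<notin> {v,v'}" "y \<notin> {v,v'}" by blast
  then show "a = b \<or> b = c \<or> a = c"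
  proof cases
    case 1
    then show ?thesis using side t by blast
  next
    case 2
    then show ?thesis
      using side[OF tri_swap[OF t(1)] tri_swap[OF t(2)] tri_swap[OF t(3)]] by blast
  next
    case 3
    define r where "r z = (if z = v' then v else z)" for z
    note e = D_edge_none[OF 3]
    have "tri \<Delta> x y (r a)" "tri \<Delta> x y (r b)" "tri \<Delta> x y (r c)"
      using e(1) t by (simp_all add: r_def)
    then have "r a = r b \<or> r b = r c \<or> r a = r c" by (rule thin_complex_edge[OF thin])
    moreover have "z = u" if "r z = r u" "tri D x y z" "tri D x y u" for z u
    proof (rule ccontr)
      assume "z \<noteq> u"
      then have "z = v \<and> u = v' \<or> z = v' \<and> u = v" using that(1) by (auto simp: r_def split: if_splits)
      then have "{x,y} \<in> L1" "{x,y} \<in> L2"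
        using e(2,3)[OF that(2)] e(2,3)[OF that(3)] by blast+
      then show False using edge_not_both e(4)[OF that(2)] by blast
    qed
    ultimately show ?thesis using t by blast
  qed
qed

end

section \<open>Extensions of a spanning subsurface\<close>

lemma tri_swap_last: "tri K x y z \<Longrightarrow> tri K x z y"
  by (rule tri_rotate[OF tri_swap])

lemma tri_edge:
  assumes "finite_simplicial_complex K" "tri K x y z"
  shows "{x,y} \<in> K" "{x,z} \<in> K"
  using simplex_face[OF assms(1), of "{x,y,z}"] assms(2) by (auto simp: tri_def)

definition meets_triangles :: "'a set set \<Rightarrow> 'a set set \<Rightarrow> bool" where
  "meets_triangles K S \<longleftrightarrow> (\<forall>T\<in>K. card T = 3 \<longrightarrow> (\<exists>e\<in>S. card e = 2 \<and> e \<subseteq> T))"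

locale spanned_split = star_split +
  fixes S :: "'a set set"
  assumes S: "comb_surface S" and sub: "S \<subseteq> \<Delta>" and meets: "meets_triangles \<Delta> S"
    and spanning: "\<Union>\<Delta> \<subseteq> \<Union>S"
begin

lemma fS: "finite_simplicial_complex S"
  using S by (rule comb_surface_complex)

lemma v'_S: "X \<in> S \<Longrightarrow> v' \<notin> X"
  using sub v' by blast

lemma vertex_S: "x \<in> \<Union>\<Delta> \<Longrightarrow> {x} \<in> S"
  using spanning simplex_face[OF fS] by blast

lemma tri_S_L: "tri S v a b \<Longrightarrow> {a,b} \<in> L1 \<or> {a,b} \<in> L2"
proof -
  assume t: "tri S v a b"
  then have "insert v {a,b} \<in> \<Delta>" "v \<notin> {a,b}" using sub by (auto simp: tri_def)
  then show ?thesis using in_L by blast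
qed

section \<open>The preimage of the subsurface under contraction\<close>

definition S1 :: "'a set set" where
  "S1 = {X \<in> D. (\<lambda>x. if x = v' then v else x) ` X \<in> S}"

lemma S1_none: "v \<notin> X \<Longrightarrow> v' \<notin> X \<Longrightarrow> X \<in> S1 \<longleftrightarrow> X \<in> S"
  unfolding S1_def using rename_simplex_notin[of v' X v] D_none[of X] sub by auto

lemma S1_v: "v \<notin> Y \<Longrightarrow> v' \<notin> Y \<Longrightarrow> insert v Y \<in> S1 \<longleftrightarrow> Y \<in> insert {} L1 \<and> insert v Y \<in> S"
  unfolding S1_def using rename_simplex_notin[of v' "insert v Y" v] D_v[of Y] vv' by auto

lemma S1_v': "v \<notin> Y \<Longrightarrow> v' \<notin> Y \<Longrightarrow> insert v' Y \<in> S1 \<longleftrightarrow> Y \<in> insert {} L2 \<and> insert v Y \<in> S"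
proof -
  assume Y: "v \<notin> Y" "v' \<notin> Y"
  show ?thesis unfolding S1_def mem_Collect_eq rename_simplex_insert[OF Y(2)] D_v'[OF Y] by (rule refl)
qed

lemma S1_vv': "v \<notin> Y \<Longrightarrow> v' \<notin> Y \<Longrightarrow>
    insert v (insert v' Y) \<in> S1 \<longleftrightarrow> Y \<in> {{},{p},{q}} \<and> insert v Y \<in> S"
proof -
  assume Y: "v \<notin> Y" "v' \<notin> Y"
  then have "(\<lambda>x. if x = v' then v else x) ` insert v (insert v' Y) = insert v Y"
    using rename_simplex_insert[of v' "insert v Y" v] vv' by (simp add: insert_commute)
  then show ?thesis unfolding S1_def mem_Collect_eq by (simp only: D_vv'[OF Y])
qed

lemma S1_subset: "S1 \<subseteq> D"
  by (auto simp: S1_def)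

lemma finite_complex_S1: "finite_simplicial_complex S1"
  unfolding finite_simplicial_complex_def
proof (intro conjI ballI allI impI)
  show "finite S1" using finite_complex_D unfolding finite_simplicial_complex_def
    by (meson S1_subset finite_subset)
  fix X assume X: "X \<in> S1"
  then show "finite X" "X \<noteq> {}"
    using S1_subset simplex_finite[OF finite_complex_D] simplex_nonempty[OF finite_complex_D] by blast+
  fix Y assume Y: "Y \<subseteq> X \<and> Y \<noteq> {}"
  have XD: "X \<in> D" and XS: "(\<lambda>x. if x = v' then v else x) ` X \<in> S" using X by (auto simp: S1_def)
  have "Y \<in> D" using simplex_face[OF finite_complex_D XD] Y by blast
  moreover have "(\<lambda>x. if x = v' then v else x) ` Y \<in> S"
    using simplex_face[OF fS XS image_mono[OF conjunct1[OF Y]]] Y by blast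
  ultimately show "Y \<in> S1" by (simp add: S1_def)
qed

lemma thin_S1: "thin_complex S1"
  by (rule thin_complex_subcomplex[OF thin_D S1_subset finite_complex_S1])

lemma tri_S1_none:
  "a \<notin> {v,v'} \<Longrightarrow> b \<notin> {v,v'} \<Longrightarrow> c \<notin> {v,v'} \<Longrightarrow> tri S1 a b c \<longleftrightarrow> tri S a b c"
  using S1_none[of "{a,b,c}"] by (auto simp: tri_def)

lemma tri_S1_v: "tri S v a b \<Longrightarrow> {a,b} \<in> L1 \<Longrightarrow> tri S1 v a b"
  using S1_v[of "{a,b}"] L_link[of "{a,b}"] by (auto simp: tri_def)

lemma tri_S1_v': "tri S v a b \<Longrightarrow> {a,b} \<in> L2 \<Longrightarrow> tri S1 v' a b"
  using S1_v'[of "{a,b}"] L_link[of "{a,b}"] by (auto simp: tri_def)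

lemma tri_S1_vv': "z = p \<or> z = q \<Longrightarrow> {v,z} \<in> S \<Longrightarrow> tri S1 v v' z"
  using S1_vv'[of "{z}"] pq_v vv' by (auto simp: tri_def)

lemma edge_S1_v: "{v,a} \<in> S1 \<Longrightarrow> a \<noteq> v \<Longrightarrow> a \<noteq> v' \<Longrightarrow> {a} \<in> L1 \<and> {v,a} \<in> S"
  using S1_v[of "{a}"] by simp

lemma edge_S1_v': "{v',a} \<in> S1 \<Longrightarrow> a \<noteq> v \<Longrightarrow> a \<noteq> v' \<Longrightarrow> {a} \<in> L2 \<and> {v,a} \<in> S"
  using S1_v'[of "{a}"] by simp

text \<open>The preimage always contracts onto \<open>S\<close>: a simplex at \<open>v\<close> has
  its opposite face in one of the arcs and lifts to the copy belonging to that arc. The new edge is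
  present because \<open>v\<close> is a vertex of \<open>S\<close>. Whether the preimage is a
  surface is a separate question.\<close>

lemma extension_by_split_S1: "extension_by_split v v' S S1"
  unfolding extension_by_split_def
proof
  have "{v} \<in> S" using vertex_S v by blast
  then show "{v,v'} \<in> S1" using S1_vv'[of "{}"] by simp
  show "rename_vertex v' v S1 = S"
  proof (intro equalityI subsetI)
    show "Z \<in> S" if "Z \<in> rename_vertex v' v S1" for Z
      using that unfolding rename_vertex_def S1_def by blast
    fix Z assume Z: "Z \<in> S"
    have img: "Z \<in> rename_vertex v' v S1"
      if "Z = (\<lambda>x. if x = v' then v else x) ` X" "X \<in> S1" for X
      unfolding rename_vertex_def using that by (rule image_eqI)
    show "Z \<in> rename_vertex v' v S1"
    proof (cases "v \<in> Z")
      case False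
      then have "Z \<in> S1" using S1_none[OF False v'_S[OF Z]] Z by blast
      then show ?thesis by (rule img[OF rename_simplex_notin[OF v'_S[OF Z], symmetric]])
    next
      case True
      define Y where "Y = Z - {v}"
      have Y: "Z = insert v Y" "v \<notin> Y" "v' \<notin> Y" using True v'_S[OF Z] by (auto simp: Y_def)
      consider "Y \<in> insert {} L1" | "Y \<in> L2"
        using in_L[of Y] Z sub Y by blast
      then show ?thesis
      proof cases
        case 1
        then have "Z \<in> S1" using S1_v[OF Y(2,3)] Z Y(1) by simp
        then show ?thesis by (rule img[OF rename_simplex_notin[OF v'_S[OF Z], symmetric]])
      next
        case 2
        then have "insert v' Y \<in> S1" using S1_v'[OF Y(2,3)] Z Y(1) by simp
        moreover have "Z = (\<lambda>x. if x = v' then v else x) ` insert v' Y"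
          unfolding Y(1) by (rule rename_simplex_insert[OF Y(3), symmetric])
        ultimately show ?thesis by (rule img[rotated])
      qed
    qed
  qed
qed

text \<open>Shared by both kinds of extension. A triangle of \<open>D\<close> at exactly one copy of
  \<open>v\<close> comes from a triangle of \<Delta> at \<open>v\<close>, and the edge of
  \<open>S\<close> found there survives on the same side. The triangles containing the new edge have
  no counterpart in \<Delta> and are left to the second assumption.\<close>

lemma meets_triangles_lift:
  assumes none: "\<And>e. e \<in> S \<Longrightarrow> v \<notin> e \<Longrightarrow> e \<in> S'"
    and vv: "\<And>z. z = p \<or> z = q \<Longrightarrow> \<exists>e\<in>S'. card e = 2 \<and> e \<subseteq> {v,v',z}"
    and side: "\<And>u a. u = v \<and> {a} \<in> L1 \<or> u = v' \<and> {a} \<in> L2 \<Longrightarrow> {v,a} \<in> S \<Longrightarrow> {u,a} \<in> S'"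
  shows "meets_triangles D S'"
  unfolding meets_triangles_def
proof (intro ballI impI)
  fix T assume T: "T \<in> D" "card T = 3"
  have key: "\<exists>e\<in>S'. card e = 2 \<and> e \<subseteq> insert w Y"
    if Y: "v \<notin> Y" "v' \<notin> Y" "card (insert w Y) = 3" "insert w Y \<in> D" and w: "w = v \<or> w = v'" for w Y
  proof -
    have fi: "finite Y" using that(3) by (metis card.infinite finite_insert zero_neq_numeral)
    have c2: "card Y = 2" using that fi by auto
    then have "Y \<noteq> {}" by auto
    then have L: "if w = v then Y \<in> L1 else Y \<in> L2" using w D_v[OF Y(1,2)] D_v'[OF Y(1,2)] Y(4) by auto
    then have "insert v Y \<in> \<Delta>" "card (insert v Y) = 3" using L_link[of Y] c2 fi Y by (auto split: if_splits)
    then obtain e where e: "e \<in> S" "card e = 2" "e \<subseteq> insert v Y" using meets unfolding meets_triangles_def by blast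
    show ?thesis
    proof (cases "v \<in> e")
      case False
      then show ?thesis using none[OF e(1) False] e by blast
    next
      case True
      then obtain a where a: "e = {v,a}" "a \<noteq> v" using e(2) by (metis card_2_iff insert_iff insert_commute singletonD)
      then have aY: "{a} \<subseteq> Y" "a \<noteq> w" using e(3) Y w by auto
      have "if w = v then {a} \<in> L1 else {a} \<in> L2" using L path_complex_face[OF _ aY(1)] by (auto split: if_splits)
      then have "{w,a} \<in> S'" using side[of w a] w e(1) a(1) by (auto split: if_splits)
      then show ?thesis using aY by (intro bexI[of _ "{w,a}"]) auto
    qed
  qed
  show "\<exists>e\<in>S'. card e = 2 \<and> e \<subseteq> T"
  proof (cases T rule: simplex_cases)
    case 1
    then obtain e where e: "e \<in> S" "card e = 2" "e \<subseteq> T"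
      using T D_none meets unfolding meets_triangles_def by blast
    then show ?thesis using 1 none by blast
  next
    case (4 Y)
    then have "Y \<in> {{},{p},{q}}" using D_vv' T(1) by blast
    moreover have "Y \<noteq> {}" using T(2) 4(1) vv' by auto
    ultimately show ?thesis using vv 4(1) by blast
  qed (use key T in blast)+
qed

lemma meets_S1: "meets_triangles D S1"
proof (rule meets_triangles_lift)
  show "e \<in> S1" if "e \<in> S" "v \<notin> e" for e using S1_none[OF that(2) v'_S[OF that(1)]] that(1) by blast
  have "{v,v'} \<in> S1" using extension_by_split_S1 by (simp add: extension_by_split_def)
  then show "\<exists>e\<in>S1. card e = 2 \<and> e \<subseteq> {v,v',z}" for z using vv' by (intro bexI[of _ "{v,v'}"]) auto
  show "{u,a} \<in> S1" if "u = v \<and> {a} \<in> L1 \<or> u = v' \<and> {a} \<in> L2" "{v,a} \<in> S" for u a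
    using that S1_v[of "{a}"] S1_v'[of "{a}"] L_link[of "{a}"] by auto
qed

lemma spanning_S1: "\<Union>D \<subseteq> \<Union>S1"
proof
  fix x assume "x \<in> \<Union>D"
  then have x: "{x} \<in> D" using simplex_face[OF finite_complex_D] by blast
  have vv: "{v,v'} \<in> S1" using extension_by_split_S1 by (simp add: extension_by_split_def)
  show "x \<in> \<Union>S1"
  proof (cases "x = v \<or> x = v'")
    case False
    then have "{x} \<in> \<Delta>" using D_none[of "{x}"] x by auto
    then have "{x} \<in> S" using vertex_S[of x] by blast
    then have "{x} \<in> S1" using S1_none[of "{x}"] False by blast
    then show ?thesis by blast
  qed (use vv in blast)
qed

text \<open>Contraction maps the link of \<open>u\<close> in \<open>S1\<close> to its link in
  \<open>S\<close>, where a crossing edge exists, and this edge lifts back. The only danger is a cut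
  that separates the two copies of \<open>v\<close>; but if both are adjacent to \<open>u\<close>,
  then \<open>u\<close> is \<open>p\<close> or \<open>q\<close>, and the triangle on
  \<open>u\<close>, \<open>v\<close>, \<open>v'\<close> crosses that cut.\<close>

lemma link_crossing_other:
  assumes u: "u \<noteq> v" "u \<noteq> v'"
    and a: "{u,a} \<in> S1" "a \<noteq> u" "a \<in> A" and b: "{u,b} \<in> S1" "b \<noteq> u" "b \<notin> A"
  shows "\<exists>x y. x \<in> A \<and> y \<notin> A \<and> tri S1 u x y"
proof (rule ccontr)
  assume no: "\<not> ?thesis"
  define r where "r c = (if c = v' then v else c)" for c
  \<comment> \<open>The image of \<open>A\<close> under the contraction: \<open>v\<close> is
    included when a copy of \<open>v\<close> adjacent to \<open>u\<close> belongs to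
    \<open>A\<close>.\<close>
  define A0 where "A0 = {x. x \<in> A \<and> x \<noteq> v \<and> x \<noteq> v' \<or> x = v \<and> (v \<in> A \<and> {u,v} \<in> S1 \<or> v' \<in> A \<and> {u,v'} \<in> S1)}"
  have uv: "{u} \<in> L1 \<and> {v,u} \<in> S" if "{u,v} \<in> S1" using edge_S1_v[of u] that u by (simp add: insert_commute)
  have uv': "{u} \<in> L2 \<and> {v,u} \<in> S" if "{u,v'} \<in> S1" using edge_S1_v'[of u] that u by (simp add: insert_commute)
  have key: "tri S1 u v v' \<and> tri S1 u v' v" if "{u,v} \<in> S1" "{u,v'} \<in> S1"
  proof -
    have "{u} \<in> {{p},{q}}" using uv uv' that unfolding inter[symmetric] by blast
    then have "tri S1 v v' u" using tri_S1_vv' uv that by blast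
    then show ?thesis using tri_rotate tri_swap_last by metis
  qed
  have claim: "{u, r c} \<in> S \<and> r c \<noteq> u \<and> (r c \<in> A0 \<longleftrightarrow> c \<in> A)" if c: "{u,c} \<in> S1" "c \<noteq> u" for c
  proof -
    consider "c = v" | "c = v'" | "c \<noteq> v" "c \<noteq> v'" by blast
    then show ?thesis
    proof cases
      case 1
      have "v \<in> A0 \<longleftrightarrow> v \<in> A" using key no c 1 unfolding A0_def by blast
      then show ?thesis using 1 c uv vv' by (simp add: r_def insert_commute)
    next
      case 2
      have "v \<in> A0 \<longleftrightarrow> v' \<in> A" using key no c 2 unfolding A0_def by blast
      then show ?thesis using 2 c uv' u by (simp add: r_def insert_commute)
    next
      case 3
      then have "{u,c} \<in> S" using S1_none[of "{u,c}"] c u by auto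
      then show ?thesis using 3 c by (simp add: r_def A0_def)
    qed
  qed
  have "\<exists>x y. x \<in> A0 \<and> y \<notin> A0 \<and> tri S u x y"
    using claim[OF a(1,2)] claim[OF b(1,2)] a(3) b(3)
    by (intro comb_surface_link_crossing[OF S, of u "r a" _ "r b"]) auto
  then obtain x y where xy: "x \<in> A0" "y \<notin> A0" "tri S u x y" by blast
  have tv: "\<exists>w. r w = v \<and> tri S1 w u c" if "tri S v u c" for c
    using tri_S_L[OF that] tri_S1_v[OF that] tri_S1_v'[OF that]
    by (metis r_def)
  have v'n: "x \<noteq> v'" "y \<noteq> v'" using v'_S[of "{u,x,y}"] xy(3) by (auto simp: tri_def)
  have "\<exists>x' y'. r x' = x \<and> r y' = y \<and> tri S1 u x' y'"
  proof -
    consider "x = v" | "y = v" | "x \<noteq> v" "y \<noteq> v" by blast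
    then show ?thesis
    proof cases
      case 1
      then have "tri S v u y" using tri_swap xy(3) by metis
      then obtain w where "r w = v" "tri S1 w u y" using tv by blast
      moreover have "r y = y" using v'n by (simp add: r_def)
      ultimately show ?thesis using 1 tri_swap by metis
    next
      case 2
      then have "tri S v u x" using tri_swap tri_swap_last xy(3) by metis
      then obtain w where w: "r w = v" "tri S1 w u x" using tv by blast
      have "r x = x" using v'n by (simp add: r_def)
      then show ?thesis using w 2 tri_rotate[OF w(2)] by blast
    next
      case 3
      then have "tri S1 u x y" using tri_S1_none[of u x y] u v'n xy(3) by simp
      then show ?thesis using v'n by (intro exI[of _ x] exI[of _ y]) (simp add: r_def)
    qed
  qed
  then obtain x' y' where t: "r x' = x" "r y' = y" "tri S1 u x' y'" by blast
  have "{u,x'} \<in> S1" "{u,y'} \<in> S1" using tri_edge[OF finite_complex_S1 t(3)] .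
  moreover have "x' \<noteq> u" "y' \<noteq> u" using t(3) by (auto simp: tri_def)
  ultimately have "x' \<in> A" "y' \<notin> A" using claim t xy by blast+
  then show False using no t(3) by blast
qed

text \<open>The edge from \<open>v\<close> to \<open>z\<close> provides a triangle at the new edge,
  and it also holds the links of the copies together. The part of the link of \<open>v\<close> in
  \<open>S\<close> over one arc may fall into several pieces, but as the whole link is connected and
  contains \<open>z\<close>, each piece reaches an end of the arc, where the other copy is
  attached.\<close>

lemma comb_surface_S1:
  assumes z: "z = p \<or> z = q" "{v,z} \<in> S"
  shows "comb_surface S1"
proof (rule comb_surfaceI[OF thin_S1])
  have big: "\<exists>T\<in>S1. {v,v',z'} \<subseteq> T \<and> card T = 3" if "z' = p \<or> z' = q" "{v,z'} \<in> S" for z'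
    using tri_S1_vv'[OF that] by (intro bexI[of _ "{v,v',z'}"]) (auto simp: tri_def)
  fix X assume X: "X \<in> S1"
  \<comment> \<open>A triangle of \<open>S\<close> over the given face may belong to the wrong arc.
    Then \<open>Y\<close> is empty or an end of the arcs, and a triangle at the new edge serves
    instead.\<close>
  have up: "\<exists>T\<in>S1. insert w Y \<subseteq> T \<and> card T = 3"
    if Y: "insert v Y \<in> S" "v \<notin> Y" and w: "w = v \<and> Y \<in> insert {} L1 \<or> w = v' \<and> Y \<in> insert {} L2"
    for w Y
  proof -
    obtain T where T: "T \<in> S" "insert v Y \<subseteq> T" "card T = 3"
      using comb_surface_pure[OF S Y(1)] by blast
    define Y' where "Y' = T - {v}"
    have Y': "T = insert v Y'" "v \<notin> Y'" "v' \<notin> Y'" "Y \<subseteq> Y'"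
      using T Y(2) v'_S[OF T(1)] by (auto simp: Y'_def)
    have "finite T" using T(3) by (metis card.infinite zero_neq_numeral)
    then have c: "card Y' = 2" "finite Y'" using T(3) Y' by auto
    then have "Y' \<noteq> {}" by auto
    then have L: "Y' \<in> L1 \<or> Y' \<in> L2" using in_L[of Y'] T(1) Y' sub by blast
    have lift: "insert w Y \<subseteq> insert w Y'" using Y'(4) by blast
    have cw: "card (insert w Y') = 3" using c w Y'(2,3) by auto
    consider "w = v" "Y' \<in> L1" | "w = v'" "Y' \<in> L2"
      | "Y = {}" | "Y \<in> L1" "Y \<in> L2"
    proof -
      have "Y \<in> L1" if "Y' \<in> L1" "Y \<noteq> {}" using path_complex_face[OF that(1) Y'(4) that(2)] .
      moreover have "Y \<in> L2" if "Y' \<in> L2" "Y \<noteq> {}" using path_complex_face[OF that(1) Y'(4) that(2)] .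
      ultimately show ?thesis using that L w by blast
    qed
    then show ?thesis
    proof cases
      case 1
      then have "insert w Y' \<in> S1" using S1_v[OF Y'(2,3)] T(1) Y'(1) by simp
      then show ?thesis using lift cw by blast
    next
      case 2
      then have "insert w Y' \<in> S1" using S1_v'[OF Y'(2,3)] T(1) Y'(1) by simp
      then show ?thesis using lift cw by blast
    next
      case 3
      then show ?thesis using big[OF z] w by blast
    next
      case 4
      then have "Y \<in> {{p},{q}}" unfolding inter[symmetric] by blast
      then obtain z' where z': "z' = p \<or> z' = q" "Y = {z'}" by blast
      then show ?thesis using big[of z'] Y(1) w by blast
    qed
  qed
  show "\<exists>T\<in>S1. X \<subseteq> T \<and> card T = 3"
  proof (cases X rule: simplex_cases)
    case 1
    then have "X \<in> S" using S1_none X by blast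
    then obtain T where T: "T \<in> S" "X \<subseteq> T" "card T = 3"
      using comb_surface_pure[OF S] by blast
    show ?thesis
    proof (cases "v \<in> T")
      case False
      then show ?thesis using S1_none[OF False v'_S[OF T(1)]] T by blast
    next
      case True
      define Y where "Y = T - {v}"
      have Y: "T = insert v Y" "v \<notin> Y" "X \<subseteq> Y" using True T 1 by (auto simp: Y_def)
      have "X \<noteq> {}" using simplex_nonempty[OF fS \<open>X \<in> S\<close>] .
      then have "Y \<in> L1 \<or> Y \<in> L2" using in_L[of Y] T(1) Y sub by blast
      then show ?thesis using up[of Y v] up[of Y v'] T(1) Y by blast
    qed
  next
    case (2 Y)
    then have "insert v Y \<in> S" "Y \<in> insert {} L1" using S1_v[OF 2(2,3)] X by blast+
    then show ?thesis using up[of Y v] 2 by blast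
  next
    case (3 Y)
    then have "insert v Y \<in> S" "Y \<in> insert {} L2" using S1_v'[OF 3(2,3)] X by blast+
    then show ?thesis using up[of Y v'] 3 by blast
  next
    case (4 Y)
    then have Y: "Y \<in> {{},{p},{q}}" "insert v Y \<in> S" using S1_vv'[OF 4(2,3)] X by blast+
    show ?thesis
    proof (cases "Y = {}")
      case True
      then show ?thesis using big[OF z] 4(1) by blast
    next
      case False
      then obtain z' where z': "z' = p \<or> z' = q" "Y = {z'}" using Y by blast
      then show ?thesis using big[of z'] Y(2) 4(1) by blast
    qed
  qed
next
  have side: "\<exists>x y. x \<in> A \<and> y \<notin> A \<and> tri S1 w x y"
    if T1: "\<And>a b. tri S v a b \<Longrightarrow> {a,b} \<in> L \<Longrightarrow> tri S1 w a b"
    and T2: "\<And>z. z = p \<or> z = q \<Longrightarrow> {v,z} \<in> S \<Longrightarrow> tri S1 w z w'"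
    and E: "\<And>a. {w,a} \<in> S1 \<Longrightarrow> a \<noteq> w \<Longrightarrow> a = w' \<or> {a} \<in> L \<and> {v,a} \<in> S \<and> a \<noteq> v"
    and Lp: "\<And>x y. {x} \<in> L \<Longrightarrow> x \<noteq> p \<Longrightarrow> x \<noteq> q \<Longrightarrow> tri S v x y \<Longrightarrow> {x,y} \<in> L"
    and Lf: "\<And>x y. {x,y} \<in> L \<Longrightarrow> {y} \<in> L"
    and a: "{w,a} \<in> S1" "a \<noteq> w" "a \<in> A" and b: "{w,b} \<in> S1" "b \<noteq> w" "b \<notin> A" for w w' L A a b
  proof -
    \<comment> \<open>If \<open>B\<close> contains an end joined to \<open>v\<close> in
      \<open>S\<close>, the triangle at the new edge leads from it to \<open>w'\<close>. Otherwise
      connectedness of the link in \<open>S\<close> gives an edge out of \<open>A1\<close> on the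
      way to \<open>z\<close>; it starts at an inner vertex of the arc and so stays in that
      arc.\<close>
    have half: "\<exists>x y. x \<in> B \<and> y \<notin> B \<and> tri S1 w x y"
      if c: "{w,c} \<in> S1" "c \<noteq> w" "c \<in> B" "w' \<notin> B" for B c
    proof -
      define A1 where "A1 = {x \<in> B. {x} \<in> L \<and> {v,x} \<in> S}"
      have "c \<noteq> w'" using c by blast
      then have cA: "c \<in> A1" "c \<noteq> v" "{v,c} \<in> S" using E[OF c(1,2)] c(3) by (auto simp: A1_def)
      show ?thesis
      proof (cases "\<exists>z\<in>A1. z = p \<or> z = q")
        case True
        then show ?thesis using T2 c(4) unfolding A1_def by blast
      next
        case False
        have "z \<notin> A1" "z \<noteq> v" using False z pq_v by blast+
        then obtain x y where xy: "x \<in> A1" "y \<notin> A1" "tri S v x y"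
          using comb_surface_link_crossing[OF S cA(3,2,1) z(2)] by blast
        have L: "{x,y} \<in> L" using Lp xy False by (auto simp: A1_def)
        have "{v,y} \<in> S" using tri_edge[OF fS xy(3)] by blast
        then have "y \<notin> B" using xy(2) Lf[OF L] by (auto simp: A1_def)
        then show ?thesis using T1[OF xy(3) L] xy(1) by (auto simp: A1_def)
      qed
    qed
    show ?thesis
    proof (cases "w' \<in> A")
      case False
      then show ?thesis using half a by blast
    next
      \<comment> \<open>The cut condition is symmetric in \<open>A\<close> and its complement, and
        here the complement avoids \<open>w'\<close>.\<close>
      case True
      then obtain x y where "x \<in> - A" "y \<notin> - A" "tri S1 w x y" using half[of b "- A"] b by blast
      then show ?thesis using tri_swap_last[of S1 w x y] by blast
    qed
  qed
  have only: "{x,y} \<in> L" if "{x} \<in> L" "x \<noteq> p" "x \<noteq> q" "tri S v x y" "L = L1 \<or> L = L2" for x y L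
  proof -
    have "{x,y} \<in> L1 \<or> {x,y} \<in> L2" using tri_S_L[OF that(4)] .
    moreover have "{x} \<in> L1" if "{x,y} \<in> L1" using path_complex_face[OF that, of "{x}"] by simp
    moreover have "{x} \<in> L2" if "{x,y} \<in> L2" using path_complex_face[OF that, of "{x}"] by simp
    moreover have "{x} \<notin> L1 \<or> {x} \<notin> L2"
    proof (rule ccontr)
      assume "\<not> ?thesis"
      then have "{x} \<in> {{p},{q}}" unfolding inter[symmetric] by blast
      then show False using that by blast
    qed
    ultimately show ?thesis using that(1,5) by blast
  qed
  have vtx: "{y} \<in> path_complex ys" if "{x,y} \<in> path_complex ys" for x y and ys :: "'a list"
    using path_complex_face[OF that, of "{y}"] by simp
  fix u A a b
  assume a: "{u,a} \<in> S1" "a \<noteq> u" "a \<in> A" and b: "{u,b} \<in> S1" "b \<noteq> u" "b \<notin> A"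
  consider "u = v" | "u = v'" | "u \<noteq> v" "u \<noteq> v'" by blast
  then show "\<exists>x y. x \<in> A \<and> y \<notin> A \<and> tri S1 u x y"
  proof cases
    case 1
    show ?thesis
    proof (rule side[of L1 u v', OF _ _ _ _ _ a b])
      show "tri S1 u a b" if "tri S v a b" "{a,b} \<in> L1" for a b
        unfolding 1 by (rule tri_S1_v[OF that])
      show "tri S1 u z v'" if "z = p \<or> z = q" "{v,z} \<in> S" for z
        unfolding 1 by (rule tri_swap_last[OF tri_S1_vv'[OF that]])
      show "a = v' \<or> {a} \<in> L1 \<and> {v,a} \<in> S \<and> a \<noteq> v" if "{u,a} \<in> S1" "a \<noteq> u" for a
        using edge_S1_v that 1 by blast
      show "{x,y} \<in> L1" if "{x} \<in> L1" "x \<noteq> p" "x \<noteq> q" "tri S v x y" for x y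
        using only[OF that] by blast
    qed (rule vtx)
  next
    case 2
    show ?thesis
    proof (rule side[of L2 u v, OF _ _ _ _ _ a b])
      show "tri S1 u a b" if "tri S v a b" "{a,b} \<in> L2" for a b
        unfolding 2 by (rule tri_S1_v'[OF that])
      show "tri S1 u z v" if "z = p \<or> z = q" "{v,z} \<in> S" for z
        unfolding 2 by (rule tri_rotate[OF tri_S1_vv'[OF that]])
      show "a = v \<or> {a} \<in> L2 \<and> {v,a} \<in> S \<and> a \<noteq> v" if "{u,a} \<in> S1" "a \<noteq> u" for a
        using edge_S1_v' that 2 by blast
      show "{x,y} \<in> L2" if "{x} \<in> L2" "x \<noteq> p" "x \<noteq> q" "tri S v x y" for x y
        using only[OF that] by blast
    qed (rule vtx)
  next
    case 3
    then show ?thesis using link_crossing_other a b by blast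
  qed
qed

end

section \<open>The cone extension and the choice between the two extensions\<close>

context spanned_split
begin

text \<open>The two symmetric cases are treated at once. \<open>yo\<close> is the arc containing all
  neighbours of \<open>v\<close> in \<open>S\<close>; the copy \<open>w\<close> over this arc takes
  over the role of \<open>v\<close>, and the other copy \<open>w'\<close> becomes the apex of the
  cone over \<open>ys\<close>. If \<open>w\<close> is \<open>v'\<close>, then \<open>S\<close> has
  to be relabelled first.\<close>

lemma cone_extension:
  assumes w: "w = v \<and> w' = v' \<and> ys = ys2 \<and> yo = ys1 \<or> w = v' \<and> w' = v \<and> ys = ys1 \<and> yo = ys2"
    and W: "\<And>x. {v,x} \<in> S \<Longrightarrow> x \<noteq> v \<Longrightarrow> x \<in> set yo" and N: "{v,p} \<notin> S" "{v,q} \<notin> S"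
  defines "S2 \<equiv> rename_vertex v w S \<union> cone_over w' (path_complex ys)"
  shows "extension_by_cone v v' S S2" "comb_surface S2" "S2 \<subseteq> D" "\<Union>D \<subseteq> \<Union>S2"
    "meets_triangles D S2"
proof -
  define S' where "S' = rename_vertex v w S"
  have ww: "w \<noteq> w'" "{w,w'} = {v,v'}" using w vv' by auto
  have ys: "distinct ys" "2 \<le> length ys" using w ys1 ys2 by auto
  have Dw: "insert w Y \<in> D \<longleftrightarrow> Y \<in> insert {} (path_complex yo)" if "v \<notin> Y" "v' \<notin> Y" for Y
    using w D_v[OF that] D_v'[OF that] by blast
  have Dw': "insert w' Y \<in> D \<longleftrightarrow> Y \<in> insert {} (path_complex ys)" if "v \<notin> Y" "v' \<notin> Y" for Y
    using w D_v[OF that] D_v'[OF that] by blast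
  have Lyo: "Y \<in> L1 \<union> L2" if "Y \<in> path_complex yo \<or> Y \<in> path_complex ys" for Y using w that by blast
  have both: "Y \<in> {{p},{q}}" if "Y \<in> path_complex yo" "Y \<in> path_complex ys" for Y
    unfolding inter[symmetric] using w that by blast
  have no: False if "{v,x} \<in> S" "x \<noteq> v" "x \<in> set ys" for x
  proof -
    have "{x} \<in> {{p},{q}}" using W[OF that(1,2)] that(3) by (intro both) (simp_all add: singleton_in_path_complex)
    then show False using N that(1) by auto
  qed
  have in1: "X \<in> S'" if "X \<in> S" "v \<notin> X" for X
    unfolding S'_def rename_vertex_def
    using rename_simplex_notin[OF that(2), of w, symmetric] that(1) by (rule image_eqI)
  have in2: "insert w Y \<in> S'" if "insert v Y \<in> S" "v \<notin> Y" for Y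
    unfolding S'_def rename_vertex_def
    using rename_simplex_insert[OF that(2), of w, symmetric] that(1) by (rule image_eqI)
  have out: "X \<in> S \<and> v \<notin> X \<and> v' \<notin> X \<or> (\<exists>Y. X = insert w Y \<and> insert v Y \<in> S \<and> v \<notin> Y \<and> v' \<notin> Y)"
    if X: "X \<in> S'" for X
  proof -
    obtain Z where Z: "Z \<in> S" "X = (\<lambda>x. if x = v then w else x) ` Z"
      using X unfolding S'_def rename_vertex_def by blast
    show ?thesis
    proof (cases "v \<in> Z")
      case False
      then show ?thesis using Z v'_S[OF Z(1)] rename_simplex_notin[OF False, of w] by metis
    next
      case True
      define Y where "Y = Z - {v}"
      have Y: "Z = insert v Y" "v \<notin> Y" "v' \<notin> Y" using True v'_S[OF Z(1)] by (auto simp: Y_def)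
      have "X = insert w Y" unfolding Z(2) Y(1) by (rule rename_simplex_insert[OF Y(2)])
      then show ?thesis using Z(1) Y by blast
    qed
  qed
  have S': "comb_surface S'"
  proof (cases "w = v")
    case True
    then show ?thesis using S by (simp add: S'_def rename_vertex_def)
  next
    case False
    then have "w \<notin> \<Union>S" using w v'_S by blast
    then show ?thesis unfolding S'_def by (rule comb_surface_rename[OF S])
  qed
  note fS' = comb_surface_complex[OF S']
  have subD: "S' \<subseteq> D"
  proof
    fix X assume "X \<in> S'"
    from out[OF this] show "X \<in> D"
    proof
      assume "X \<in> S \<and> v \<notin> X \<and> v' \<notin> X"
      then show ?thesis using D_none sub by blast
    next
      assume "\<exists>Y. X = insert w Y \<and> insert v Y \<in> S \<and> v \<notin> Y \<and> v' \<notin> Y"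
      then obtain Y where Y: "X = insert w Y" "insert v Y \<in> S" "v \<notin> Y" "v' \<notin> Y" by blast
      have "Y \<in> path_complex yo" if ne: "Y \<noteq> {}"
      proof -
        have "Y \<in> L1 \<or> Y \<in> L2" using in_L[of Y] Y sub ne by blast
        moreover have "Y \<notin> path_complex ys"
        proof
          assume "Y \<in> path_complex ys"
          then have "Y \<subseteq> set ys" by (rule path_complex_subset)
          moreover obtain x where x: "x \<in> Y" using ne by blast
          moreover have "{v,x} \<in> S" using simplex_face[OF fS Y(2), of "{v,x}"] x by blast
          moreover have "x \<noteq> v" using x Y(3) by blast
          ultimately show False using no by blast
        qed
        ultimately show ?thesis using w by blast
      qed
      then show ?thesis using Dw[OF Y(3,4)] Y(1) by blast
    qed
  qed
  \<comment> \<open>A triangle of \<Delta> formed by \<open>v\<close> and an edge of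
    \<open>ys\<close> has an edge in \<open>S\<close>; both edges at \<open>v\<close> are excluded
    by \<open>no\<close>, so the edge of \<open>ys\<close> itself lies in \<open>S\<close>.\<close>
  have pS': "path_complex ys \<subseteq> S'"
  proof
    fix X assume X: "X \<in> path_complex ys"
    obtain i where i: "Suc i < length ys" "X \<subseteq> {ys ! i, ys ! Suc i}" using path_complex_in_edge[OF X ys(2)] .
    define a b where "a = ys ! i" and "b = ys ! Suc i"
    have ab: "a \<noteq> b" "{a,b} \<in> path_complex ys" "a \<in> set ys" "b \<in> set ys"
      using i(1) ys by (auto simp: a_def b_def path_complex_def nth_eq_iff_index_eq)
    note L = L_link[OF Lyo[OF disjI2[OF ab(2)]]]
    have "insert v {a,b} \<in> \<Delta>" "card (insert v {a,b}) = 3" using L ab(1) by auto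
    then obtain e where e: "e \<in> S" "card e = 2" "e \<subseteq> insert v {a,b}"
      using meets unfolding meets_triangles_def by blast
    have "v \<notin> e"
    proof
      assume ve: "v \<in> e"
      have "e \<noteq> {v}" using e(2) by auto
      then obtain x where x: "x \<in> e" "x \<noteq> v" using ve by blast
      then have "{v,x} \<in> S" using simplex_face[OF fS e(1), of "{v,x}"] ve by blast
      moreover have "x \<in> set ys" using x e(3) ab by blast
      ultimately show False using no x(2) by blast
    qed
    then have "e \<subseteq> {a,b}" using e(3) by blast
    then have "e = {a,b}" using e(2) ab(1) by (intro card_subset_eq) auto
    then have "{a,b} \<in> S'" using in1 e(1) \<open>v \<notin> e\<close> by blast
    then show "X \<in> S'"
      using simplex_face[OF fS'] i(2) path_complex_nonempty[OF X] unfolding a_def b_def by blast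
  qed
  have w'S': "w' \<notin> \<Union>S'"
  proof
    assume "w' \<in> \<Union>S'"
    then obtain X where X: "X \<in> S'" "w' \<in> X" by blast
    have "w' = v \<or> w' = v'" using w by blast
    then show False using out[OF X(1)] X(2) ww(1) by blast
  qed
  have "cone_over w' (path_complex ys) \<subseteq> D"
  proof
    fix X assume "X \<in> cone_over w' (path_complex ys)"
    then consider "X \<in> path_complex ys" | Y where "X = insert w' Y" "Y \<in> path_complex ys" | "X = insert w' {}"
      unfolding cone_over_def by blast
    then show "X \<in> D"
    proof cases
      case 1
      then show ?thesis using pS' subD by blast
    next
      case 2
      note L = L_link[OF Lyo[OF disjI2[OF 2(2)]]]
      then show ?thesis using Dw'[of Y] 2 by blast
    next
      case 3
      then show ?thesis using Dw'[of "{}"] by simp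
    qed
  qed
  then have sD: "S' \<union> cone_over w' (path_complex ys) \<subseteq> D" using subD by blast
  note cone = cone_over_path_surface[OF S' thin_D sD ys pS' w'S']
  show "comb_surface S2" using cone(1) unfolding S2_def S'_def .
  show "S2 \<subseteq> D" using sD unfolding S2_def S'_def .
  show "extension_by_cone v v' S S2"
    unfolding extension_by_cone_def
  proof (intro exI conjI)
    show "(w, w') \<in> {(v, v'), (v', v)}" using w by blast
    show "realization (path_complex ys) \<subseteq> surface_boundary (realization_space (rename_vertex v w S))"
      using cone(2) unfolding S'_def .
  qed (use ys S2_def in auto)
  have S2: "X \<in> S2" if "X \<in> S'" for X using that by (simp add: S2_def S'_def)
  have S2': "insert w' Y \<in> S2" if "Y \<in> path_complex ys" for Y using that by (simp add: S2_def cone_over_def)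
  have w'2: "{w'} \<in> S2" by (simp add: S2_def cone_over_def)
  show "\<Union>D \<subseteq> \<Union>S2"
  proof
    fix x assume "x \<in> \<Union>D"
    then have x: "{x} \<in> D" using simplex_face[OF finite_complex_D] by blast
    have "insert v {} \<in> S" using vertex_S v by blast
    then have w2: "insert w {} \<in> S2" using in2[of "{}"] S2 by blast
    show "x \<in> \<Union>S2"
    proof (cases "x = v \<or> x = v'")
      case False
      then have "{x} \<in> \<Delta>" using D_none[of "{x}"] x by blast
      then have "{x} \<in> S" using vertex_S[of x] by blast
      then have "{x} \<in> S2" using in1[of "{x}"] S2 False by blast
      then show ?thesis by blast
    next
      case True
      then have "x = w \<or> x = w'" using ww(2) by blast
      then show ?thesis using w2 w'2 by blast
    qed
  qed
  show "meets_triangles D S2"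
  proof (rule meets_triangles_lift)
    show "e \<in> S2" if "e \<in> S" "v \<notin> e" for e by (rule S2[OF in1[OF that]])
    show "\<exists>e\<in>S2. card e = 2 \<and> e \<subseteq> {v,v',z}" if "z = p \<or> z = q" for z
    proof -
      have "{w',z} \<in> S2" using S2'[of "{z}"] that w pq_L by blast
      moreover have "w' \<noteq> z" using that w pq_v by blast
      ultimately show ?thesis using ww(2) by (intro bexI[of _ "{w',z}"]) auto
    qed
    show "{u,a} \<in> S2" if "u = v \<and> {a} \<in> L1 \<or> u = v' \<and> {a} \<in> L2" "{v,a} \<in> S" for u a
    proof -
      have "v \<noteq> a" using that(1) L_link[of "{a}"] by blast
      then have "{w,a} \<in> S2" using S2[OF in2[of "{a}"]] that(2) by simp
      moreover have "{a} \<in> path_complex ys \<Longrightarrow> {w',a} \<in> S2" by (rule S2')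
      ultimately show ?thesis using that(1) w by blast
    qed
  qed
qed

lemma good_extension:
  obtains S' where "extension_by_split v v' S S' \<or> extension_by_cone v v' S S'"
    "comb_surface S'" "S' \<subseteq> D" "\<Union>D \<subseteq> \<Union>S'" "meets_triangles D S'"
proof (cases "{v,p} \<in> S \<or> {v,q} \<in> S")
  case True
  then have "comb_surface S1" using comb_surface_S1 by blast
  then show ?thesis
    using that extension_by_split_S1 S1_subset spanning_S1 meets_S1 by blast
next
  case False
  then have N: "{v,p} \<notin> S" "{v,q} \<notin> S" by blast+
  \<comment> \<open>If neither arc contained all neighbours of \<open>v\<close> in \<open>S\<close>,
    some link edge in \<open>S\<close> would leave \<open>ys1\<close>. It would belong to the arc
    \<open>ys2\<close> and start at a vertex of both arcs, which is \<open>p\<close> or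
    \<open>q\<close>.\<close>
  have "(\<forall>x. {v,x} \<in> S \<and> x \<noteq> v \<longrightarrow> x \<in> set ys1) \<or> (\<forall>x. {v,x} \<in> S \<and> x \<noteq> v \<longrightarrow> x \<in> set ys2)"
  proof (rule ccontr)
    assume "\<not> ?thesis"
    then obtain x0 y0 where x0: "{v,x0} \<in> S" "x0 \<noteq> v" "x0 \<notin> set ys2" and y0: "{v,y0} \<in> S" "y0 \<noteq> v" "y0 \<notin> set ys1"
      by blast
    have "insert v {x0} \<in> \<Delta>" using x0 sub by blast
    then have "{x0} \<in> L1 \<or> {x0} \<in> L2" using in_L[of "{x0}"] x0(2) by blast
    then have x1: "x0 \<in> set ys1" using x0(3) by (simp add: singleton_in_path_complex)
    obtain x y where xy: "x \<in> set ys1" "y \<notin> set ys1" "tri S v x y"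
      using comb_surface_link_crossing[OF S x0(1,2) x1 y0] by blast
    have "{x,y} \<notin> L1"
    proof
      assume "{x,y} \<in> L1"
      from path_complex_subset[OF this] show False using xy(2) by blast
    qed
    then have "{x,y} \<in> L2" using tri_S_L[OF xy(3)] by blast
    from path_complex_subset[OF this] have "x \<in> set ys2" by blast
    then have "{x} \<in> L1 \<inter> L2" using xy(1) by (simp add: singleton_in_path_complex)
    then have "x = p \<or> x = q" unfolding inter by blast
    moreover have "{v,x} \<in> S" using tri_edge[OF fS xy(3)] by blast
    ultimately show False using N by blast
  qed
  then show ?thesis
  proof
    assume W: "\<forall>x. {v,x} \<in> S \<and> x \<noteq> v \<longrightarrow> x \<in> set ys1"
    have "v = v \<and> v' = v' \<and> ys2 = ys2 \<and> ys1 = ys1 \<or> v = v' \<and> v' = v \<and> ys2 = ys1 \<and> ys1 = ys2" by blast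
    note c = cone_extension[OF this _ N]
    show ?thesis by (rule that[OF disjI2[OF c(1)] c(2-5)]) (use W in blast)+
  next
    assume W: "\<forall>x. {v,x} \<in> S \<and> x \<noteq> v \<longrightarrow> x \<in> set ys2"
    have "v' = v \<and> v = v' \<and> ys1 = ys2 \<and> ys2 = ys1 \<or> v' = v' \<and> v = v \<and> ys1 = ys1 \<and> ys2 = ys2" by blast
    note c = cone_extension[OF this _ N]
    show ?thesis by (rule that[OF disjI2[OF c(1)] c(2-5)]) (use W in blast)+
  qed
qed

end

section \<open>Reduction to vertex splits and conclusion\<close>

lemma cycle_complex_rotate: "cycle_complex (as @ bs) = cycle_complex (bs @ as)"
proof (cases "as = [] \<or> bs = []")
  case False
  then obtain a as' b bs' where ab: "as = a # as'" "bs = b # bs'" by (metis neq_Nil_conv)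
  have "cycle_complex (as @ bs) = path_complex (as @ b # (bs' @ [a]))"
    using False by (subst cycle_complex_closed_path) (simp_all add: ab)
  also have "\<dots> = path_complex (as @ [b]) \<union> path_complex (bs @ [a])"
    by (subst path_complex_append) (simp add: ab)
  also have "\<dots> = path_complex (bs @ a # (as' @ [b]))"
    by (subst (3) path_complex_append) (auto simp: ab)
  also have "\<dots> = cycle_complex (bs @ as)"
    using False by (subst cycle_complex_closed_path) (simp_all add: ab)
  finally show ?thesis .
qed auto

text \<open>Choosing the rotation whose closing edge is \<open>{b,c}\<close> lets the largest index
  in a vertex split cut off exactly this edge as the second arc.\<close>

lemma cycle_complex_starting_at_edge:
  assumes xs: "distinct xs" and e: "{b,c} \<in> cycle_complex xs" "b \<noteq> c"
  obtains ys where "distinct ys" "length ys = length xs" "cycle_complex ys = cycle_complex xs"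
    "{hd ys, last ys} = {b,c}"
proof (cases "{b,c} \<in> path_complex xs")
  case False
  then have "{b,c} = {last xs, hd xs}" using e(1) by (simp add: cycle_complex_def)
  then show ?thesis using that[of xs] xs by (simp add: insert_commute)
next
  case True
  then obtain i where i: "Suc i < length xs" "{b,c} = {xs ! i, xs ! Suc i}"
    using path_complex_edge[OF xs True e(2)] by blast
  define ys where "ys = drop (Suc i) xs @ take (Suc i) xs"
  have "hd ys = xs ! Suc i" using i(1) by (simp add: ys_def hd_append hd_drop_conv_nth)
  moreover have "last ys = xs ! i" using i(1) by (auto simp: ys_def last_append last_conv_nth)
  moreover have "cycle_complex ys = cycle_complex xs"
    unfolding ys_def by (subst cycle_complex_rotate) simp
  moreover have "distinct ys" using xs set_take_disj_set_drop_if_distinct[OF xs order_refl, of "Suc i"]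
    by (auto simp: ys_def)
  ultimately show ?thesis using that[of ys] i by (simp add: ys_def insert_commute)
qed

text \<open>Here the closed star and the two cones are compared with \<open>D\<close>. The index is
  shifted because list positions start at 0: \<open>xs ! (k - 1)\<close> is the k-th vertex of the
  cycle and belongs to both arcs.\<close>

lemma star_split_of_cycle:
  assumes thin: "thin_complex \<Delta>" and v: "v \<in> \<Union>\<Delta>" and v': "v' \<notin> \<Union>\<Delta>"
    and xs: "distinct xs" "3 \<le> length xs" and link: "link \<Delta> v = cycle_complex xs"
    and k: "2 \<le> k" "k \<le> length xs"
  shows "star_split \<Delta> v v' (hd xs) (xs ! (k - 1)) (take k xs) (drop (k - 1) xs @ [hd xs])"
    (is ?split)
    and "(\<Delta> - closed_star \<Delta> v)
              \<union> cone_over v (cycle_complex (take k xs @ [v']))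
              \<union> cone_over v' (cycle_complex (drop (k - 1) xs @ [hd xs, v]))
       = star_split.D \<Delta> v v' (hd xs) (xs ! (k - 1)) (take k xs) (drop (k - 1) xs @ [hd xs])"
    (is "?\<Delta>' = _")
proof -
  note fin = thin_complex_complex[OF thin]
  define as q bs where "as = take (k - 1) xs" and "q = xs ! (k - 1)" and "bs = drop k xs"
  have kk: "k - 1 < length xs" "Suc (k - 1) = k" using k by auto
  have xs_eq: "xs = as @ q # bs" unfolding as_def q_def bs_def
    using id_take_nth_drop[OF kk(1)] kk(2) by simp
  have take: "take k xs = as @ [q]" unfolding as_def q_def
    using take_Suc_conv_app_nth[OF kk(1)] kk(2) by simp
  have drop: "drop (k - 1) xs = q # bs" unfolding bs_def q_def
    using Cons_nth_drop_Suc[OF kk(1)] kk(2) by simp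
  have as_ne: "as \<noteq> []" using k by (auto simp: as_def)
  define p where "p = hd xs"
  have p: "p = hd as" using as_ne by (simp add: p_def xs_eq)
  define ys1 ys2 where "ys1 = as @ [q]" and "ys2 = q # bs @ [p]"
  have p_in: "p \<in> set as" using p as_ne by simp
  have pq: "p \<noteq> q" "p \<notin> set bs" using xs(1) p_in by (auto simp: xs_eq)
  have link': "link \<Delta> v = path_complex ys1 \<union> path_complex ys2"
  proof -
    have "link \<Delta> v = path_complex (xs @ [p])"
      unfolding link p_def using xs(2) by (intro cycle_complex_closed_path) auto
    also have "\<dots> = path_complex (as @ [q]) \<union> path_complex (q # (bs @ [p]))"
      unfolding xs_eq by (simp, rule path_complex_append)
    finally show ?thesis by (simp add: ys1_def ys2_def)
  qed
  have d1: "distinct ys1" "distinct ys2" using xs(1) pq by (auto simp: ys1_def ys2_def xs_eq)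
  have l: "2 \<le> length ys1" "2 \<le> length ys2" using as_ne by (cases as; simp add: ys1_def ys2_def)+
  have inter_v: "set ys1 \<inter> set ys2 = {p,q}" using xs(1) p_in by (auto simp: ys1_def ys2_def xs_eq)
  have inter: "path_complex ys1 \<inter> path_complex ys2 = {{p},{q}}"
  proof (intro equalityI subsetI)
    fix X assume X: "X \<in> path_complex ys1 \<inter> path_complex ys2"
    then have "X \<subseteq> {p,q}" "X \<noteq> {}"
      using path_complex_subset[of X ys1] path_complex_subset[of X ys2] inter_v path_complex_nonempty by blast+
    then consider "X = {p}" | "X = {q}" | "X = {p,q}" by blast
    then show "X \<in> {{p},{q}}"
    proof cases
      \<comment> \<open>A common edge on \<open>p\<close> and \<open>q\<close> would force each arc
        to be that single edge, and the cycle would have only two vertices.\<close>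
      case 3
      have e: "{p,q} \<in> path_complex ys1" "{q,p} \<in> path_complex ys2" using X 3 by (simp_all add: insert_commute)
      have "as = [p]"
      proof (cases as rule: remdups_adj.cases)
        case (3 x y zs)
        have "{p,q} \<notin> path_complex (y # zs @ [q])"
          using path_complex_subset[of "{p,q}" "y # zs @ [q]"] d1(1) pq(1) by (auto simp: ys1_def 3 p)
        then show ?thesis using e(1) d1(1) pq(1) by (auto simp: ys1_def 3 p path_complex_Cons2 doubleton_eq_iff)
      qed (use as_ne p in auto)
      moreover have "bs = []"
      proof (cases bs)
        case (Cons y zs)
        have "{q,p} \<notin> path_complex (y # zs @ [p])"
          using path_complex_subset[of "{q,p}" "y # zs @ [p]"] d1(2) by (auto simp: ys2_def Cons)
        then show ?thesis using e(2) d1(2) pq(1) by (auto simp: ys2_def Cons path_complex_Cons2 doubleton_eq_iff)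
      qed
      ultimately have "length xs = 2" by (simp add: xs_eq)
      then show ?thesis using xs(2) by simp
    qed auto
  next
    fix X assume "X \<in> {{p},{q}}"
    then show "X \<in> path_complex ys1 \<inter> path_complex ys2"
      using inter_v by (auto simp: singleton_in_path_complex)
  qed
  have sp: "star_split \<Delta> v v' p q ys1 ys2"
  proof
    show "{v} \<in> \<Delta>" using v simplex_face[OF fin] by blast
  qed (use thin v' pq d1 l link' inter in auto)
  have t': "take k xs = ys1" "drop (k - 1) xs @ [hd xs] = ys2"
    unfolding take drop by (simp_all add: ys1_def ys2_def p_def)
  show ?split unfolding t' using sp by (simp add: p_def q_def)
  interpret star_split \<Delta> v v' p q ys1 ys2 by (rule sp)
  have c1: "cycle_complex (take k xs @ [v']) = L1 \<union> {{v'}, {q,v'}, {v',p}}"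
  proof -
    have "hd (ys1 @ [v']) = p" using p as_ne by (simp add: ys1_def)
    then show ?thesis unfolding t' cycle_complex_def
      by (subst path_complex_snoc) (auto simp: ys1_def)
  qed
  have c2: "cycle_complex (drop (k - 1) xs @ [hd xs, v]) = L2 \<union> {{v}, {p,v}, {v,q}}"
  proof -
    have "drop (k - 1) xs @ [hd xs, v] = ys2 @ [v]" using t'(2) by simp
    then show ?thesis unfolding cycle_complex_def
      by (simp only:, subst path_complex_snoc) (auto simp: ys2_def)
  qed
  have "?\<Delta>' = D"
  proof (rule set_eqI)
    fix X
    have cs: "X \<in> closed_star \<Delta> v \<longleftrightarrow> X \<in> L1 \<or> X \<in> L2" if "v \<notin> X" "X \<in> \<Delta>"
    proof
      assume "X \<in> closed_star \<Delta> v"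
      then obtain Z where Z: "Z \<in> \<Delta>" "v \<in> Z" "X \<subseteq> Z" "X \<noteq> {}" by (auto simp: closed_star_def)
      then have "insert v X \<in> \<Delta>" using simplex_face[OF fin Z(1), of "insert v X"] by blast
      then show "X \<in> L1 \<or> X \<in> L2" using in_L that(1) Z(4) by blast
    next
      assume "X \<in> L1 \<or> X \<in> L2"
      then have "insert v X \<in> \<Delta>" using L_link by blast
      moreover have "X \<noteq> {}" using simplex_nonempty[OF fin that(2)] .
      ultimately show "X \<in> closed_star \<Delta> v" unfolding closed_star_def by blast
    qed
    have cv: "X \<in> closed_star \<Delta> v" if "v \<in> X" "X \<in> \<Delta>" using that by (auto simp: closed_star_def)
    \<comment> \<open>Each cone is written out as a disjunction of shapes, so that sorting
      \<open>X\<close> by the copies it contains leaves purely propositional problems.\<close>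
    have m1: "X \<in> cone_over v (cycle_complex (take k xs @ [v'])) \<longleftrightarrow>
        X \<in> L1 \<or> X = {v'} \<or> X = {q,v'} \<or> X = {v',p} \<or> (\<exists>Y\<in>L1. X = insert v Y)
          \<or> X = {v,v'} \<or> X = {v,q,v'} \<or> X = {v,v',p} \<or> X = {v}"
      unfolding c1 cone_over_def image_Un image_insert image_empty Un_iff insert_iff empty_iff image_iff
      by argo
    have m2: "X \<in> cone_over v' (cycle_complex (drop (k - 1) xs @ [hd xs, v])) \<longleftrightarrow>
        X \<in> L2 \<or> X = {v} \<or> X = {p,v} \<or> X = {v,q} \<or> (\<exists>Y\<in>L2. X = insert v' Y)
          \<or> X = {v',v} \<or> X = {v',p,v} \<or> X = {v',v,q} \<or> X = {v'}"
      unfolding c2 cone_over_def image_Un image_insert image_empty Un_iff insert_iff empty_iff image_iff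
      by argo
    have vL: "X \<in> L1 \<longrightarrow> v \<notin> X \<and> v' \<notin> X \<and> X \<in> \<Delta>" "X \<in> L2 \<longrightarrow> v \<notin> X \<and> v' \<notin> X \<and> X \<in> \<Delta>"
      using L_link[of X] by blast+
    have v'\<Delta>: "X \<in> \<Delta> \<longrightarrow> v' \<notin> X" using v' by blast
    have cs': "v \<notin> X \<and> X \<in> \<Delta> \<longrightarrow> (X \<in> closed_star \<Delta> v \<longleftrightarrow> X \<in> L1 \<or> X \<in> L2)" using cs by blast
    have cv': "v \<in> X \<and> X \<in> \<Delta> \<longrightarrow> X \<in> closed_star \<Delta> v" using cv by blast
    have in_v: "X = {v} \<or> X = {p,v} \<or> X = {v,q} \<longrightarrow> v \<in> X \<and> v' \<notin> X"
      and in_v': "X = {v'} \<or> X = {q,v'} \<or> X = {v',p} \<longrightarrow> v \<notin> X \<and> v' \<in> X"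
      and in_vv': "X = {v,v'} \<or> X = {v,q,v'} \<or> X = {v,v',p} \<or> X = {v',v} \<or> X = {v',p,v} \<or> X = {v',v,q}
         \<longrightarrow> v \<in> X \<and> v' \<in> X"
      using vv' pq_v by auto
    have in_1: "(\<exists>Y\<in>L1. X = insert v Y) \<longrightarrow> v \<in> X \<and> v' \<notin> X"
      and in_2: "(\<exists>Y\<in>L2. X = insert v' Y) \<longrightarrow> v \<notin> X \<and> v' \<in> X"
      using L_link vv' by auto
    have pq1: "X = {p,v} \<or> X = {v,q} \<longrightarrow> (\<exists>Y\<in>L1. X = insert v Y)"
      and pq2: "X = {q,v'} \<or> X = {v',p} \<longrightarrow> (\<exists>Y\<in>L2. X = insert v' Y)"
      using pq_L by auto
    have cm: "{v,q,v'} = {v,v',q}" "{v',p,v} = {v,v',p}" "{v',v,q} = {v,v',q}" "{v',v} = {v,v'}" by blast+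
    show "X \<in> ?\<Delta>' \<longleftrightarrow> X \<in> D"
    proof (cases X rule: simplex_cases)
      case 1
      have "X \<in> ?\<Delta>' \<longleftrightarrow> X \<in> \<Delta>" unfolding Un_iff Diff_iff m1 m2
        using 1 cs' vL in_v in_v' in_vv' in_1 in_2 by argo
      then show ?thesis using D_none 1 by blast
    next
      case (2 Y)
      then have s: "v \<in> X" "v' \<notin> X" using vv' by auto
      have "X \<in> ?\<Delta>' \<longleftrightarrow> (\<exists>Y\<in>L1. X = insert v Y) \<or> X = {v}" unfolding Un_iff Diff_iff m1 m2
        using s cv' vL in_v' in_vv' in_2 pq1 by argo
      also have "\<dots> \<longleftrightarrow> Y \<in> insert {} L1"
      proof -
        have "Y = Z" if "Z \<in> L1" "X = insert v Z" for Z
          using that 2 L_link[of Z] by (metis UnI1 insert_ident)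
        moreover have "X = {v} \<longleftrightarrow> Y = {}" using 2 by auto
        ultimately show ?thesis using 2(1) by blast
      qed
      finally show ?thesis using D_v[OF 2(2,3)] 2(1) by simp
    next
      case (3 Y)
      then have s: "v \<notin> X" "v' \<in> X" using vv' by auto
      have "X \<in> ?\<Delta>' \<longleftrightarrow> (\<exists>Y\<in>L2. X = insert v' Y) \<or> X = {v'}" unfolding Un_iff Diff_iff m1 m2
        using s v'\<Delta> vL in_v in_vv' in_1 pq2 by argo
      also have "\<dots> \<longleftrightarrow> Y \<in> insert {} L2"
      proof -
        have "Y = Z" if "Z \<in> L2" "X = insert v' Z" for Z
          using that 3 L_link[of Z] by (metis UnI2 insert_ident)
        moreover have "X = {v'} \<longleftrightarrow> Y = {}" using 3 by auto
        ultimately show ?thesis using 3(1) by blast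
      qed
      finally show ?thesis using D_v'[OF 3(2,3)] 3(1) by simp
    next
      case (4 Y)
      then have s: "v \<in> X" "v' \<in> X" by auto
      have "X \<in> ?\<Delta>' \<longleftrightarrow> X = {v,v'} \<or> X = {v,v',p} \<or> X = {v,v',q}" unfolding Un_iff Diff_iff m1 m2 cm
        using s v'\<Delta> vL in_v in_v' in_1 in_2 by argo
      also have "\<dots> \<longleftrightarrow> Y \<in> {{},{p},{q}}"
      proof -
        have "insert v (insert v' Y) = insert v (insert v' Z) \<longleftrightarrow> Y = Z" if "v \<notin> Z" "v' \<notin> Z" for Z
          using 4(2,3) that vv' by (metis insert_ident insert_iff)
        from this[of "{}"] this[of "{p}"] this[of "{q}"] show ?thesis using 4(1) pq_v by auto
      qed
      finally show ?thesis using D_vv'[OF 4(2,3)] 4(1) by simp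
    qed
  qed
  then show "?\<Delta>' = star_split.D \<Delta> v v' (hd xs) (xs ! (k - 1)) (take k xs) (drop (k - 1) xs @ [hd xs])"
    unfolding t' by (simp add: p_def q_def)
qed

section \<open>Extendibility under vertex splits\<close>

lemma vertex_split_star_split:
  assumes "thin_complex \<Delta>" "vertex_split \<Delta> v v' \<Delta>'"
  obtains p q ys1 ys2 where "star_split \<Delta> v v' p q ys1 ys2" "\<Delta>' = star_split.D \<Delta> v v' p q ys1 ys2"
proof -
  obtain xs k where x: "v \<in> \<Union>\<Delta>" "v' \<notin> \<Union>\<Delta>" "distinct xs" "3 \<le> length xs" "link \<Delta> v = cycle_complex xs"
    "1 \<le> k" "k \<le> length xs" "k \<noteq> 1"
    "\<Delta>' = (\<Delta> - closed_star \<Delta> v)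
              \<union> cone_over v (cycle_complex (take k xs @ [v']))
              \<union> cone_over v' (cycle_complex (drop (k - 1) xs @ [hd xs, v]))"
    using assms(2) unfolding vertex_split_def by blast
  have k: "2 \<le> k" using x by simp
  show ?thesis
    using that[OF star_split_of_cycle(1)[OF assms(1) x(1-5) k x(7)]]
      star_split_of_cycle(2)[OF assms(1) x(1-5) k x(7)] x(9) by metis
qed

text \<open>The output reproduces for \<Delta>' and \<open>S'\<close> what was assumed of \<Delta>
  and \<open>S\<close>: a thin complex and a spanning combinatorial surface that meets every
  triangle. So the extension can itself be extended in the next split.\<close>

lemma good_extension_of_vertex_split:
  assumes thin: "thin_complex \<Delta>" and S: "comb_surface S" "S \<subseteq> \<Delta>" "meets_triangles \<Delta> S" "\<Union>\<Delta> \<subseteq> \<Union>S"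
    and split: "vertex_split \<Delta> v v' \<Delta>'"
  obtains S' where "extension \<Delta>' v v' S S'" "thin_complex \<Delta>'" "comb_surface S'" "S' \<subseteq> \<Delta>'"
    "meets_triangles \<Delta>' S'" "\<Union>\<Delta>' \<subseteq> \<Union>S'"
proof -
  obtain p q ys1 ys2 where sp: "star_split \<Delta> v v' p q ys1 ys2"
    and D: "\<Delta>' = star_split.D \<Delta> v v' p q ys1 ys2"
    using vertex_split_star_split[OF thin split] .
  interpret star_split \<Delta> v v' p q ys1 ys2 by (rule sp)
  interpret spanned_split \<Delta> v v' p q ys1 ys2 S
    by unfold_locales (use S in auto)
  obtain S' where S': "extension_by_split v v' S S' \<or> extension_by_cone v v' S S'"
    "comb_surface S'" "S' \<subseteq> D" "\<Union>D \<subseteq> \<Union>S'" "meets_triangles D S'"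
    using good_extension .
  have "subsurface D S'"
    unfolding subsurface_def using S'(3) comb_surface_complex[OF S'(2)]
      comb_surface_imp_surface[OF S'(2)] by blast
  then have "extension D v v' S S'" unfolding extension_def using S'(1) by blast
  then show ?thesis using that[of S'] S'(2-5) thin_D unfolding D by blast
qed

lemma meets_triangles_imp_extendible:
  assumes "thin_complex \<Delta>" "comb_surface S" "S \<subseteq> \<Delta>" "meets_triangles \<Delta> S" "\<Union>\<Delta> \<subseteq> \<Union>S"
  shows "extendible \<Delta> S"
  unfolding extendible_def vertex_spanning_subsurface_def subsurface_def
  using assms comb_surface_complex comb_surface_imp_surface
  by (auto elim: good_extension_of_vertex_split)

lemma subsurface_combinatorial: "subsurface \<Delta> S \<Longrightarrow> comb_surface S"
  unfolding subsurface_def using surface_imp_comb_surface by blast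

text \<open>In the chosen split the arc of \<open>a'\<close> is the single edge on \<open>b\<close>
  and \<open>c\<close>. In a split extension the new edge needs a triangle, whose third vertex is
  \<open>b\<close> or \<open>c\<close>; contraction puts the edge from \<open>a\<close> to that
  vertex into \<open>S\<close>. In a cone extension a triangle at \<open>a'\<close> can only stand
  over the edge on \<open>b\<close> and \<open>c\<close> or contain the new edge, and this forces an
  edge of \<open>T\<close> into \<open>S\<close>, whether \<open>a'\<close> is the apex or takes
  over the role of \<open>a\<close>.\<close>

lemma extendible_imp_meets_triangles:
  fixes \<Delta> S :: "'a::infinite set set"
  assumes \<Delta>: "comb_surface \<Delta>" and bd: "surface_boundary (realization_space \<Delta>) = {}"
    and ext: "extendible \<Delta> S"
  shows "meets_triangles \<Delta> S"
  unfolding meets_triangles_def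
proof (intro ballI impI, rule ccontr)
  fix T assume T: "T \<in> \<Delta>" "card T = 3" and no: "\<not> (\<exists>e\<in>S. card e = 2 \<and> e \<subseteq> T)"
  note thin = comb_surface_thin[OF \<Delta>]
  note fin = comb_surface_complex[OF \<Delta>]
  have sS: "subsurface \<Delta> S" and span: "\<Union>\<Delta> \<subseteq> \<Union>S"
    using ext by (simp_all add: extendible_def vertex_spanning_subsurface_def)
  have S: "comb_surface S" by (rule subsurface_combinatorial[OF sS])
  have sub: "S \<subseteq> \<Delta>" using sS by (simp add: subsurface_def)
  obtain a b c where abc: "T = {a,b,c}" "a \<noteq> b" "b \<noteq> c" "a \<noteq> c" using T(2) by (metis card_3_iff)
  have nab: "{x,y} \<notin> S" if "x \<in> T" "y \<in> T" "x \<noteq> y" for x y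
    using no that by (metis card_2_iff empty_subsetI insert_subset)
  have a: "{a} \<in> \<Delta>" using simplex_face[OF fin T(1)] abc by blast
  obtain xs0 where xs0: "distinct xs0" "a \<notin> set xs0" "3 \<le> length xs0" "link \<Delta> a = cycle_complex xs0"
    using closed_surface_link[OF \<Delta> bd a] .
  have "{b,c} \<in> link \<Delta> a" using abc T by (simp add: link_def)
  then obtain xs where xs: "distinct xs" "length xs = length xs0" "cycle_complex xs = cycle_complex xs0"
    "{hd xs, last xs} = {b,c}"
    using cycle_complex_starting_at_edge[OF xs0(1)] xs0(4) abc(3) by metis
  have len: "3 \<le> length xs" and lk: "link \<Delta> a = cycle_complex xs" using xs xs0 by simp_all
  have "finite (\<Union>\<Delta>)" using fin by (auto simp: finite_simplicial_complex_def)
  \<comment> \<open>Infinitely many labels guarantee a fresh vertex. Without one there would be no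
    split at all, and the condition on splits would hold vacuously.\<close>
  then obtain a' where a': "a' \<notin> \<Union>\<Delta>" using ex_new_if_finite[OF infinite_UNIV] by blast
  \<comment> \<open>The largest index cuts the link at \<open>last xs\<close> and
    \<open>hd xs\<close>, that is at \<open>b\<close> and \<open>c\<close>; the second arc is then
    just the edge between them.\<close>
  define k where "k = length xs"
  have k: "2 \<le> k" "k \<le> length xs" using len by (simp_all add: k_def)
  have aU: "a \<in> \<Union>\<Delta>" using a by blast
  define p q ys1 ys2 where "p = hd xs" and "q = xs ! (k - 1)" and "ys1 = take k xs"
    and "ys2 = drop (k - 1) xs @ [hd xs]"
  note sp = star_split_of_cycle[OF thin aU a' xs(1) len lk k, folded p_def q_def ys1_def ys2_def]
  interpret star_split \<Delta> a a' p q ys1 ys2 by (rule sp(1))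
  have "vertex_split \<Delta> a a' D"
    unfolding vertex_split_def
    using aU a' xs(1) len lk k sp(2)[symmetric] unfolding ys1_def ys2_def p_def q_def
    by (intro conjI exI[of _ xs] exI[of _ k]) (assumption | linarith)+
  then obtain S' where S': "extension D a a' S S'" using ext unfolding extendible_def by blast
  then have S'D: "S' \<subseteq> D" and cS': "comb_surface S'"
    by (auto simp: extension_def subsurface_combinatorial) (auto simp: subsurface_def)
  have "xs \<noteq> []" using len by auto
  then have q: "q = last xs" by (simp add: q_def k_def last_conv_nth)
  have pqT: "{p,q} = {b,c}" using xs(4) by (simp add: p_def q)
  then have "p \<in> T" "q \<in> T" "p \<noteq> a" "q \<noteq> a" using abc by (auto simp: doubleton_eq_iff)
  then have pq': "{a,p} \<notin> S" "{a,q} \<notin> S" "{p,q} \<notin> S"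
    using nab[of a p] nab[of a q] nab[of p q] abc(1) pq by blast+
  have "drop (length xs - 1) xs = [last xs]"
    by (metis append_butlast_last_id append_eq_conv_conj length_butlast \<open>xs \<noteq> []\<close>)
  then have ys2: "ys2 = [q,p]" by (simp add: ys2_def k_def q p_def)
  have L2: "{x,y} = {p,q}" if "{x,y} \<in> L2" "x \<noteq> y" for x y
    using that unfolding ys2 by (auto simp: path_complex_Cons2 path_complex_single doubleton_eq_iff)
  from S' consider "extension_by_split a a' S S'" | "extension_by_cone a a' S S'"
    unfolding extension_def by blast
  then show False
  proof cases
    case 1
    then have e: "{a,a'} \<in> S'" and r: "rename_vertex a' a S' = S" by (auto simp: extension_by_split_def)
    obtain y where y: "tri S' a a' y" using comb_surface_edge_triangle[OF cS' e vv'] .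
    then have yy: "{a,a',y} \<in> S'" "y \<noteq> a'" "y \<noteq> a" by (auto simp: tri_def)
    have "tri D a a' y" using y S'D by (auto simp: tri_def)
    then have ypq: "y = p \<or> y = q" by (simp add: tri_D_vv')
    have "(\<lambda>x. if x = a' then a else x) ` {a,a',y} \<in> S"
      unfolding r[symmetric] rename_vertex_def using yy(1) by (rule imageI)
    moreover have "(\<lambda>x. if x = a' then a else x) ` {a,a',y} = {a,y}" using yy vv' by auto
    ultimately show False using ypq pq' by auto
  next
    case 2
    then obtain w w' zs where w: "(w,w') \<in> {(a,a'),(a',a)}" and zs: "distinct zs" "2 \<le> length zs"
      and zb: "realization (path_complex zs) \<subseteq> surface_boundary (realization_space (rename_vertex a w S))"
      and S'_eq: "S' = rename_vertex a w S \<union> cone_over w' (path_complex zs)"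
      unfolding extension_by_cone_def by blast
    show False
    proof (cases "w = a")
      case True
      then have w': "w' = a'" and rS: "rename_vertex a w S = S" using w vv' by (auto simp: rename_vertex_def)
      obtain x y where xy: "x \<noteq> y" "{x,y} \<in> path_complex zs"
      proof -
        have "hd zs \<in> set zs" using zs(2) by (intro hd_in_set) auto
        then show ?thesis using that path_complex_neighbour[OF zs] by metis
      qed
      have xyS: "{x,y} \<in> S"
      proof -
        \<comment> \<open>The midpoint of an edge of the base is a boundary point of
          \<open>S\<close>, hence a point of its realization, so its support \<open>{x,y}\<close> is
          a simplex of \<open>S\<close>.\<close>
        define f :: "'a \<Rightarrow> real" where "f u = (if u = x \<or> u = y then 1/2 else 0)" for u
        have "{u. f u \<noteq> 0} = {x,y}" by (auto simp: f_def)
        then have "f \<in> realization (path_complex zs)" using xy by (simp add: realization_def f_def)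
        then have "f \<in> realization S" using zb unfolding rS surface_boundary_def by auto
        from realization_support[OF this] show ?thesis using \<open>{u. f u \<noteq> 0} = {x,y}\<close> by simp
      qed
      have big: "insert a' {x,y} \<in> D" using S'D xy(2) unfolding S'_eq w' cone_over_def by blast
      have a'xy: "a' \<notin> {x,y}" using xyS sub a' by blast
      show False
      proof (cases "a \<in> {x,y}")
        case False
        then have "{x,y} \<in> L2" using big D_v'[of "{x,y}"] a'xy by auto
        then show False using L2 xy(1) xyS pq' by metis
      next
        case True
        then obtain z where z: "{x,y} = {a,z}" "z \<noteq> a" using xy(1) by blast
        then have "tri D a a' z" using big a'xy vv' by (auto simp: tri_def insert_commute)
        then have "z = p \<or> z = q" by (simp add: tri_D_vv')
        then show False using xyS z pq' by auto
      qed
    next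
      case False
      then have w': "w = a'" using w by blast
      \<comment> \<open>As \<open>S\<close> is spanning it has a triangle at \<open>a\<close>. The
        relabelling moves this triangle to \<open>a'\<close>, where it can only stand over the edge
        on \<open>p\<close> and \<open>q\<close>.\<close>
      have "{a} \<in> S" using span aU simplex_face[OF comb_surface_complex[OF S]] by blast
      then obtain F where F: "F \<in> S" "{a} \<subseteq> F" "card F = 3" using comb_surface_pure[OF S] by blast
      then have "card (F - {a}) = 2" by (simp add: card_Diff_subset)
      then obtain x y where xy: "F - {a} = {x,y}" "x \<noteq> y" by (metis card_2_iff)
      then have F': "F = insert a {x,y}" "a \<notin> {x,y}" "a' \<notin> {x,y}" using F a' sub by blast+
      have "(\<lambda>u. if u = a then w else u) ` F \<in> S'"
        unfolding S'_eq rename_vertex_def using F(1) by blast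
      moreover have "(\<lambda>u. if u = a then w else u) ` F = insert a' {x,y}"
        unfolding F'(1) w' by (rule rename_simplex_insert[OF F'(2)])
      ultimately have "insert a' {x,y} \<in> D" using S'D by auto
      then have "{x,y} \<in> L2" using D_v'[OF F'(2,3)] by blast
      then have "{x,y} = {p,q}" using L2 xy(2) by blast
      then have "{a,p} \<in> S" using simplex_face[OF comb_surface_complex[OF S] F(1), of "{a,p}"] F'(1)
        by blast
      then show False using pq' by blast
    qed
  qed
qed

theorem theorem3p2:
  fixes \<Delta> S :: "'a::infinite set set"
  assumes "triangulation_of_closed_connected_surface \<Delta>"
    and "vertex_spanning_subsurface \<Delta> S"
  shows "(extendible \<Delta> S \<longleftrightarrow>
            (\<forall>T\<in>\<Delta>. card T = 3 \<longrightarrow> (\<exists>e\<in>S. card e = 2 \<and> e \<subseteq> T))) \<and>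
         (\<forall>v v' \<Delta>'. vertex_split \<Delta> v v' \<Delta>' \<and> extendible \<Delta> S \<longrightarrow>
            (\<exists>S'. extension \<Delta>' v v' S S' \<and> extendible \<Delta>' S'))"
proof -
  have \<Delta>: "comb_surface \<Delta>" and bd: "surface_boundary (realization_space \<Delta>) = {}"
    using assms(1) surface_imp_comb_surface
    by (auto simp: triangulation_of_closed_connected_surface_def compact_connected_surface_without_boundary_def)
  note thin = comb_surface_thin[OF \<Delta>]
  have sS: "subsurface \<Delta> S" and span: "\<Union>\<Delta> \<subseteq> \<Union>S"
    using assms(2) by (simp_all add: vertex_spanning_subsurface_def)
  have S: "comb_surface S" "S \<subseteq> \<Delta>"
    using subsurface_combinatorial[OF sS] sS by (simp_all add: subsurface_def)
  have iff: "extendible \<Delta> S \<longleftrightarrow> meets_triangles \<Delta> S"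
    using extendible_imp_meets_triangles[OF \<Delta> bd] meets_triangles_imp_extendible[OF thin S _ span] by blast
  have "\<exists>S'. extension \<Delta>' v v' S S' \<and> extendible \<Delta>' S'"
    if split: "vertex_split \<Delta> v v' \<Delta>'" and e: "extendible \<Delta> S" for v v' \<Delta>'
  proof -
    obtain S' where S': "extension \<Delta>' v v' S S'" "thin_complex \<Delta>'" "comb_surface S'" "S' \<subseteq> \<Delta>'"
      "meets_triangles \<Delta>' S'" "\<Union>\<Delta>' \<subseteq> \<Union>S'"
      using good_extension_of_vertex_split[OF thin S _ span split] e iff by blast
    then show ?thesis using meets_triangles_imp_extendible[OF S'(2-6)] by blast
  qed
  then show ?thesis using iff unfolding meets_triangles_def by blast
qed

end
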